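(* Let $n\ge 3$ be an integer. For a graph $G$ on the vertex set $[n]$, the pair of characteristic polynomials $(\phi^G,\phi^{\overline{G}})$ can be efficiently reconstructed from the generalized polynomial deck $\{(\phi^{G\setminus i},\phi^{\overline{G}\setminus i})\}_{i\in[n]}$, and the reconstruction algorithm only requires $\phi^{G\setminus i}$ and the top $\lceil\frac{n+4}{2}\rceil$ coefficients of $\phi^{\overline{G}\setminus i}$ for every $i\in[n]$. That is: there is an algorithm, running in time polynomial in $n$, which for every graph $G$ on $[n]$, given as input the multiset over $i\in[n]$ of the pairs consisting of $\phi^{G\setminus i}$ and the top $\lceil\frac{n+4}{2}\rceil$ coefficients of $\phi^{\overline{G}\setminus i}$, outputs $(\phi^G,\phi^{\overline{G}})$. (In particular, two graphs on $[n]$ with the same such multiset have the same pair of characteristic polynomials.)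
   Context: Graphs are finite, simple and undirected. For a graph $G$ with vertex set $[n]=\{1,\dots,n\}$ and adjacency matrix $A$, the characteristic polynomial is $\phi^G(x)=\det(xI-A)$. $\overline{G}$ denotes the complement of $G$, with adjacency matrix $\overline{A}=J-I-A$, where $J$ is the all-ones matrix. $G\setminus i$ is the graph obtained by deleting vertex $i$, and $\overline{G}\setminus i=\overline{G\setminus i}$. The generalized polynomial deck of $G$ is the multiset of pairs $\{(\phi^{G\setminus i},\phi^{\overline{G}\setminus i})\}_{i\in[n]}$. The top $k$ coefficients of a monic polynomial of degree $d$ are the coefficients of $x^d,x^{d-1},\dots,x^{d-k+1}$ (all coefficients if $k>d+1$). "Efficiently" means by an algorithm running in time polynomial in $n$. *)

theory Defs
  imports
    "HOL-Library.Multiset"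
    "HOL-Library.Log_Nat"
    "Graph_Theory.Pair_Digraph"
    "Jordan_Normal_Form.Char_Poly"
begin

section \<open>Graphs, characteristic polynomials and the deck\<close>

text \<open>
  A finite simple undirected graph is a \<open>pair_graph\<close>, i.e. a finite, loop-free digraph with
  a symmetric arc relation.
\<close>

definition complement_graph :: "'a pair_pre_digraph \<Rightarrow> 'a pair_pre_digraph" where
  "complement_graph G =
     \<lparr> pverts = pverts G,
       parcs = {(u, v). u \<in> pverts G \<and> v \<in> pverts G \<and> u \<noteq> v \<and> (u, v) \<notin> parcs G} \<rparr>"

definition delete_vertex :: "'a pair_pre_digraph \<Rightarrow> 'a \<Rightarrow> 'a pair_pre_digraph" where
  "delete_vertex G i =
     \<lparr> pverts = pverts G - {i}, parcs = {(u, v) \<in> parcs G. u \<noteq> i \<and> v \<noteq> i} \<rparr>"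

text \<open>Rows and columns are indexed from 0 by the vertices in increasing order.\<close>

definition adjacency_matrix :: "'a::linorder pair_pre_digraph \<Rightarrow> int mat" where
  "adjacency_matrix G =
     (let vs = sorted_list_of_set (pverts G)
      in mat (length vs) (length vs) (\<lambda>(i, j). if (vs ! i, vs ! j) \<in> parcs G then 1 else 0))"

definition graph_char_poly :: "'a::linorder pair_pre_digraph \<Rightarrow> int poly" where
  "graph_char_poly G = char_poly (adjacency_matrix G)"

text \<open>
  The top \<open>k\<close> coefficients, from the leading one downwards; all of them if
  \<open>k > degree p + 1\<close>.
\<close>

definition top_coeffs :: "nat \<Rightarrow> int poly \<Rightarrow> int list" where
  "top_coeffs k p = map (\<lambda>j. coeff p (degree p - j)) [0..<min k (degree p + 1)]"

definition num_top_coeffs :: "nat \<Rightarrow> nat" where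
  "num_top_coeffs n = nat \<lceil>(real n + 4) / 2\<rceil>"

definition truncated_deck ::
    "nat \<Rightarrow> 'a::linorder pair_pre_digraph \<Rightarrow> (int poly \<times> int list) multiset" where
  "truncated_deck k G =
     {# (graph_char_poly (delete_vertex G i),
         top_coeffs k (graph_char_poly (complement_graph (delete_vertex G i)))).
        i \<in># mset_set (pverts G) #}"


section \<open>A model of computation with logarithmic cost\<close>

text \<open>
  Algorithms are programs of a random access machine over the integers, presented with structured
  control flow. The memory of the machine is divided into arrays, of which a program can name only
  finitely many; every array has a cell for each integer index. The cost measure is the
  logarithmic one: evaluating an expression costs the sum of the bit sizes of the values of all its
  subexpressions, so that every address used, every value read or written and every operand and
  result of an arithmetic operation is charged by its size. A multitape Turing machine can carry
  out each primitive operation in time polynomial in the charged sizes and the current size of the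
  memory, so a run of cost \<open>t\<close> on an input of size \<open>m\<close> is simulated in time polynomial in \<open>t + m\<close>
  (and conversely), and polynomial time has its usual meaning.
\<close>

type_synonym aname = string
type_synonym state = "aname \<Rightarrow> int \<Rightarrow> int"

datatype aexp =
    Const int
  | Cell aname aexp
  | Add aexp aexp
  | Sub aexp aexp
  | Mul aexp aexp
  | Div aexp aexp

datatype com =
    Skip
  | Assign aname aexp aexp
  | Seq com com
  | IfPos aexp com com
  | WhilePos aexp com

text \<open>
  \<open>Assign x a b\<close> stores the value of \<open>b\<close> in the cell of the array \<open>x\<close> whose index is the value
  of \<open>a\<close>. The tests of \<open>IfPos\<close> and \<open>WhilePos\<close> ask whether the value is positive.
\<close>

fun aval :: "aexp \<Rightarrow> state \<Rightarrow> int" where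
  "aval (Const k) s = k"
| "aval (Cell x a) s = s x (aval a s)"
| "aval (Add a b) s = aval a s + aval b s"
| "aval (Sub a b) s = aval a s - aval b s"
| "aval (Mul a b) s = aval a s * aval b s"
| "aval (Div a b) s = aval a s div aval b s"

text \<open>One bit is charged for the sign, so that no value is free of charge.\<close>

definition bit_size :: "int \<Rightarrow> nat" where
  "bit_size k = nat (bitlen \<bar>k\<bar>) + 1"

fun acost :: "aexp \<Rightarrow> state \<Rightarrow> nat" where
  "acost (Const k) s = bit_size k"
| "acost (Cell x a) s = acost a s + bit_size (aval (Cell x a) s)"
| "acost (Add a b) s = acost a s + acost b s + bit_size (aval (Add a b) s)"
| "acost (Sub a b) s = acost a s + acost b s + bit_size (aval (Sub a b) s)"
| "acost (Mul a b) s = acost a s + acost b s + bit_size (aval (Mul a b) s)"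
| "acost (Div a b) s = acost a s + acost b s + bit_size (aval (Div a b) s)"

text \<open>\<open>exec c s t s'\<close>: started in \<open>s\<close>, the program \<open>c\<close> halts in \<open>s'\<close> after time \<open>t\<close>.\<close>

inductive exec :: "com \<Rightarrow> state \<Rightarrow> nat \<Rightarrow> state \<Rightarrow> bool" where
  Skip: "exec Skip s 1 s"
| Assign: "exec (Assign x a b) s (acost a s + acost b s) (s(x := (s x)(aval a s := aval b s)))"
| Seq: "exec c\<^sub>1 s t\<^sub>1 s' \<Longrightarrow> exec c\<^sub>2 s' t\<^sub>2 s'' \<Longrightarrow> exec (Seq c\<^sub>1 c\<^sub>2) s (t\<^sub>1 + t\<^sub>2) s''"
| IfTrue: "aval a s > 0 \<Longrightarrow> exec c\<^sub>1 s t s' \<Longrightarrow> exec (IfPos a c\<^sub>1 c\<^sub>2) s (acost a s + t) s'"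
| IfFalse: "aval a s \<le> 0 \<Longrightarrow> exec c\<^sub>2 s t s' \<Longrightarrow> exec (IfPos a c\<^sub>1 c\<^sub>2) s (acost a s + t) s'"
| WhileFalse: "aval a s \<le> 0 \<Longrightarrow> exec (WhilePos a c) s (acost a s) s"
| WhileTrue: "aval a s > 0 \<Longrightarrow> exec c s t\<^sub>1 s' \<Longrightarrow> exec (WhilePos a c) s' t\<^sub>2 s'' \<Longrightarrow>
    exec (WhilePos a c) s (acost a s + t\<^sub>1 + t\<^sub>2) s''"

definition array_of :: "int list \<Rightarrow> int \<Rightarrow> int" where
  "array_of xs i = (if 0 \<le> i \<and> i < int (length xs) then xs ! nat i else 0)"

definition initial_state :: "int list \<Rightarrow> state" where
  "initial_state xs = (\<lambda>_ _. 0)(''in'' := array_of xs)"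

definition computes_within :: "com \<Rightarrow> int list \<Rightarrow> int list \<Rightarrow> nat \<Rightarrow> bool" where
  "computes_within c xs ys T \<longleftrightarrow>
     (\<exists>t s. exec c (initial_state xs) t s \<and> t \<le> T \<and> s ''out'' = array_of ys)"


section \<open>Input and output encodings\<close>

text \<open>
  Lists carry a length prefix, because \<open>array_of\<close> by itself does not determine the length of its
  argument. Polynomials are given by their coefficients in increasing order of degree.
\<close>

definition encode_ints :: "int list \<Rightarrow> int list" where
  "encode_ints xs = int (length xs) # xs"

definition encode_poly :: "int poly \<Rightarrow> int list" where
  "encode_poly p = encode_ints (coeffs p)"

text \<open>
  A multiset is presented to a program as a list of its elements in some order; programs are
  required to work for all such orders.
\<close>

definition encode_deck :: "(int poly \<times> int list) list \<Rightarrow> int list" where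
  "encode_deck ds =
     int (length ds) # concat (map (\<lambda>(p, cs). encode_poly p @ encode_ints cs) ds)"

definition encode_poly_pair :: "int poly \<times> int poly \<Rightarrow> int list" where
  "encode_poly_pair = (\<lambda>(p, q). encode_poly p @ encode_poly q)"

end

theory Submission
  imports Defs "HOL-Computational_Algebra.Polynomial_FPS"
begin

text \<open>
  Let \<open>A\<close> be the adjacency matrix of \<open>G\<close>, let \<open>J\<close> be the all-ones matrix, and read characteristic
  polynomials backwards: \<open>f = det (I - zA)\<close>, and \<open>f\<^sub>i\<close> for the card without vertex \<open>i\<close>. The number of
  walks of length \<open>k\<close> starting in \<open>i\<close> is the coefficient of \<open>z\<^sup>k\<close> in a power series \<open>w\<^sub>i\<close>, and
  \<open>W = \<Sum>\<^sub>i w\<^sub>i\<close> counts all walks. The complement has adjacency matrix \<open>- (A - J) - I\<close>, so the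
  substitution of \<open>-1 - x\<close> for \<open>x\<close> exchanges its characteristic polynomial with that of \<open>A - J\<close>,
  both for \<open>G\<close> and for the cards, and it turns leading coefficients into leading coefficients. Write
  \<open>g = det (I - z(A - J))\<close> and \<open>g\<^sub>i\<close> for the determinant without row and column \<open>i\<close>.

  Rank-one updates of determinants give \<open>g = f (1 + z W)\<close> and \<open>g\<^sub>i = f\<^sub>i (1 + z W) - z f w\<^sub>i\<^sup>2\<close>, that is,
  \<open>f w\<^sub>i\<^sup>2 = W f\<^sub>i - (g\<^sub>i - f\<^sub>i) / z\<close> (lemma \<open>generating_functions_of_minors\<close>). The coefficient of \<open>z\<^sup>j\<close>
  in this identity determines \<open>w\<^sub>i\<close> up to order \<open>j\<close> from \<open>f\<close> and \<open>W\<close> up to order \<open>j\<close> and from the card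
  up to order \<open>j + 1\<close>, since \<open>w\<^sub>i\<close> has constant term 1 and can be extracted from its square term by
  term. On the other hand \<open>A\<close> is symmetric, so the number of walks of length \<open>j + k\<close> is the sum over
  \<open>i\<close> of the products of the coefficients of \<open>z\<^sup>j\<close> and \<open>z\<^sup>k\<close> in \<open>w\<^sub>i\<close> (lemma \<open>total_walks_add\<close>): local
  counts up to order \<open>j\<close> give global counts up to order \<open>2 j\<close>. This doubling is why the top half of
  the coefficients of the complements is enough. Starting from \<open>W\<close> up to order 1 and extending the
  local counts to order \<open>h = \<lceil>n/2\<rceil>\<close>, one knows \<open>W\<close> up to order \<open>2 h \<ge> n\<close>; the cards enter up to
  order \<open>h + 1\<close>, that is, with the leading \<open>h + 2 = \<lceil>(n + 4)/2\<rceil>\<close> coefficients of their complements.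

  The derivative of a characteristic polynomial is the sum of those of the cards, which gives \<open>f\<close>
  except for its last coefficient and also the number of edges, hence \<open>W\<close> up to order 1. The last
  coefficient is obtained because \<open>f W\<close> is a polynomial of degree less than \<open>n\<close>: its coefficient at \<open>z\<^sup>n\<close>
  vanishes and is linear in the unknown, with factor \<open>n\<close>. Finally \<open>g = f (1 + z W)\<close> yields the
  complement.

  All of this is integer arithmetic on recursions with at most \<open>n + 2\<close> steps, organised in nested
  counting loops. The cost of such a program is bounded by its syntax alone, given bounds on the
  number of iterations of its loops and on the bit size of the stored numbers
  (lemma \<open>poly_bounded_com_cost\<close>), so it is polynomial as soon as every stored number has polynomially many bits.
  The stored numbers are walk counts, coefficients of characteristic polynomials and partial sums
  of products of these. That the deck determines the result follows because the program is
  deterministic and its output encoding is injective.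
\<close>

section \<open>Determinants and principal minors under rank-one updates\<close>

text \<open>
  Both sides are determinants of the same bordered matrix, factored once from the left and once from
  the right into block triangular matrices.
\<close>

lemma det_one_plus_outer:
  fixes x v :: "nat \<Rightarrow> 'a::idom"
  shows "det (mat n n (\<lambda>(i,j). (if i = j then 1 else 0) + x i * v j)) = 1 + (\<Sum>i<n. v i * x i)"
proof -
  define X where "X = mat n 1 (\<lambda>(i,j). x i)"
  define V where "V = mat 1 n (\<lambda>(i,j). - v j)"
  define K where "K = mat n n (\<lambda>(i,j). (if i = j then 1 else 0) + x i * v j)"
  define S where "S = mat 1 1 (\<lambda>_. 1 + (\<Sum>i<n. v i * x i))"
  have carr: "X \<in> carrier_mat n 1" "V \<in> carrier_mat 1 n" "K \<in> carrier_mat n n" "S \<in> carrier_mat 1 1"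
    by (auto simp: X_def V_def K_def S_def)
  let ?L = "four_block_mat (1\<^sub>m n) (0\<^sub>m n 1) V (1\<^sub>m 1)"
  let ?U = "four_block_mat K X (0\<^sub>m 1 n) (1\<^sub>m 1)"
  let ?U' = "four_block_mat (1\<^sub>m n) X (0\<^sub>m 1 n) S"
  have "?U * ?L = four_block_mat (1\<^sub>m n) X V (1\<^sub>m 1)"
    by (subst mult_four_block_mat[OF carr(3) carr(1) _ _ _ _ carr(2)], auto)
      (rule cong_four_block_mat; rule eq_matI;
        auto simp: X_def V_def K_def S_def scalar_prod_def sum.distrib)+
  moreover have "?L * ?U' = four_block_mat (1\<^sub>m n) X V (1\<^sub>m 1)"
    by (subst mult_four_block_mat[OF _ _ carr(2) _ _ carr(1) _ carr(4)], auto)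
      (rule cong_four_block_mat; rule eq_matI;
        auto simp: X_def V_def K_def S_def scalar_prod_def sum_negf atLeast0LessThan)+
  ultimately have "?U * ?L = ?L * ?U'" by simp
  then have "det ?U * det ?L = det ?L * det ?U'"
    using det_mult[of ?U "n+1" ?L] det_mult[of ?L "n+1" ?U'] carr
    by (metis four_block_carrier_mat one_carrier_mat)
  moreover have "det ?L = 1" 
    by (subst det_four_block_mat_upper_right_zero[OF _ refl carr(2)]) auto
  moreover have "det ?U = det K"
    by (subst det_four_block_mat_lower_left_zero[OF carr(3) carr(1) refl]) auto
  moreover have "det ?U' = 1 + (\<Sum>i<n. v i * x i)"
    by (subst det_four_block_mat_lower_left_zero[OF _ carr(1) refl carr(4)]) (auto simp: S_def det_single)
  ultimately show ?thesis by (simp add: K_def)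
qed

text \<open>
  If \<open>M x = u\<close>, then \<open>M + u v\<^sup>T = M (I + x v\<^sup>T)\<close>; the matrix \<open>M\<close> need not be invertible.
\<close>

lemma det_rank_one_update:
  fixes M :: "'a::idom mat"
  assumes M: "M \<in> carrier_mat n n"
    and x: "\<And>i. i < n \<Longrightarrow> (\<Sum>k<n. M $$ (i,k) * x k) = u i"
  shows "det (mat n n (\<lambda>(i,j). M $$ (i,j) + u i * v j)) = det M * (1 + (\<Sum>i<n. v i * x i))"
proof -
  let ?K = "mat n n (\<lambda>(i,j). (if i = j then 1 else 0) + x i * v j)"
  have "mat n n (\<lambda>(i,j). M $$ (i,j) + u i * v j) = M * ?K"
  proof (rule eq_matI)
    fix i j assume "i < dim_row (M * ?K)" "j < dim_col (M * ?K)"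
    then have ij: "i < n" "j < n" using M by auto
    have "(M * ?K) $$ (i,j) = (\<Sum>k<n. M $$ (i,k) * ((if k = j then 1 else 0) + x k * v j))"
      using ij M by (auto simp: scalar_prod_def atLeast0LessThan intro!: sum.cong)
    also have "\<dots> = (\<Sum>k<n. M $$ (i,k) * (if k = j then 1 else 0)) + (\<Sum>k<n. M $$ (i,k) * x k) * v j"
      by (simp add: distrib_left sum.distrib sum_distrib_right mult.assoc)
    also have "(\<Sum>k<n. M $$ (i,k) * (if k = j then 1 else 0)) = M $$ (i,j)"
      using ij by (subst sum.remove[of _ j]) auto
    finally show "mat n n (\<lambda>(i,j). M $$ (i,j) + u i * v j) $$ (i,j) = (M * ?K) $$ (i,j)"
      using ij x by simp
  qed (use M in auto)
  then show ?thesis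
    using det_mult[OF M, of ?K] det_one_plus_outer[of n x v] by simp
qed

text \<open>
  Laplace expansion along row \<open>m\<close>, whose cofactors do not see the entries of that row.
\<close>

lemma det_increment_diagonal_entry:
  fixes B :: "'a::comm_ring_1 mat"
  assumes B: "B \<in> carrier_mat n n" and m: "m < n"
  shows "det (mat n n (\<lambda>(i,j). B $$ (i,j) + (if i = m then 1 else 0) * (if j = m then 1 else 0)))
       = det B + det (mat_delete B m m)"
proof -
  let ?B = "mat n n (\<lambda>(i,j). B $$ (i,j) + (if i = m then 1 else 0) * (if j = m then 1 else 0))"
  have "mat_delete ?B m j = mat_delete B m j" if "j < n" for j
    using that B m by (intro eq_matI) (auto simp: mat_delete_def)
  then have cof: "cofactor ?B m j = cofactor B m j" if "j < n" for j
    using that by (simp add: cofactor_def)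
  have "det ?B = (\<Sum>j<n. ?B $$ (m,j) * cofactor ?B m j)"
    by (rule laplace_expansion_row) (use m in auto)
  also have "\<dots> = (\<Sum>j<n. B $$ (m,j) * cofactor B m j + (if j = m then cofactor B m j else 0))"
    by (rule sum.cong) (auto simp: m cof algebra_simps)
  also have "\<dots> = det B + cofactor B m m"
    using m by (simp add: sum.distrib laplace_expansion_row[OF B m])
  finally show ?thesis by (simp add: cofactor_def)
qed

text \<open>
  Deleting row and column \<open>m\<close> is a difference of two determinants: incrementing the diagonal entry at \<open>m\<close>
  adds the principal minor. Hence all three determinants reduce to rank-one updates of \<open>M\<close>, for which
  it suffices to solve linear systems: \<open>w\<close> solves \<open>M w = 1\<close>, \<open>r\<close> is column \<open>m\<close> of the inverse, and the
  incremented matrix is treated by the Sherman-Morrison formula. The element \<open>c\<close> replaces the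
  division in that formula, so that the lemma applies to matrices of power series.
\<close>

lemma principal_minors_of_rank_one_update:
  fixes M :: "'a::idom mat"
  assumes M: "M \<in> carrier_mat n n" and m: "m < n"
    and w: "\<And>i. i < n \<Longrightarrow> (\<Sum>k<n. M $$ (i,k) * w k) = 1"
    and r: "\<And>i. i < n \<Longrightarrow> (\<Sum>k<n. M $$ (i,k) * r k) = (if i = m then 1 else 0)"
    and sum_r: "(\<Sum>k<n. r k) = w m"
    and unit: "c * (1 + r m) = 1"
  shows "det (mat_delete M m m) = det M * r m"
    and "det (mat n n (\<lambda>(i,j). M $$ (i,j) + z)) = det M * (1 + z * (\<Sum>k<n. w k))"
    and "det (mat_delete (mat n n (\<lambda>(i,j). M $$ (i,j) + z)) m m)
       = det (mat_delete M m m) * (1 + z * (\<Sum>k<n. w k)) - z * det M * (w m)\<^sup>2"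
proof -
  define e where "e = (\<lambda>i. if i = m then 1 else (0::'a))"
  define W where "W = (\<Sum>k<n. w k)"
  define M1 where "M1 = mat n n (\<lambda>(i,j). M $$ (i,j) + e i * e j)"
  define MJ where "MJ = mat n n (\<lambda>(i,j). M $$ (i,j) + z)"
  have e_sum: "(\<Sum>k<n. e k * y k) = y m" for y
    using m by (simp add: e_def if_distrib[of "\<lambda>a. a * _"] cong: if_cong)
  have M1c: "M1 \<in> carrier_mat n n" and MJc: "MJ \<in> carrier_mat n n" by (auto simp: M1_def MJ_def)
  have detM1: "det M1 = det M * (1 + r m)"
    unfolding M1_def using det_rank_one_update[OF M, of r e e] r e_sum by (simp add: e_def)
  have delM: "det M1 = det M + det (mat_delete M m m)"
    using det_increment_diagonal_entry[OF M m] by (simp add: M1_def e_def)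
  from detM1 delM show minor: "det (mat_delete M m m) = det M * r m"
    by (simp add: algebra_simps)
  show detMJ: "det (mat n n (\<lambda>(i,j). M $$ (i,j) + z)) = det M * (1 + z * (\<Sum>k<n. w k))"
    using det_rank_one_update[OF M, of w "\<lambda>_. 1" "\<lambda>_. z"] w by (simp add: sum_distrib_left)
  \<comment> \<open>The Sherman-Morrison solution of the system with right-hand side 1 for the incremented matrix.\<close>
  define x where "x = (\<lambda>k. w k - c * w m * r k)"
  have M1x: "(\<Sum>k<n. M1 $$ (i,k) * x k) = 1" if i: "i < n" for i
  proof -
    have "(\<Sum>k<n. M1 $$ (i,k) * x k) = (\<Sum>k<n. M $$ (i,k) * x k) + e i * x m"
      using i e_sum[of x] by (simp add: M1_def distrib_right sum.distrib mult.assoc sum_distrib_left[symmetric])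
    also have "(\<Sum>k<n. M $$ (i,k) * x k) = (\<Sum>k<n. M $$ (i,k) * w k) - c * w m * (\<Sum>k<n. M $$ (i,k) * r k)"
      by (simp add: x_def right_diff_distrib sum_subtractf sum_distrib_left mult_ac)
    also have "\<dots> = 1 - c * w m * e i" using w[OF i] r[OF i] by (simp add: e_def)
    also have "1 - c * w m * e i + e i * x m = 1 + e i * w m * (1 - c * (1 + r m))"
      by (simp add: x_def algebra_simps)
    finally show ?thesis using unit by simp
  qed
  have "(\<Sum>k<n. x k) = W - c * w m * w m"
    by (simp add: x_def sum_subtractf sum_distrib_left[symmetric] sum_r W_def)
  then have "det (mat n n (\<lambda>(i,j). M1 $$ (i,j) + 1 * z)) = det M1 * (1 + z * (W - c * w m * w m))"
    using det_rank_one_update[OF M1c, of x "\<lambda>_. 1" "\<lambda>_. z"] M1x by (simp add: sum_distrib_left[symmetric])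
  moreover have "mat n n (\<lambda>(i,j). M1 $$ (i,j) + 1 * z)
      = mat n n (\<lambda>(i,j). MJ $$ (i,j) + (if i = m then 1 else 0) * (if j = m then 1 else 0))"
    by (rule eq_matI) (auto simp: M1_def MJ_def e_def)
  ultimately have "det MJ + det (mat_delete MJ m m) = det M1 * (1 + z * (W - c * w m * w m))"
    using det_increment_diagonal_entry[OF MJc m] by simp
  also have "\<dots> = det M * (1 + r m) * (1 + z * W) - z * det M * (w m)\<^sup>2 * (c * (1 + r m))"
    by (simp add: detM1 algebra_simps power2_eq_square)
  also have "\<dots> = det M * (1 + r m) * (1 + z * W) - z * det M * (w m)\<^sup>2"
    by (simp only: unit mult_1_right)
  finally show "det (mat_delete (mat n n (\<lambda>(i,j). M $$ (i,j) + z)) m m)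
       = det (mat_delete M m m) * (1 + z * (\<Sum>k<n. w k)) - z * det M * (w m)\<^sup>2"
    using detMJ minor by (simp add: MJ_def W_def algebra_simps)
qed


lemma poly_det: "poly (det B) a = det (map_mat (\<lambda>p. poly p a) B)" for B :: "'a::comm_ring_1 poly mat"
  by (rule comm_ring_hom.hom_det[symmetric, where hom = "\<lambda>p. poly p a"]) (unfold_locales, auto)

text \<open>
  Both sides are polynomials, so it suffices to compare values: at \<open>a \<noteq> 0\<close> the matrix \<open>I - a A\<close> is
  \<open>a\<close> times \<open>(1/a) I - A\<close>, and at \<open>a = 0\<close> both sides are 1.
\<close>

lemma reflect_char_poly:
  fixes A :: "'a::field_char_0 mat"
  assumes A: "A \<in> carrier_mat n n"
  shows "reflect_poly (char_poly A) = det (mat n n (\<lambda>(i,j). [: if i = j then 1 else 0, - A $$ (i,j) :]))"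
    (is "_ = det ?B")
proof (rule poly_eq_poly_eq_iff[THEN iffD1], rule ext)
  fix a :: 'a
  have deg: "degree (char_poly A) = n" "lead_coeff (char_poly A) = 1"
    using degree_monic_char_poly[OF A] by auto
  have B: "poly (det ?B) a = det (mat n n (\<lambda>(i,j). (if i = j then 1 else 0) - a * A $$ (i,j)))"
    unfolding poly_det by (rule arg_cong[where f = det]) (auto intro!: eq_matI)
  show "poly (reflect_poly (char_poly A)) a = poly (det ?B) a"
  proof (cases "a = 0")
    case True
    then have "mat n n (\<lambda>(i,j). (if i = j then 1 else 0) - a * A $$ (i,j)) = 1\<^sub>m n" by auto
    with True B deg show ?thesis by (simp add: poly_reflect_poly_0)
  next
    case False
    have "poly (reflect_poly (char_poly A)) a = a ^ n * poly (char_poly A) (inverse a)"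
      using False deg by (simp add: poly_reflect_poly_nz)
    also have "poly (char_poly A) (inverse a)
        = det (mat n n (\<lambda>(i,j). (if i = j then inverse a else 0) - A $$ (i,j)))"
      unfolding char_poly_def poly_det using A
      by (intro arg_cong[where f = det] eq_matI) (auto simp: char_poly_matrix_def)
    also have "a ^ n * \<dots> = det (a \<cdot>\<^sub>m mat n n (\<lambda>(i,j). (if i = j then inverse a else 0) - A $$ (i,j)))"
      by simp
    also have "a \<cdot>\<^sub>m mat n n (\<lambda>(i,j). (if i = j then inverse a else 0) - A $$ (i,j))
        = mat n n (\<lambda>(i,j). (if i = j then 1 else 0) - a * A $$ (i,j))"
      using False by (intro eq_matI) (auto simp: algebra_simps)
    finally show ?thesis using B by simp
  qed
qed

text \<open>
  Characteristic polynomials are monic of known degree; reversed, they are power series with constant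
  term 1, and knowing leading coefficients becomes knowing a power series up to some order. The
  rationals are used because the Sherman-Morrison formula divides by a series with constant term 2.
\<close>

definition rev_fps :: "int poly \<Rightarrow> rat fps" where
  "rev_fps p = Abs_fps (\<lambda>j. of_int (coeff (reflect_poly p) j))"

lemma rev_fps_char_poly:
  fixes A :: "int mat"
  assumes A: "A \<in> carrier_mat n n"
  shows "rev_fps (char_poly A)
    = det (mat n n (\<lambda>(i,j). (if i = j then 1 else 0) - fps_X * of_int (A $$ (i,j))))"
proof -
  interpret h: comm_ring_hom "fps_of_poly :: rat poly \<Rightarrow> rat fps"
    by unfold_locales (auto simp: fps_of_poly_add fps_of_poly_mult)
  let ?A = "map_mat rat_of_int A"
  have A': "?A \<in> carrier_mat n n" using A by simp
  have "rev_fps (char_poly A) = fps_of_poly (reflect_poly (char_poly ?A))"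
    unfolding of_int_hom.char_poly_hom[OF A]
    by (rule fps_ext) (simp add: rev_fps_def coeff_reflect_poly)
  also have "\<dots> = det (map_mat fps_of_poly (mat n n (\<lambda>(i,j). [: if i = j then 1 else 0, - ?A $$ (i,j) :])))"
    unfolding reflect_char_poly[OF A'] by simp
  also have "map_mat fps_of_poly (mat n n (\<lambda>(i,j). [: if i = j then 1 else 0, - ?A $$ (i,j) :]))
      = mat n n (\<lambda>(i,j). (if i = j then 1 else 0) - fps_X * of_int (A $$ (i,j)))"
    using A by (intro eq_matI)
      (auto simp: fps_of_poly_pCons fps_of_int[symmetric] fps_const_neg[symmetric] simp del: fps_const_neg)
  finally show ?thesis .
qed


section \<open>Walk generating functions\<close>

text \<open>
  The entries of \<open>A\<^sup>m b\<close>; for the adjacency matrix of a graph and \<open>b = 1\<close> they count walks of length \<open>m\<close>.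
\<close>

primrec walk_count :: "int mat \<Rightarrow> (nat \<Rightarrow> int) \<Rightarrow> nat \<Rightarrow> nat \<Rightarrow> int" where
  "walk_count A b 0 i = b i"
| "walk_count A b (Suc m) i = (\<Sum>j<dim_row A. A $$ (i,j) * walk_count A b m j)"

lemma walk_count_add: "walk_count A b (l + m) i = walk_count A (walk_count A b l) m i"
  by (induction m arbitrary: i) auto

definition resolvent :: "int mat \<Rightarrow> (nat \<Rightarrow> int) \<Rightarrow> nat \<Rightarrow> rat fps" where
  "resolvent A b i = Abs_fps (\<lambda>m. of_int (walk_count A b m i))"

lemma fps_of_int_mult_nth: "fps_nth (of_int a * f) m = (of_int a :: rat) * fps_nth f m"
  by (simp add: fps_of_int[symmetric])

text \<open>
  The Neumann series \<open>\<Sum> z\<^sup>m A\<^sup>m b\<close> solves the system \<open>(I - z A) x = b\<close>.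
\<close>

lemma resolvent:
  assumes A: "A \<in> carrier_mat n n" and i: "i < n"
  shows "(\<Sum>k<n. mat n n (\<lambda>(i,j). (if i = j then 1 else 0) - fps_X * of_int (A $$ (i,j))) $$ (i,k) * resolvent A b k)
       = of_int (b i)"
proof -
  have "(\<Sum>k<n. mat n n (\<lambda>(i,j). (if i = j then 1 else 0) - fps_X * of_int (A $$ (i,j))) $$ (i,k) * resolvent A b k)
      = (\<Sum>k<n. (if i = k then resolvent A b k else 0)) - fps_X * (\<Sum>k<n. of_int (A $$ (i,k)) * resolvent A b k)"
    unfolding sum_distrib_left sum_subtractf[symmetric] using i
    by (intro sum.cong) (auto simp: algebra_simps)
  also have "\<dots> = resolvent A b i - fps_X * (\<Sum>k<n. of_int (A $$ (i,k)) * resolvent A b k)"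
    using i by simp
  also have "\<dots> = of_int (b i)"
  proof (rule fps_ext)
    fix m
    show "fps_nth (resolvent A b i - fps_X * (\<Sum>k<n. of_int (A $$ (i,k)) * resolvent A b k)) m
        = fps_nth (of_int (b i)) m"
      using A
      by (cases m) (auto simp: resolvent_def fps_sum_nth fps_of_int_mult_nth fps_of_int[symmetric])
  qed
  finally show ?thesis .
qed

definition minus_ones :: "int mat \<Rightarrow> int mat" where
  "minus_ones A = mat (dim_row A) (dim_col A) (\<lambda>(i,j). A $$ (i,j) - 1)"

locale symmetric_int_matrix =
  fixes A :: "int mat" and n :: nat
  assumes carrier: "A \<in> carrier_mat n n"
    and symmetric: "\<And>i j. i < n \<Longrightarrow> j < n \<Longrightarrow> A $$ (i,j) = A $$ (j,i)"
begin

abbreviation walks :: "nat \<Rightarrow> nat \<Rightarrow> int" where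
  "walks m i \<equiv> walk_count A (\<lambda>_. 1) m i"

definition total_walks :: "nat \<Rightarrow> int" where
  "total_walks m = (\<Sum>i<n. walks m i)"

lemma walk_count_self_adjoint:
  "(\<Sum>i<n. walk_count A b m i * c i) = (\<Sum>i<n. b i * walk_count A c m i)"
proof (induction m arbitrary: b)
  case (Suc m)
  have "walk_count A b (Suc m) i = walk_count A (walk_count A b (Suc 0)) m i" for i
    using walk_count_add[of A b "Suc 0" m i] by simp
  then have "(\<Sum>i<n. walk_count A b (Suc m) i * c i)
      = (\<Sum>i<n. walk_count A b (Suc 0) i * walk_count A c m i)" by (simp only: Suc.IH)
  also have "\<dots> = (\<Sum>i<n. \<Sum>j<n. A $$ (i,j) * b j * walk_count A c m i)"
    using carrier by (simp add: sum_distrib_right)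
  also have "\<dots> = (\<Sum>j<n. \<Sum>i<n. A $$ (i,j) * b j * walk_count A c m i)" by (rule sum.swap)
  also have "\<dots> = (\<Sum>j<n. b j * walk_count A c (Suc m) j)"
    using carrier symmetric by (auto simp: sum_distrib_left mult_ac intro!: sum.cong)
  finally show ?case .
qed simp

text \<open>
  Cut a walk of length \<open>l + m\<close> after \<open>l\<close> steps: by symmetry, both halves are walks starting at the
  cutting vertex. This doubles the length up to which walks can be counted.
\<close>

lemma total_walks_add: "total_walks (l + m) = (\<Sum>i<n. walks l i * walks m i)"
proof -
  have "total_walks (l + m) = (\<Sum>i<n. walk_count A (walks l) m i * 1)"
    by (simp add: total_walks_def walk_count_add)
  then show ?thesis by (simp only: walk_count_self_adjoint)
qed

lemma sum_walk_count_unit: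
  assumes "i < n"
  shows "(\<Sum>k<n. walk_count A (\<lambda>k. if k = i then 1 else 0) m k) = walks m i"
  using walk_count_self_adjoint[of "\<lambda>k. if k = i then 1 else 0" m "\<lambda>_. 1"] assms
  by (simp add: if_distrib[of "\<lambda>a. a * _"] cong: if_cong)

definition total_resolvent :: "rat fps" where
  "total_resolvent = Abs_fps (\<lambda>m. of_int (total_walks m))"

text \<open>
  The three identities behind the reconstruction. In the third, everything except the square of the
  generating function of walks from vertex \<open>i\<close> is visible on card \<open>i\<close> or common to all cards.
\<close>

lemma generating_functions_of_minors:
  assumes i: "i < n"
  shows "rev_fps (char_poly (mat_delete A i i))
      = rev_fps (char_poly A) * resolvent A (\<lambda>k. if k = i then 1 else 0) i"
    and "rev_fps (char_poly (minus_ones A)) = rev_fps (char_poly A) * (1 + fps_X * total_resolvent)"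
    and "rev_fps (char_poly (mat_delete (minus_ones A) i i))
      = rev_fps (char_poly (mat_delete A i i)) * (1 + fps_X * total_resolvent)
        - fps_X * rev_fps (char_poly A) * (resolvent A (\<lambda>_. 1) i)\<^sup>2"
proof -
  define M where "M = mat n n (\<lambda>(i,j). (if i = j then 1 else 0) - fps_X * of_int (A $$ (i,j)) :: rat fps)"
  let ?r = "resolvent A (\<lambda>k. if k = i then 1 else 0)"
  have M: "M \<in> carrier_mat n n" by (simp add: M_def)
  have C: "minus_ones A \<in> carrier_mat n n" using carrier by (simp add: minus_ones_def)
  have W: "(\<Sum>k<n. resolvent A (\<lambda>_. 1) k) = total_resolvent"
    by (rule fps_ext) (simp add: fps_sum_nth resolvent_def total_resolvent_def total_walks_def)
  have sum_r: "(\<Sum>k<n. ?r k) = resolvent A (\<lambda>_. 1) i"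
    by (rule fps_ext) (simp add: fps_sum_nth resolvent_def sum_walk_count_unit[OF i, symmetric])
  have nz: "fps_nth (1 + ?r i) 0 \<noteq> 0" by (simp add: resolvent_def)
  note minors = principal_minors_of_rank_one_update[OF M i, where w = "resolvent A (\<lambda>_. 1)" and r = ?r and c = "inverse (1 + ?r i)",
    OF _ _ sum_r inverse_mult_eq_1[OF nz], unfolded W]
  have w: "(\<Sum>k<n. M $$ (j,k) * resolvent A (\<lambda>_. 1) k) = 1" if "j < n" for j
    unfolding M_def using resolvent[OF carrier that, of "\<lambda>_. 1"] by simp
  have r: "(\<Sum>k<n. M $$ (j,k) * ?r k) = (if j = i then 1 else 0)" if "j < n" for j
    unfolding M_def using resolvent[OF carrier that, of "\<lambda>k. if k = i then 1 else 0"] by simp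
  have f: "rev_fps (char_poly A) = det M"
    unfolding M_def by (rule rev_fps_char_poly[OF carrier])
  have fi: "rev_fps (char_poly (mat_delete A i i)) = det (mat_delete M i i)"
    unfolding rev_fps_char_poly[OF mat_delete_carrier[OF carrier]]
    by (rule arg_cong[where f = det]) (use carrier in \<open>auto simp: M_def mat_delete_def intro!: eq_matI\<close>)
  have g: "rev_fps (char_poly (minus_ones A)) = det (mat n n (\<lambda>(i,j). M $$ (i,j) + fps_X))"
    unfolding rev_fps_char_poly[OF C]
    by (rule arg_cong[where f = det]) (use carrier in \<open>auto simp: M_def minus_ones_def algebra_simps intro!: eq_matI\<close>)
  have gi: "rev_fps (char_poly (mat_delete (minus_ones A) i i))
      = det (mat_delete (mat n n (\<lambda>(i,j). M $$ (i,j) + fps_X)) i i)"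
    unfolding rev_fps_char_poly[OF mat_delete_carrier[OF C]]
    by (rule arg_cong[where f = det])
      (use carrier in \<open>auto simp: M_def minus_ones_def mat_delete_def algebra_simps intro!: eq_matI\<close>)
  show "rev_fps (char_poly (mat_delete A i i)) = rev_fps (char_poly A) * ?r i"
    unfolding f fi by (rule minors(1)[OF w r])
  show "rev_fps (char_poly (minus_ones A)) = rev_fps (char_poly A) * (1 + fps_X * total_resolvent)"
    unfolding f g by (rule minors(2)[OF w r])
  show "rev_fps (char_poly (mat_delete (minus_ones A) i i))
      = rev_fps (char_poly (mat_delete A i i)) * (1 + fps_X * total_resolvent)
        - fps_X * rev_fps (char_poly A) * (resolvent A (\<lambda>_. 1) i)\<^sup>2"
    unfolding f fi gi by (rule minors(3)[OF w r])
qed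

abbreviation rev_coeff :: "int poly \<Rightarrow> nat \<Rightarrow> int" where "rev_coeff p j \<equiv> coeff (reflect_poly p) j"

lemma rev_coeff_0: "rev_coeff (char_poly B) 0 = 1" if "B \<in> carrier_mat m m" for B m
  using degree_monic_char_poly[OF that] by simp

text \<open>
  The coefficient of \<open>z\<^sup>j\<close> in \<open>f w\<^sub>i\<^sup>2 = W f\<^sub>i - (g\<^sub>i - f\<^sub>i) / z\<close>.
\<close>

lemma vertex_walks_identity:
  assumes i: "i < n"
  shows "(\<Sum>l=0..j. (\<Sum>a=0..l. walks a i * walks (l - a) i) * rev_coeff (char_poly A) (j - l))
       = (\<Sum>l=0..j. total_walks l * rev_coeff (char_poly (mat_delete A i i)) (j - l))
         - (rev_coeff (char_poly (mat_delete (minus_ones A) i i)) (Suc j) - rev_coeff (char_poly (mat_delete A i i)) (Suc j))"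
proof -
  let ?f = "rev_fps (char_poly A)" and ?fi = "rev_fps (char_poly (mat_delete A i i))"
    and ?gi = "rev_fps (char_poly (mat_delete (minus_ones A) i i))" and ?w = "resolvent A (\<lambda>_. 1) i"
  have "fps_X * ((?w * ?w) * ?f) = fps_X * (total_resolvent * ?fi) - (?gi - ?fi)"
    unfolding generating_functions_of_minors(3)[OF i] by (simp add: algebra_simps power2_eq_square)
  then have "fps_nth (fps_X * ((?w * ?w) * ?f)) (Suc j)
      = fps_nth (fps_X * (total_resolvent * ?fi) - (?gi - ?fi)) (Suc j)" by simp
  then have "rat_of_int (\<Sum>l=0..j. (\<Sum>a=0..l. walks a i * walks (l - a) i) * rev_coeff (char_poly A) (j - l))
      = rat_of_int ((\<Sum>l=0..j. total_walks l * rev_coeff (char_poly (mat_delete A i i)) (j - l))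
         - (rev_coeff (char_poly (mat_delete (minus_ones A) i i)) (Suc j) - rev_coeff (char_poly (mat_delete A i i)) (Suc j)))"
    by (simp only: fps_X_mult_nth fps_sub_nth fps_add_nth)
      (simp add: fps_mult_nth rev_fps_def resolvent_def total_resolvent_def del: coeff_reflect_poly)
  then show ?thesis by (simp only: of_int_eq_iff)
qed

lemma minus_ones_coeffs:
  assumes "n > 0"
  shows "rev_coeff (char_poly (minus_ones A)) (Suc j)
    = rev_coeff (char_poly A) (Suc j) + (\<Sum>l=0..j. rev_coeff (char_poly A) l * total_walks (j - l))"
proof -
  have "rev_fps (char_poly (minus_ones A)) = rev_fps (char_poly A) + fps_X * (rev_fps (char_poly A) * total_resolvent)"
    unfolding generating_functions_of_minors(2)[OF assms] by (simp add: algebra_simps)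
  then have "fps_nth (rev_fps (char_poly (minus_ones A))) (Suc j)
    = fps_nth (rev_fps (char_poly A) + fps_X * (rev_fps (char_poly A) * total_resolvent)) (Suc j)" by simp
  then have "rat_of_int (rev_coeff (char_poly (minus_ones A)) (Suc j))
    = rat_of_int (rev_coeff (char_poly A) (Suc j) + (\<Sum>l=0..j. rev_coeff (char_poly A) l * total_walks (j - l)))"
    by (simp only: fps_X_mult_nth fps_sub_nth fps_add_nth)
      (simp add: fps_mult_nth rev_fps_def total_resolvent_def del: coeff_reflect_poly)
  then show ?thesis by (simp only: of_int_eq_iff)
qed

lemma rev_coeff_beyond_dim: "rev_coeff (char_poly B) j = 0" if "B \<in> carrier_mat m m" "m < j" for B m j
  using degree_monic_char_poly[OF that(1)] that(2) by (simp add: coeff_reflect_poly)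

text \<open>
  The series \<open>1 + z W\<close> times \<open>f\<close> is the reversed characteristic polynomial of \<open>A - J\<close>, which has degree at most \<open>n\<close>;
  here its coefficient of order \<open>n + 1\<close> is read off. It expresses \<open>1\<^sup>T \<phi>(A) 1 = 0\<close>.
\<close>

lemma cayley_hamilton_for_total_walks:
  assumes "n > 0"
  shows "(\<Sum>l=0..n. rev_coeff (char_poly A) l * total_walks (n - l)) = 0"
proof -
  have "minus_ones A \<in> carrier_mat n n" using carrier by (simp add: minus_ones_def)
  then show ?thesis using minus_ones_coeffs[OF assms, of n] rev_coeff_beyond_dim[of _ n "Suc n"] carrier by simp
qed

lemma derivative_coeffs:
  assumes "j < n"
  shows "int (n - j) * rev_coeff (char_poly A) j = (\<Sum>i<n. rev_coeff (char_poly (mat_delete A i i)) j)"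
proof -
  have "coeff (pderiv (char_poly A)) (n - 1 - j) = (\<Sum>i<n. coeff (char_poly (mat_delete A i i)) (n - 1 - j))"
    by (simp add: pderiv_char_poly[OF carrier] coeff_sum)
  moreover have "rev_coeff (char_poly (mat_delete A i i)) j = coeff (char_poly (mat_delete A i i)) (n - 1 - j)" for i
    using degree_monic_char_poly[OF mat_delete_carrier[OF carrier]] assms by (simp add: coeff_reflect_poly)
  moreover have "rev_coeff (char_poly A) j = coeff (char_poly A) (n - j)"
    using degree_monic_char_poly[OF carrier] assms by (simp add: coeff_reflect_poly)
  moreover have "Suc (n - 1 - j) = n - j" using assms by simp
  ultimately show ?thesis by (simp add: coeff_pderiv)
qed

text \<open>
  The total number of walks of length 1 is the trace of \<open>A\<^sup>2\<close>, because the entries are 0 or 1. Comparing the sum over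
  \<open>i\<close> of the identities \<open>f\<^sub>i = f R\<^sub>i\<^sub>i\<close>, where \<open>R\<close> is the resolvent, with the derivative formula yields
  \<open>p\<^sub>1 = 0\<close> at order 1, as the diagonal vanishes, and \<open>- 2 p\<^sub>2 = tr A\<^sup>2\<close> at order 2.
\<close>

lemma total_walks_1:
  assumes n: "n \<ge> 3" and diag: "\<And>i. i < n \<Longrightarrow> A $$ (i,i) = 0"
    and entries: "\<And>i j. i < n \<Longrightarrow> j < n \<Longrightarrow> A $$ (i,j) \<in> {0,1}"
  shows "total_walks 1 = - 2 * rev_coeff (char_poly A) 2"
proof -
  let ?e = "\<lambda>i k. if k = i then 1 else (0::int)"
  have minor: "rev_coeff (char_poly (mat_delete A i i)) j
      = (\<Sum>l=0..j. rev_coeff (char_poly A) l * walk_count A (?e i) (j - l) i)" if "i < n" for i j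
  proof -
    have "fps_nth (rev_fps (char_poly (mat_delete A i i))) j
      = fps_nth (rev_fps (char_poly A) * resolvent A (?e i) i) j"
      using generating_functions_of_minors(1)[OF that] by simp
    then have "rat_of_int (rev_coeff (char_poly (mat_delete A i i)) j)
      = rat_of_int (\<Sum>l=0..j. rev_coeff (char_poly A) l * walk_count A (?e i) (j - l) i)"
      by (simp add: fps_mult_nth rev_fps_def resolvent_def del: coeff_reflect_poly)
    then show ?thesis by (simp only: of_int_eq_iff)
  qed
  have unit_step: "walk_count A (?e i) 1 k = A $$ (k,i)" if "i < n" for i k
    using carrier that by (simp add: if_distrib[of "\<lambda>a. _ * a"] cong: if_cong)
  have p0: "rev_coeff (char_poly A) 0 = 1" using rev_coeff_0[OF carrier] .
  have "int (n - 1) * rev_coeff (char_poly A) 1 = (\<Sum>i<n. rev_coeff (char_poly A) 1)"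
    using derivative_coeffs[of 1] n minor[of _ 1] unit_step diag p0 by simp
  then have p1: "rev_coeff (char_poly A) 1 = 0" using n by (simp add: of_nat_diff algebra_simps)
  have two: "walk_count A (?e i) 2 i = walks 1 i" if i: "i < n" for i
  proof -
    have "walk_count A (?e i) 2 i = (\<Sum>j<n. A $$ (i,j) * walk_count A (?e i) 1 j)"
      using carrier by (simp add: numeral_2_eq_2)
    also have "\<dots> = (\<Sum>j<n. A $$ (i,j))"
    proof (rule sum.cong)
      fix j assume "j \<in> {..<n}"
      then show "A $$ (i,j) * walk_count A (?e i) 1 j = A $$ (i,j)"
        unfolding unit_step[OF i] using entries[of i j] symmetric[of i j] i by auto
    qed simp
    also have "\<dots> = walks 1 i" using carrier by simp
    finally show ?thesis .
  qed
  have "rev_coeff (char_poly (mat_delete A i i)) 2 = rev_coeff (char_poly A) 2 + walks 1 i" if i: "i < n" for i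
  proof -
    have "{0..2} = {0,1,2::nat}" by auto
    then show ?thesis using minor[OF i, of 2] two[OF i] p0 p1 by simp
  qed
  then have "int (n - 2) * rev_coeff (char_poly A) 2 = (\<Sum>i<n. rev_coeff (char_poly A) 2 + walks 1 i)"
    using derivative_coeffs[of 2] n by simp
  then show ?thesis using n by (simp add: sum.distrib total_walks_def[symmetric] of_nat_diff algebra_simps del: walk_count.simps)
qed

end


section \<open>Bounds, complements and adjacency matrices\<close>

text \<open>
  Coefficientwise majorization is compatible with products, so a determinant of linear polynomials
  can be bounded term by term in the Leibniz formula.
\<close>

definition dominated :: "int poly \<Rightarrow> int poly \<Rightarrow> bool" where
  "dominated p q \<longleftrightarrow> (\<forall>k. \<bar>coeff p k\<bar> \<le> coeff q k)"

lemma dominated_mult: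
  assumes "dominated p q" "dominated p' q'"
  shows "dominated (p * p') (q * q')"
  unfolding dominated_def
proof
  fix k
  have "\<bar>coeff (p * p') k\<bar> \<le> (\<Sum>i\<le>k. \<bar>coeff p i * coeff p' (k - i)\<bar>)"
    by (simp add: coeff_mult)
  also have "\<dots> \<le> (\<Sum>i\<le>k. coeff q i * coeff q' (k - i))"
  proof (rule sum_mono)
    fix i
    have "\<bar>coeff p i\<bar> \<le> coeff q i" "\<bar>coeff p' (k - i)\<bar> \<le> coeff q' (k - i)"
      using assms by (auto simp: dominated_def)
    moreover from this have "0 \<le> coeff q i" by linarith
    ultimately show "\<bar>coeff p i * coeff p' (k - i)\<bar> \<le> coeff q i * coeff q' (k - i)"
      by (simp add: abs_mult mult_mono)
  qed
  also have "\<dots> = coeff (q * q') k" by (simp add: coeff_mult)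
  finally show "\<bar>coeff (p * p') k\<bar> \<le> coeff (q * q') k" .
qed

lemma dominated_prod:
  assumes "finite I" "\<And>i. i \<in> I \<Longrightarrow> dominated (p i) (q i)"
  shows "dominated (prod p I) (prod q I)"
  using assms
proof (induction I rule: finite_induct)
  case (insert i I)
  then show ?case by (simp add: dominated_mult)
qed (auto simp: dominated_def)

lemma coeff_1_plus_X_power: "0 \<le> coeff ([:1,1::int:] ^ n) k \<and> coeff ([:1,1:] ^ n) k \<le> (2::int) ^ n"
proof (induction n arbitrary: k)
  case 0 then show ?case by (simp add: coeff_1)
next
  case (Suc n)
  have step: "coeff ([:1,1::int:] ^ Suc n) k = coeff ([:1,1:] ^ n) k + (if k = 0 then 0 else coeff ([:1,1:] ^ n) (k - 1))"
    by (cases k) (auto simp: mult_pCons_left)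
  show ?case using Suc.IH[of k] Suc.IH[of "k - 1"] unfolding step by auto
qed

lemma char_poly_coeff_bound:
  assumes A: "A \<in> carrier_mat n n" and entries: "\<And>i j. i < n \<Longrightarrow> j < n \<Longrightarrow> \<bar>A $$ (i,j)\<bar> \<le> (1::int)"
  shows "\<bar>coeff (char_poly A) k\<bar> \<le> fact n * 2 ^ n"
proof -
  let ?P = "{\<pi>. \<pi> permutes {0..<n}}"
  let ?M = "char_poly_matrix A"
  have M: "?M \<in> carrier_mat n n" using A by simp
  have dom: "dominated (\<Prod>i=0..<n. ?M $$ (i, \<pi> i)) ([:1,1:] ^ n)" if "\<pi> permutes {0..<n}" for \<pi>
  proof -
    have "dominated (\<Prod>i=0..<n. ?M $$ (i, \<pi> i)) (\<Prod>i=0..<n. [:1,1:])"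
    proof (rule dominated_prod)
      fix i assume i: "i \<in> {0..<n}"
      then have \<pi>: "\<pi> i < n" using permutes_in_image[OF that] by fastforce
      have "\<bar>A $$ (i, \<pi> i)\<bar> \<le> 1" using entries i \<pi> by simp
      then show "dominated (?M $$ (i, \<pi> i)) [:1,1:]"
        using A i \<pi> by (cases "i = \<pi> i") (simp_all add: dominated_def char_poly_matrix_def coeff_pCons split: nat.split)
    qed simp
    then show ?thesis by simp
  qed
  have prod: "\<bar>coeff (\<Prod>i=0..<n. ?M $$ (i, \<pi> i)) k\<bar> \<le> 2 ^ n" if "\<pi> permutes {0..<n}" for \<pi>
  proof -
    have "\<bar>coeff (\<Prod>i=0..<n. ?M $$ (i, \<pi> i)) k\<bar> \<le> coeff ([:1,1:] ^ n) k"
      using dom[OF that] by (simp only: dominated_def)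
    also have "\<dots> \<le> 2 ^ n" using coeff_1_plus_X_power by blast
    finally show ?thesis .
  qed
  have sign: "\<bar>coeff (signof \<pi> * q) k\<bar> = \<bar>coeff q k\<bar>" for \<pi> :: "nat \<Rightarrow> nat" and q :: "int poly"
    by (cases "evenperm \<pi>") (simp_all add: sign_def)
  have "\<bar>coeff (char_poly A) k\<bar> = \<bar>\<Sum>\<pi>\<in>?P. coeff (signof \<pi> * (\<Prod>i=0..<n. ?M $$ (i, \<pi> i))) k\<bar>"
    unfolding char_poly_def det_def'[OF M] coeff_sum ..
  also have "\<dots> \<le> (\<Sum>\<pi>\<in>?P. \<bar>coeff (signof \<pi> * (\<Prod>i=0..<n. ?M $$ (i, \<pi> i))) k\<bar>)" by (rule sum_abs)
  also have "\<dots> \<le> (\<Sum>\<pi>\<in>?P. 2 ^ n)"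
    by (rule sum_mono, unfold sign, rule prod) simp
  also have "\<dots> = int (card ?P) * 2 ^ n" by simp
  also have "card ?P = fact n" by (rule card_permutations) simp_all
  finally show ?thesis by simp
qed

lemma walk_count_bound:
  assumes A: "A \<in> carrier_mat n n" and entries: "\<And>i j. i < n \<Longrightarrow> j < n \<Longrightarrow> \<bar>A $$ (i,j)\<bar> \<le> (1::int)" and i: "i < n"
  shows "\<bar>walk_count A (\<lambda>_. 1) m i\<bar> \<le> int n ^ m"
  using i
proof (induction m arbitrary: i)
  case (Suc m)
  have dim: "dim_row A = n" using A by simp
  have "\<bar>walk_count A (\<lambda>_. 1) (Suc m) i\<bar> \<le> (\<Sum>j<n. \<bar>A $$ (i,j) * walk_count A (\<lambda>_. 1) m j\<bar>)"
    unfolding walk_count.simps dim by (rule sum_abs)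
  also have "\<dots> \<le> (\<Sum>j<n. 1 * int n ^ m)"
  proof (rule sum_mono)
    fix j assume "j \<in> {..<n}"
    then have "j < n" by simp
    show "\<bar>A $$ (i,j) * walk_count A (\<lambda>_. 1) m j\<bar> \<le> 1 * int n ^ m"
      unfolding abs_mult by (rule mult_mono[OF entries[OF Suc.prems \<open>j < n\<close>] Suc.IH[OF \<open>j < n\<close>]]) simp_all
  qed
  finally show ?case by simp
qed simp


text \<open>
  If \<open>a\<close> lists the coefficients of a polynomial \<open>q\<close> of degree \<open>d\<close> from the leading one downwards, these
  are the coefficients of \<open>(-1)\<^sup>d q(-1 - x)\<close>, again from the leading one downwards. Entry \<open>j\<close> depends only
  on the first \<open>j + 1\<close> entries of \<open>a\<close>, so the transformation can be applied to truncated lists.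
\<close>

definition shift_coeff :: "nat \<Rightarrow> (nat \<Rightarrow> int) \<Rightarrow> nat \<Rightarrow> int" where
  "shift_coeff d a j = (\<Sum>l\<le>j. (-1) ^ l * a l * int ((d - l) choose (j - l)))"

lemma poly_as_monom_sum:
  assumes "degree p \<le> n"
  shows "p = (\<Sum>i\<le>n. monom (coeff p i) i)"
  using poly_as_sum_of_monoms'[OF assms] by simp

lemma pcompose_monom: "pcompose (monom c i) q = Polynomial.smult c (q ^ i)" for q :: "'a::comm_semiring_1 poly"
  by (induction i) (auto simp: monom_0 monom_Suc pcompose_pCons mult_ac)

lemma char_poly_reflected_matrix:
  fixes B C :: "int mat"
  assumes C: "C \<in> carrier_mat n n" and B: "B \<in> carrier_mat n n"
    and BC: "\<And>i j. i < n \<Longrightarrow> j < n \<Longrightarrow> B $$ (i,j) = - C $$ (i,j) - (if i = j then 1 else 0)"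
  shows "char_poly B = (-1) ^ n * pcompose (char_poly C) [:-1,-1:]"
proof -
  have h: "comm_ring_hom (\<lambda>p :: int poly. pcompose p [:-1,-1:])"
    by unfold_locales (auto simp: pcompose_add pcompose_mult pcompose_1)
  have "pcompose (char_poly C) [:-1,-1:] = det (map_mat (\<lambda>p. pcompose p [:-1,-1:]) (char_poly_matrix C))"
    unfolding char_poly_def by (rule comm_ring_hom.hom_det[OF h, symmetric])
  moreover have "char_poly_matrix B = (-1) \<cdot>\<^sub>m map_mat (\<lambda>p. pcompose p [:-1,-1:]) (char_poly_matrix C)"
    using B C by (intro eq_matI) (auto simp: char_poly_matrix_def BC pcompose_pCons one_pCons)
  ultimately show ?thesis using char_poly_matrix_closed[OF C] by (simp add: char_poly_def)
qed

text \<open>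
  The relation \<open>B = - C - I\<close> is symmetric in \<open>B\<close> and \<open>C\<close>. The lemma is used in both directions: from the complement of a
  card to the minor of \<open>A - J\<close>, and from \<open>A - J\<close> to the complement of the graph.
\<close>

lemma reflected_matrix_coeffs:
  fixes B C :: "int mat"
  assumes C: "C \<in> carrier_mat n n" and B: "B \<in> carrier_mat n n"
    and BC: "\<And>i j. i < n \<Longrightarrow> j < n \<Longrightarrow> B $$ (i,j) = - C $$ (i,j) - (if i = j then 1 else 0)"
  shows "coeff (reflect_poly (char_poly B)) j = shift_coeff n (coeff (reflect_poly (char_poly C))) j"
proof (cases "j \<le> n")
  case True
  let ?p = "char_poly C"
  have deg: "degree ?p = n" "degree (char_poly B) = n"
    using degree_monic_char_poly[OF C] degree_monic_char_poly[OF B] by auto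
  have comp: "coeff ((-1) ^ n * pcompose ?p [:-1,-1:]) k = (\<Sum>i\<le>n. (-1) ^ (n + i) * coeff ?p i * int (i choose k))" for k
  proof -
    have lin: "[:-1,-1::int:] ^ i = Polynomial.smult ((-1) ^ i) ([:1,1:] ^ i)" for i
      using smult_power[of "-1" "[:1,1::int:]" i] by simp
    have binom: "coeff ([:1,1::int:] ^ i) k = int (i choose k)" for i
    proof (cases "k \<le> i")
      case True then show ?thesis by (simp add: coeff_linear_poly_power)
    next
      case False
      then have "degree ([:1,1::int:] ^ i) < k" by (simp add: degree_power_eq)
      with False show ?thesis by (simp add: coeff_eq_0)
    qed
    have "pcompose ?p [:-1,-1:] = (\<Sum>i\<le>n. Polynomial.smult (coeff ?p i) ([:-1,-1:] ^ i))"
      by (subst poly_as_monom_sum[of ?p n]) (auto simp: deg pcompose_sum pcompose_monom)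
    then have c0: "coeff (pcompose ?p [:-1,-1:]) k = (\<Sum>i\<le>n. coeff ?p i * ((-1) ^ i * int (i choose k)))"
      by (simp add: coeff_sum lin binom mult.assoc)
    have sg: "coeff ((-1) ^ n * q) k = (-1) ^ n * coeff q k" for q :: "int poly"
      by (metis coeff_smult minus_one_power_iff mult_minus_left mult.left_neutral coeff_minus)
    show ?thesis unfolding sg c0 sum_distrib_left power_add by (simp add: mult_ac)
  qed
  have "coeff (reflect_poly (char_poly B)) j = coeff (char_poly B) (n - j)"
    using True deg by (simp add: coeff_reflect_poly)
  also have "\<dots> = (\<Sum>i\<le>n. (-1) ^ (n + i) * coeff ?p i * int (i choose (n - j)))"
    by (subst char_poly_reflected_matrix[OF C B BC]) (assumption, assumption, rule comp)
  also have "\<dots> = (\<Sum>l\<le>n. (-1) ^ (n + (n - l)) * coeff ?p (n - l) * int ((n - l) choose (n - j)))"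
    by (rule sum.reindex_bij_witness[of _ "\<lambda>l. n - l" "\<lambda>l. n - l"]) auto
  also have "\<dots> = (\<Sum>l\<le>j. (-1) ^ l * coeff (reflect_poly ?p) l * int ((n - l) choose (j - l)))"
  proof (rule sum.mono_neutral_cong_right)
    fix l assume "l \<in> {..j}"
    then have l: "l \<le> j" by simp
    have "(-1::int) ^ (n + (n - l)) = (-1) ^ l"
      using l True by (auto simp: minus_one_power_iff)
    moreover have "(n - l) choose (n - j) = (n - l) choose (j - l)"
      using l True binomial_symmetric[of "j - l" "n - l"] by simp
    ultimately show "(-1) ^ (n + (n - l)) * coeff ?p (n - l) * int ((n - l) choose (n - j))
        = (-1) ^ l * coeff (reflect_poly ?p) l * int ((n - l) choose (j - l))"
      using l True deg by (simp add: coeff_reflect_poly)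
  qed (use True in auto)
  finally show ?thesis by (simp add: shift_coeff_def)
next
  case False
  then have "coeff (reflect_poly (char_poly B)) j = 0"
    using degree_monic_char_poly[OF B] by (simp add: coeff_reflect_poly)
  moreover have "(-1) ^ l * coeff (reflect_poly (char_poly C)) l * int ((n - l) choose (j - l)) = 0" if "l \<le> j" for l
    using degree_monic_char_poly[OF C] False that by (auto simp: coeff_reflect_poly)
  ultimately show ?thesis unfolding shift_coeff_def by (simp add: sum.neutral)
qed


lemma adjacency_matrix_carrier:
  "adjacency_matrix G \<in> carrier_mat (card (pverts G)) (card (pverts G))"
  by (simp add: adjacency_matrix_def Let_def)

lemma adjacency_matrix_complement:
  assumes "finite (pverts G)" "\<And>v. (v,v) \<notin> parcs G"
    and "i < card (pverts G)" "j < card (pverts G)"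
  shows "adjacency_matrix (complement_graph G) $$ (i,j)
    = - minus_ones (adjacency_matrix G) $$ (i,j) - (if i = j then 1 else 0)"
proof -
  let ?vs = "sorted_list_of_set (pverts G)"
  have "?vs ! i \<in> pverts G" "?vs ! j \<in> pverts G"
    using assms nth_mem[of _ ?vs] by auto
  moreover have "?vs ! i = ?vs ! j \<longleftrightarrow> i = j"
    using assms by (simp add: nth_eq_iff_index_eq)
  ultimately show ?thesis using assms
    by (auto simp: adjacency_matrix_def minus_ones_def complement_graph_def Let_def)
qed

lemma sorted_list_of_1_to_n: "sorted_list_of_set {1..n} = [1..<Suc n]"
  by (metis atLeastLessThanSuc_atLeastAtMost sorted_list_of_set_range)

lemma sorted_list_of_set_delete:
  assumes "m < n"
  shows "sorted_list_of_set ({1..n} - {Suc m}) = [1..<Suc m] @ [Suc (Suc m)..<Suc n]"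
proof -
  let ?xs = "[1..<Suc m] @ [Suc (Suc m)..<Suc n]"
  have "set ?xs = {1..n} - {Suc m}" using assms by auto
  moreover have "sorted ?xs" "distinct ?xs" by (auto simp: sorted_append)
  ultimately show ?thesis using sorted_list_of_set.idem_if_sorted_distinct[of ?xs] by simp
qed

lemma adjacency_matrix_delete:
  assumes G: "pverts G = {1..n}" and m: "m < n"
  shows "adjacency_matrix (delete_vertex G (Suc m)) = mat_delete (adjacency_matrix G) m m"
proof -
  have nth: "([1..<Suc m] @ [Suc (Suc m)..<Suc n]) ! i = Suc (if i < m then i else Suc i)" if "i < n - 1" for i
  proof (cases "i < m")
    case True
    then show ?thesis by (simp add: nth_append del: upt_Suc)
  next
    case False
    then have "Suc (Suc m) + (i - m) < Suc n" using that by simp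
    with False show ?thesis by (simp add: nth_append nth_upt del: upt_Suc)
  qed
  have vs: "sorted_list_of_set (pverts (delete_vertex G (Suc m))) = [1..<Suc m] @ [Suc (Suc m)..<Suc n]"
    by (simp only: delete_vertex_def G pair_pre_digraph.simps sorted_list_of_set_delete[OF m])
  have dim: "dim_row (adjacency_matrix (delete_vertex G (Suc m))) = n - 1"
    "dim_col (adjacency_matrix (delete_vertex G (Suc m))) = n - 1"
    "dim_row (adjacency_matrix G) = n" "dim_col (adjacency_matrix G) = n"
    using m by (simp_all add: adjacency_matrix_def Let_def G delete_vertex_def)
  show ?thesis
  proof (rule eq_matI)
    fix i j
    assume "i < dim_row (mat_delete (adjacency_matrix G) m m)" "j < dim_col (mat_delete (adjacency_matrix G) m m)"
    then have i: "i < n - 1" and j: "j < n - 1" by (simp_all add: dim)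
    define i' where "i' = (if i < m then i else Suc i)"
    define j' where "j' = (if j < m then j else Suc j)"
    have bounds: "i' < n" "j' < n" "i' \<noteq> m" "j' \<noteq> m" using i j by (auto simp: i'_def j'_def)
    have "adjacency_matrix (delete_vertex G (Suc m)) $$ (i,j) = (if (Suc i', Suc j') \<in> parcs G then 1 else 0)"
      using i j bounds m unfolding adjacency_matrix_def Let_def vs
      by (simp add: delete_vertex_def nth[OF i] nth[OF j] i'_def[symmetric] j'_def[symmetric] del: upt_Suc One_nat_def)
    moreover have "mat_delete (adjacency_matrix G) m m $$ (i,j) = (if (Suc i', Suc j') \<in> parcs G then 1 else 0)"
    proof -
      have "mat_delete (adjacency_matrix G) m m $$ (i,j) = adjacency_matrix G $$ (i',j')"
        using i j by (simp add: mat_delete_def dim i'_def j'_def)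
      then show ?thesis using bounds
        by (simp add: adjacency_matrix_def Let_def G sorted_list_of_1_to_n nth_upt plus_1_eq_Suc del: upt_Suc One_nat_def)
    qed
    ultimately show "adjacency_matrix (delete_vertex G (Suc m)) $$ (i,j) = mat_delete (adjacency_matrix G) m m $$ (i,j)"
      by simp
  qed (use dim in simp_all)
qed

lemma top_coeffs_conv: "top_coeffs k p = map (coeff (reflect_poly p)) [0..<min k (degree p + 1)]"
  by (auto simp: top_coeffs_def coeff_reflect_poly)

lemma coeffs_conv_reflect: "degree p = n \<Longrightarrow> p \<noteq> 0 \<Longrightarrow> coeffs p = map (\<lambda>j. coeff (reflect_poly p) (n - j)) [0..<Suc n]"
  by (auto simp: coeffs_def coeff_reflect_poly)


section \<open>A calculus for running time and correctness of programs\<close>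


text \<open>
  A bound on the whole memory is the only property of states that enters the cost analysis: it bounds
  the value of every expression in terms of the expression alone.
\<close>

definition fits :: "nat \<Rightarrow> state \<Rightarrow> bool" where
  "fits L s \<longleftrightarrow> (\<forall>x i. \<bar>s x i\<bar> < 2 ^ L)"

primrec width :: "nat \<Rightarrow> aexp \<Rightarrow> nat" where
  "width L (Const k) = bit_size k"
| "width L (Cell x a) = L"
| "width L (Add a b) = width L a + width L b + 1"
| "width L (Sub a b) = width L a + width L b + 1"
| "width L (Mul a b) = width L a + width L b"
| "width L (Div a b) = width L a"

primrec exp_cost :: "nat \<Rightarrow> aexp \<Rightarrow> nat" where
  "exp_cost L (Const k) = bit_size k"
| "exp_cost L (Cell x a) = exp_cost L a + (L + 1)"
| "exp_cost L (Add a b) = exp_cost L a + exp_cost L b + (width L (Add a b) + 1)"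
| "exp_cost L (Sub a b) = exp_cost L a + exp_cost L b + (width L (Sub a b) + 1)"
| "exp_cost L (Mul a b) = exp_cost L a + exp_cost L b + (width L (Mul a b) + 1)"
| "exp_cost L (Div a b) = exp_cost L a + exp_cost L b + (width L (Div a b) + 1)"

text \<open>
  An upper bound for the running time of a program whose loops iterate at most \<open>N\<close> times and whose memory cells
  keep fitting into \<open>L\<close> bits.
\<close>

primrec com_cost :: "nat \<Rightarrow> nat \<Rightarrow> com \<Rightarrow> nat" where
  "com_cost N L Skip = 1"
| "com_cost N L (Assign x a b) = exp_cost L a + exp_cost L b"
| "com_cost N L (Seq c\<^sub>1 c\<^sub>2) = com_cost N L c\<^sub>1 + com_cost N L c\<^sub>2"
| "com_cost N L (IfPos a c\<^sub>1 c\<^sub>2) = exp_cost L a + (com_cost N L c\<^sub>1 + com_cost N L c\<^sub>2)"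
| "com_cost N L (WhilePos a c) = (N + 1) * (exp_cost L a + com_cost N L c)"

lemma bit_size_le: "\<bar>k\<bar> < 2 ^ m \<Longrightarrow> bit_size k \<le> m + 1"
proof -
  assume "\<bar>k\<bar> < 2 ^ m"
  then have "bitlen \<bar>k\<bar> \<le> int m" by (simp add: bitlen_le_iff_power)
  then show ?thesis by (simp add: bit_size_def)
qed

lemma less_power_bit_size: "\<bar>k\<bar> < 2 ^ bit_size k"
proof -
  have "\<bar>k\<bar> < 2 ^ nat (bitlen \<bar>k\<bar>)"
    by (metis abs_ge_zero bitlen_le_iff_power bitlen_nonneg int_nat_eq order_refl)
  also have "\<dots> \<le> (2::int) ^ bit_size k" by (simp add: bit_size_def)
  finally show ?thesis .
qed

lemma abs_div_le: "\<bar>a div b\<bar> \<le> \<bar>a\<bar>" for a b :: int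
proof -
  have pos: "\<bar>a div b\<bar> \<le> \<bar>a\<bar>" if b: "b > 0" for a b :: int
  proof (cases "a div b \<ge> 0")
    case True
    then have "1 * (a div b) \<le> b * (a div b)" using b by (intro mult_right_mono) auto
    also have "\<dots> \<le> a" using b by (simp add: minus_mod_eq_mult_div[symmetric])
    finally show ?thesis using True by simp
  next
    case False
    then have "b * (a div b + 1) \<le> 1 * (a div b + 1)" using b by (intro mult_right_mono_neg) auto
    moreover have "a < b * (a div b + 1)"
    proof -
      have "a = b * (a div b) + a mod b" by (simp only: mult_div_mod_eq)
      with pos_mod_bound[OF b, of a] show ?thesis unfolding distrib_left by linarith
    qed
    ultimately have "a < 1 * (a div b + 1)" by (meson order.strict_trans2)
    then have "a \<le> a div b" by simp
    then show ?thesis using False by (simp add: abs_if)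
  qed
  then show ?thesis
    using pos[of b a] pos[of "- b" "- a"] by (cases "b = 0"; cases "b > 0") (auto simp: div_minus_minus)
qed

lemma abs_add_less_power:
  fixes a b :: int
  assumes "\<bar>a\<bar> < 2 ^ k" "\<bar>b\<bar> < 2 ^ l"
  shows "\<bar>a + b\<bar> < 2 ^ Suc (k + l)" "\<bar>a - b\<bar> < 2 ^ Suc (k + l)"
proof -
  have "(2::int) ^ k \<le> 2 ^ (k + l)" "(2::int) ^ l \<le> 2 ^ (k + l)" by (rule power_increasing; simp)+
  then show "\<bar>a + b\<bar> < 2 ^ Suc (k + l)" "\<bar>a - b\<bar> < 2 ^ Suc (k + l)"
    using assms unfolding power_Suc by arith+
qed

lemma abs_aval_less:
  assumes "fits L s"
  shows "\<bar>aval e s\<bar> < 2 ^ width L e"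
proof (induction e)
  case (Const k) then show ?case by (simp add: less_power_bit_size)
next
  case (Cell x a) then show ?case using assms by (simp add: fits_def)
next
  case (Add a b)
  then show ?case using abs_add_less_power(1) by simp
next
  case (Sub a b)
  then show ?case using abs_add_less_power(2) by simp
next
  case (Mul a b)
  then show ?case by (simp add: abs_mult power_add mult_strict_mono')
next
  case (Div a b)
  then show ?case using abs_div_le[of "aval a s" "aval b s"] by simp
qed

lemma acost_le:
  assumes "fits L s"
  shows "acost e s \<le> exp_cost L e"
proof (induction e)
  case (Cell x a)
  then show ?case using bit_size_le[of "s x (aval a s)" L] assms by (simp add: fits_def)
next
  case (Add a b)
  then show ?case using bit_size_le[OF abs_aval_less[OF assms, of "Add a b"]] by simp
next
  case (Sub a b)
  then show ?case using bit_size_le[OF abs_aval_less[OF assms, of "Sub a b"]] by simp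
next
  case (Mul a b)
  then show ?case using bit_size_le[OF abs_aval_less[OF assms, of "Mul a b"]] by simp
next
  case (Div a b)
  then show ?case using bit_size_le[OF abs_aval_less[OF assms, of "Div a b"]] by simp
qed simp


text \<open>
  Total correctness together with the two resource bounds. Only the size of stored values and the number of
  iterations of loops have to be established along a run; the running time is then bounded by the syntax of the program.
\<close>

definition run :: "nat \<Rightarrow> nat \<Rightarrow> com \<Rightarrow> state \<Rightarrow> (state \<Rightarrow> bool) \<Rightarrow> bool" where
  "run N L c s Q \<longleftrightarrow>
     (fits L s \<longrightarrow> (\<exists>t s'. exec c s t s' \<and> t \<le> com_cost N L c \<and> fits L s' \<and> Q s'))"

lemma run_conseq: "run N L c s Q \<Longrightarrow> (\<And>s'. Q s' \<Longrightarrow> R s') \<Longrightarrow> run N L c s R"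
  unfolding run_def by blast

lemma run_Assign:
  assumes "\<bar>aval b s\<bar> < 2 ^ L" "Q (s(x := (s x)(aval a s := aval b s)))"
  shows "run N L (Assign x a b) s Q"
  unfolding run_def
proof
  assume s: "fits L s"
  have "fits L (s(x := (s x)(aval a s := aval b s)))" using s assms(1) by (simp add: fits_def)
  moreover have "acost a s + acost b s \<le> com_cost N L (Assign x a b)"
    using acost_le[OF s] by (simp add: add_mono)
  ultimately show "\<exists>t s'. exec (Assign x a b) s t s' \<and> t \<le> com_cost N L (Assign x a b) \<and> fits L s' \<and> Q s'"
    using exec.Assign[of x a b s] assms(2) by blast
qed

lemma run_Seq:
  assumes "run N L c\<^sub>1 s R" "\<And>s'. R s' \<Longrightarrow> run N L c\<^sub>2 s' Q"
  shows "run N L (Seq c\<^sub>1 c\<^sub>2) s Q"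
  unfolding run_def
proof
  assume "fits L s"
  with assms(1) obtain t s' where 1: "exec c\<^sub>1 s t s'" "t \<le> com_cost N L c\<^sub>1" "fits L s'" "R s'"
    unfolding run_def by blast
  with assms(2) obtain t' s'' where 2: "exec c\<^sub>2 s' t' s''" "t' \<le> com_cost N L c\<^sub>2" "fits L s''" "Q s''"
    unfolding run_def by blast
  from 1 2 exec.Seq[OF 1(1) 2(1)]
  show "\<exists>t s'. exec (Seq c\<^sub>1 c\<^sub>2) s t s' \<and> t \<le> com_cost N L (Seq c\<^sub>1 c\<^sub>2) \<and> fits L s' \<and> Q s'"
    by (intro exI[of _ "t + t'"] exI[of _ s'']) simp
qed

lemma exec_WhilePos:
  assumes step: "\<And>j s. j < m \<Longrightarrow> I j s \<Longrightarrow> aval a s > 0 \<and> (\<exists>t s'. exec c s t s' \<and> t \<le> K \<and> I (Suc j) s')"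
    and stop: "\<And>s. I m s \<Longrightarrow> aval a s \<le> 0"
    and test: "\<And>j s. I j s \<Longrightarrow> acost a s \<le> A"
    and "j \<le> m" "I j s"
  shows "\<exists>t s'. exec (WhilePos a c) s t s' \<and> t \<le> (m - j) * (A + K) + A \<and> I m s'"
  using assms(4,5)
proof (induction "m - j" arbitrary: j s)
  case 0
  then have "j = m" by simp
  then show ?case using exec.WhileFalse[OF stop, of s] test[of j s] 0 by auto
next
  case (Suc k)
  then have j: "j < m" "k = m - Suc j" "m - j = Suc (m - Suc j)" by auto
  from step[OF j(1) Suc.prems(2)] obtain t s' where
    1: "aval a s > 0" "exec c s t s'" "t \<le> K" "I (Suc j) s'" by blast
  from Suc.hyps(1)[OF j(2) _ 1(4)] j obtain t' s'' where
    2: "exec (WhilePos a c) s' t' s''" "t' \<le> (m - Suc j) * (A + K) + A" "I m s''" by auto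
  have "acost a s + t + t' \<le> (m - j) * (A + K) + A"
    unfolding j(3) using 1 2 test[OF Suc.prems(2)] by simp
  with exec.WhileTrue[OF 1(1,2) 2(1)] 2(3) show ?case by blast
qed

abbreviation Var :: "aname \<Rightarrow> aexp" where
  "Var x \<equiv> Cell x (Const 0)"

abbreviation set_var :: "aname \<Rightarrow> int \<Rightarrow> state \<Rightarrow> state" where
  "set_var x k s \<equiv> s(x := (s x)(0 := k))"

definition Loop :: "aname \<Rightarrow> aexp \<Rightarrow> com \<Rightarrow> com" where
  "Loop v lm c =
     Seq (Assign v (Const 0) (Const 0))
       (WhilePos (Sub lm (Var v)) (Seq c (Assign v (Const 0) (Add (Var v) (Const 1)))))"

lemma run_Loop:
  assumes m: "m \<le> N" "int m < 2 ^ L"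
    and start: "I 0 (set_var v 0 s)"
    and step: "\<And>j s'. j < m \<Longrightarrow> I j s' \<Longrightarrow> s' v 0 = int j \<Longrightarrow>
      run N L c s' (\<lambda>s''. s'' v 0 = int j \<and> I (Suc j) (set_var v (int (Suc j)) s''))"
    and lm: "\<And>j s'. j \<le> m \<Longrightarrow> I j s' \<Longrightarrow> s' v 0 = int j \<Longrightarrow> aval lm s' = int m"
    and post: "\<And>s'. I m s' \<Longrightarrow> s' v 0 = int m \<Longrightarrow> Q s'"
  shows "run N L (Loop v lm c) s Q"
  unfolding Loop_def
proof (rule run_Seq[OF run_Assign])
  let ?incr = "Assign v (Const 0) (Add (Var v) (Const 1))"
  let ?body = "Seq c ?incr"
  let ?test = "Sub lm (Var v)"
  fix s'
  assume s': "s' = set_var v 0 s"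
  show "run N L (WhilePos ?test ?body) s' Q"
    unfolding run_def
  proof
    assume fits: "fits L s'"
    let ?I = "\<lambda>j s'. j \<le> m \<and> fits L s' \<and> s' v 0 = int j \<and> I j s'"
    have "\<exists>t s''. exec (WhilePos ?test ?body) s' t s'' \<and>
        t \<le> (m - 0) * (exp_cost L ?test + com_cost N L ?body) + exp_cost L ?test \<and> ?I m s''"
    proof (rule exec_WhilePos[where I = ?I])
      fix j s assume j: "j < m" and I: "?I j s"
      have "run N L ?body s (\<lambda>s'. s' v 0 = int (Suc j) \<and> I (Suc j) s')"
      proof (rule run_Seq[OF step[OF j]])
        fix s' assume s': "s' v 0 = int j \<and> I (Suc j) (set_var v (int (Suc j)) s')"
        then have val: "aval (Add (Var v) (Const 1)) s' = int (Suc j)" by simp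
        have "\<bar>aval (Add (Var v) (Const 1)) s'\<bar> < 2 ^ L" unfolding val using j m by linarith
        then show "run N L ?incr s' (\<lambda>s'. s' v 0 = int (Suc j) \<and> I (Suc j) s')"
          by (rule run_Assign) (use s' in \<open>simp add: val del: aval.simps(3)\<close>)
      qed (use I in auto)
      then show "aval ?test s > 0 \<and> (\<exists>t s'. exec ?body s t s' \<and> t \<le> com_cost N L ?body \<and> ?I (Suc j) s')"
        using I j lm[of j s] unfolding run_def by auto
    next
      fix s assume "?I m s"
      then show "aval ?test s \<le> 0" using lm[of m s] by simp
    next
      fix j s assume "?I j s"
      then show "acost ?test s \<le> exp_cost L ?test" using acost_le by blast
    qed (use fits start s' in auto)
    then obtain t s'' where "exec (WhilePos ?test ?body) s' t s''"
      "t \<le> m * (exp_cost L ?test + com_cost N L ?body) + exp_cost L ?test" "?I m s''" by auto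
    moreover from this(2) have "t \<le> com_cost N L (WhilePos ?test ?body)"
    proof -
      have "m * (exp_cost L ?test + com_cost N L ?body) \<le> N * (exp_cost L ?test + com_cost N L ?body)"
        by (rule mult_right_mono[OF m(1)]) simp
      with \<open>t \<le> _\<close> show ?thesis by simp
    qed
    ultimately show "\<exists>t s''. exec (WhilePos ?test ?body) s' t s'' \<and> t \<le> com_cost N L (WhilePos ?test ?body)
        \<and> fits L s'' \<and> Q s''" using post by blast
  qed
qed auto

definition same_but :: "aname set \<Rightarrow> state \<Rightarrow> state \<Rightarrow> bool" where
  "same_but X s s' \<longleftrightarrow> (\<forall>x. x \<notin> X \<longrightarrow> s' x = s x)"

definition Sum :: "aname \<Rightarrow> aname \<Rightarrow> aexp \<Rightarrow> aexp \<Rightarrow> com" where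
  "Sum acc v lm e =
     Seq (Assign acc (Const 0) (Const 0)) (Loop v lm (Assign acc (Const 0) (Add (Var acc) e)))"

lemma run_Sum:
  assumes "acc \<noteq> v" and m: "m \<le> N" "int m < 2 ^ L"
    and lm: "\<And>s'. same_but {acc,v} s s' \<Longrightarrow> aval lm s' = int m"
    and e: "\<And>l s'. l < m \<Longrightarrow> same_but {acc,v} s s' \<Longrightarrow> s' v 0 = int l \<Longrightarrow> aval e s' = F l"
    and bound: "\<And>l. l \<le> m \<Longrightarrow> \<bar>\<Sum>i<l. F i\<bar> < 2 ^ L"
  shows "run N L (Sum acc v lm e) s (\<lambda>s'. same_but {acc,v} s s' \<and> s' acc 0 = (\<Sum>i<m. F i))"
  unfolding Sum_def
proof (rule run_Seq[OF run_Assign])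
  let ?I = "\<lambda>j s'. same_but {acc,v} s s' \<and> s' acc 0 = (\<Sum>i<j. F i)"
  fix s0 assume s0: "s0 = set_var acc 0 s"
  show "run N L (Loop v lm (Assign acc (Const 0) (Add (Var acc) e))) s0 (?I m)"
  proof (rule run_Loop[where I = ?I and m = m])
    fix j s' assume j: "j < m" and I: "?I j s'" and v: "s' v 0 = int j"
    have e: "aval e s' = F j" using e j I v by blast
    show "run N L (Assign acc (Const 0) (Add (Var acc) e)) s'
      (\<lambda>s''. s'' v 0 = int j \<and> ?I (Suc j) (set_var v (int (Suc j)) s''))"
      using bound[of "Suc j"] j I v e \<open>acc \<noteq> v\<close>
      by (intro run_Assign) (auto simp: same_but_def)
  next
    show "?I 0 (set_var v 0 s0)" using s0 \<open>acc \<noteq> v\<close> by (simp add: same_but_def)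
  next
    fix j s' assume "?I j s'"
    then show "aval lm s' = int m" using lm by blast
  qed (rule m | assumption)+
qed simp_all


definition poly_bounded :: "(nat \<Rightarrow> nat) \<Rightarrow> bool" where
  "poly_bounded f \<longleftrightarrow> (\<exists>C d. \<forall>n\<ge>1. f n \<le> C * n ^ d)"

lemma poly_bounded_const: "poly_bounded (\<lambda>_. k)"
  unfolding poly_bounded_def by (rule exI[of _ k], rule exI[of _ 0]) simp

lemma poly_bounded_add:
  assumes "poly_bounded f" "poly_bounded g"
  shows "poly_bounded (\<lambda>n. f n + g n)"
proof -
  from assms obtain C d C' d' where f: "\<And>n. n \<ge> 1 \<Longrightarrow> f n \<le> C * n ^ d" and g: "\<And>n. n \<ge> 1 \<Longrightarrow> g n \<le> C' * n ^ d'"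
    unfolding poly_bounded_def by blast
  have "f n + g n \<le> (C + C') * n ^ (d + d')" if "n \<ge> 1" for n
  proof -
    have "n ^ d \<le> n ^ (d + d')" "n ^ d' \<le> n ^ (d + d')" using that by (simp_all add: power_increasing)
    from this[THEN mult_le_mono2] have "C * n ^ d \<le> C * n ^ (d + d')" "C' * n ^ d' \<le> C' * n ^ (d + d')" by blast+
    then show ?thesis using f[OF that] g[OF that] unfolding add_mult_distrib by linarith
  qed
  then show ?thesis unfolding poly_bounded_def by blast
qed

lemma poly_bounded_mult:
  assumes "poly_bounded f" "poly_bounded g"
  shows "poly_bounded (\<lambda>n. f n * g n)"
proof -
  from assms obtain C d C' d' where f: "\<And>n. n \<ge> 1 \<Longrightarrow> f n \<le> C * n ^ d" and g: "\<And>n. n \<ge> 1 \<Longrightarrow> g n \<le> C' * n ^ d'"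
    unfolding poly_bounded_def by blast
  have "f n * g n \<le> (C * C') * n ^ (d + d')" if "n \<ge> 1" for n
    using mult_le_mono[OF f[OF that] g[OF that]] by (simp add: power_add mult_ac)
  then show ?thesis unfolding poly_bounded_def by blast
qed

text \<open>
  Nesting depth is fixed by the program, so bounds that are polynomial in \<open>n\<close> on iterations and bit size
  give a polynomial bound on the running time.
\<close>

lemma poly_bounded_com_cost:
  assumes N: "poly_bounded N" and L: "poly_bounded L"
  shows "poly_bounded (\<lambda>n. com_cost (N n) (L n) c)"
proof -
  note intros = poly_bounded_const poly_bounded_add poly_bounded_mult N L
  have w: "poly_bounded (\<lambda>n. width (L n) e)" for e
    by (induction e) (simp_all only: width.simps, (intro intros; assumption)+)
  have e: "poly_bounded (\<lambda>n. exp_cost (L n) e)" for e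
    by (induction e) (simp_all only: exp_cost.simps, (intro intros w; assumption)+)
  show ?thesis
    by (induction c) (simp_all only: com_cost.simps, (intro intros e; assumption)+)
qed


inductive_cases exec_SkipE: "exec Skip s t s'"
inductive_cases exec_AssignE: "exec (Assign x a b) s t s'"
inductive_cases exec_SeqE: "exec (Seq c\<^sub>1 c\<^sub>2) s t s'"
inductive_cases exec_IfPosE: "exec (IfPos a c\<^sub>1 c\<^sub>2) s t s'"
inductive_cases exec_WhilePosE: "exec (WhilePos a c) s t s'"

lemma exec_deterministic: "exec c s t s' \<Longrightarrow> exec c s t' s'' \<Longrightarrow> s'' = s'"
proof (induction arbitrary: t' s'' rule: exec.induct)
  case (Skip s)
  then show ?case by (auto elim: exec_SkipE)
next
  case (Assign x a b s)
  then show ?case by (auto elim: exec_AssignE)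
next
  case (Seq c\<^sub>1 s t\<^sub>1 u c\<^sub>2 t\<^sub>2 u')
  from Seq.prems obtain t\<^sub>3 t\<^sub>4 v where "exec c\<^sub>1 s t\<^sub>3 v" "exec c\<^sub>2 v t\<^sub>4 s''" by (rule exec_SeqE)
  with Seq.IH(1)[of t\<^sub>3 v] Seq.IH(2)[of t\<^sub>4 s''] show ?case by simp
next
  case (IfTrue a s c\<^sub>1 t u c\<^sub>2)
  from IfTrue.prems obtain t\<^sub>3 where "exec c\<^sub>1 s t\<^sub>3 s''"
    by (rule exec_IfPosE) (use IfTrue.hyps in auto)
  with IfTrue.IH show ?case by simp
next
  case (IfFalse a s c\<^sub>2 t u c\<^sub>1)
  from IfFalse.prems obtain t\<^sub>3 where "exec c\<^sub>2 s t\<^sub>3 s''"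
    by (rule exec_IfPosE) (use IfFalse.hyps in auto)
  with IfFalse.IH show ?case by simp
next
  case (WhileFalse a s c)
  from WhileFalse.prems show ?case
    by (rule exec_WhilePosE) (use WhileFalse.hyps in auto)
next
  case (WhileTrue a s c t\<^sub>1 u t\<^sub>2 u')
  from WhileTrue.prems obtain t\<^sub>3 t\<^sub>4 v where "exec c s t\<^sub>3 v" "exec (WhilePos a c) v t\<^sub>4 s''"
    by (rule exec_WhilePosE) (use WhileTrue.hyps in auto)
  with WhileTrue.IH(1)[of t\<^sub>3 v] WhileTrue.IH(2)[of t\<^sub>4 s''] show ?case by simp
qed


section \<open>Programs for the substitution of -1-x\<close>

lemma run_Loop_invariant:
  assumes "m \<le> N" "int m < 2 ^ L"
    and "I 0 (set_var v 0 s)"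
    and "\<And>j s'. j < m \<Longrightarrow> I j s' \<Longrightarrow> s' v 0 = int j \<Longrightarrow>
      run N L c s' (\<lambda>s''. s'' v 0 = int j \<and> I (Suc j) (set_var v (int (Suc j)) s''))"
    and "\<And>j s'. j \<le> m \<Longrightarrow> I j s' \<Longrightarrow> s' v 0 = int j \<Longrightarrow> aval lm s' = int m"
  shows "run N L (Loop v lm c) s (I m)"
  by (rule run_Loop[where I = I]) (use assms in auto)

lemma run_Assign_Seq:
  assumes "\<bar>aval b s\<bar> < 2 ^ L" "run N L c (s(x := (s x)(aval a s := aval b s))) Q"
  shows "run N L (Seq (Assign x a b) c) s Q"
  by (rule run_Seq[OF run_Assign, where R = "\<lambda>s'. s' = s(x := (s x)(aval a s := aval b s))"]) (use assms in auto)

abbreviation seq_infix (infixr ";;" 55) where "c ;; c' \<equiv> Seq c c'"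
abbreviation add_infix (infixl "[+]" 65) where "a [+] b \<equiv> Add a b"
abbreviation sub_infix (infixl "[-]" 65) where "a [-] b \<equiv> Sub a b"
abbreviation mul_infix (infixl "[*]" 70) where "a [*] b \<equiv> Mul a b"
abbreviation div_infix (infixl "[div]" 70) where "a [div] b \<equiv> Div a b"

text \<open>
  Computes \<open>shift_coeff\<close>, adding for each \<open>l\<close> the coefficients of \<open>(-1)\<^sup>l c\<^sub>l (x + 1)\<^sup>d\<^sup>-\<^sup>l\<close>. The variable \<open>b\<close>
  runs through these coefficients, each obtained from the previous one by an exact division. One cell beyond the degree
  is cleared because the walk recursion reads it when \<open>n = 3\<close>.
\<close>

definition shift_prog :: "aexp \<Rightarrow> com" where
  "shift_prog len =
     Loop ''t'' (Var ''d'' [+] Const 2) (Assign ''g'' (Var ''t'') (Const 0)) ;;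
     Assign ''sign'' (Const 0) (Const 1) ;;
     Loop ''l'' len (
       Assign ''b'' (Const 0) (Var ''sign'' [*] Cell ''c'' (Var ''l'')) ;;
       Loop ''t'' (Var ''d'' [-] Var ''l'' [+] Const 1) (
         Assign ''g'' (Var ''l'' [+] Var ''t'') (Cell ''g'' (Var ''l'' [+] Var ''t'') [+] Var ''b'') ;;
         Assign ''b'' (Const 0) ((Var ''b'' [*] (Var ''d'' [-] Var ''l'' [-] Var ''t'')) [div] (Var ''t'' [+] Const 1))) ;;
       Assign ''sign'' (Const 0) (Const 0 [-] Var ''sign''))"

lemma choose_Suc_step:
  assumes "t \<le> m"
  shows "int (m choose t) * (int m - int t) = (int t + 1) * int (m choose Suc t)"
proof -
  have "Suc t * (m choose Suc t) = (m - t) * (m choose t)"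
    unfolding binomial_absorption binomial_absorb_comp ..
  then have "int (Suc t) * int (m choose Suc t) = int (m - t) * int (m choose t)"
    by (metis of_nat_mult)
  then show ?thesis using assms by (simp add: of_nat_diff algebra_simps)
qed

lemma run_shift_prog:
  fixes d len :: nat and s :: state
  defines "a \<equiv> \<lambda>l. if l < len then s ''c'' (int l) else 0"
    and "X \<equiv> {''g'',''sign'',''b'',''l'',''t''}"
  assumes d: "s ''d'' 0 = int d"
    and len: "\<And>s'. same_but X s s' \<Longrightarrow> aval lenx s' = int len" "len \<le> d + 1"
    and c: "\<And>l. l < len \<Longrightarrow> \<bar>s ''c'' (int l)\<bar> \<le> 2 ^ K"
    and N: "d + 2 \<le> N" and E: "d + 2 \<le> 2 ^ E" "d \<le> E" and L: "K + 2 * E < L"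
  shows "run N L (shift_prog lenx) s (\<lambda>s'. same_but X s s' \<and>
           (\<forall>j\<le>d+1. s' ''g'' (int j) = shift_coeff d a j))"
proof -
  define summand where "summand = (\<lambda>l j. (-1) ^ l * a l * (if l \<le> j then int ((d - l) choose (j - l)) else 0))"
  define G where "G = (\<lambda>l j. \<Sum>x<l. summand x j)"
  have small: "int x < 2 ^ L" if "x \<le> d + 2" for x
  proof -
    have "int x \<le> 2 ^ E" using that E(1) by (simp add: order_trans[of "int x" "int (d + 2)"] numeral_power_le_of_nat_cancel_iff flip: of_nat_power)
    also have "(2::int) ^ E < 2 ^ L" using L by (intro power_strict_increasing) auto
    finally show ?thesis .
  qed
  have a_bound: "\<bar>a l\<bar> \<le> 2 ^ K" for l using c by (simp add: a_def)
  have choose_bound: "int ((d - l) choose t) \<le> 2 ^ E" for l t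
  proof -
    have "(d - l) choose t \<le> 2 ^ (d - l)" by (rule binomial_le_pow2)
    also have "\<dots> \<le> 2 ^ E" using E(2) by (intro power_increasing) auto
    finally show ?thesis by (metis of_nat_le_iff of_nat_numeral of_nat_power)
  qed
  have prod_bound: "\<bar>(-1) ^ l * a l * int ((d - l) choose t)\<bar> \<le> 2 ^ (K + E)" for l t
    unfolding abs_mult power_add using a_bound[of l] choose_bound[of l t]
    by (simp add: mult_mono)
  have summand_bound: "\<bar>summand l j\<bar> \<le> 2 ^ (K + E)" for l j
    using prod_bound[of l "j - l"] by (simp add: summand_def)
  have G_bound: "\<bar>G l j\<bar> \<le> int l * 2 ^ (K + E)" for l j
  proof -
    have "\<bar>G l j\<bar> \<le> (\<Sum>x<l. \<bar>summand x j\<bar>)" unfolding G_def by (rule sum_abs)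
    also have "\<dots> \<le> (\<Sum>x<l. 2 ^ (K + E))" by (rule sum_mono) (rule summand_bound)
    finally show ?thesis by simp
  qed
  have G_Suc_bound: "\<bar>G l j + y\<bar> < 2 ^ L" if "\<bar>y\<bar> \<le> 2 ^ (K + E)" "l \<le> d" for l j y
  proof -
    have "\<bar>G l j + y\<bar> \<le> int l * 2 ^ (K + E) + 1 * 2 ^ (K + E)" using G_bound[of l j] that by linarith
    also have "\<dots> = int (Suc l) * 2 ^ (K + E)" by (simp add: distrib_right)
    also have "\<dots> \<le> 2 ^ E * 2 ^ (K + E)"
    proof (rule mult_right_mono)
      have "Suc l \<le> 2 ^ E" using that E(1) by simp
      then show "int (Suc l) \<le> 2 ^ E" by (metis of_nat_le_iff of_nat_numeral of_nat_power)
    qed simp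
    also have "\<dots> = 2 ^ (K + 2 * E)" by (simp add: power_add[symmetric])
    also have "(2::int) ^ (K + 2 * E) < 2 ^ L" using L by (intro power_strict_increasing) auto
    finally show ?thesis .
  qed
  have KE_less: "(2::int) ^ (K + E) < 2 ^ L" using L by (intro power_strict_increasing) auto
  show ?thesis
    unfolding shift_prog_def
  proof (rule run_Seq)
    let ?I = "\<lambda>t s'. same_but X s s' \<and> (\<forall>j<t. s' ''g'' (int j) = 0)"
    show "run N L (Loop ''t'' (Var ''d'' [+] Const 2) (Assign ''g'' (Var ''t'') (Const 0))) s (?I (d + 2))"
    proof (rule run_Loop_invariant[where I = ?I and m = "d + 2"])
      fix j s' assume "j < d + 2" "?I j s'" "s' ''t'' 0 = int j"
      then show "run N L (Assign ''g'' (Var ''t'') (Const 0)) s' (\<lambda>s''. s'' ''t'' 0 = int j \<and> ?I (Suc j) (set_var ''t'' (int (Suc j)) s''))"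
        by (intro run_Assign) (auto simp: same_but_def X_def less_Suc_eq)
    qed (rule N, rule small, use d in \<open>auto simp: same_but_def X_def\<close>)
  next
    fix s1 assume s1: "same_but X s s1 \<and> (\<forall>j<d+2. s1 ''g'' (int j) = 0)"
    let ?I = "\<lambda>l s'. same_but X s s' \<and> s' ''sign'' 0 = (-1) ^ l \<and> (\<forall>j\<le>d+1. s' ''g'' (int j) = G l j)"
    show "run N L (Assign ''sign'' (Const 0) (Const 1) ;;
     Loop ''l'' lenx (
       Assign ''b'' (Const 0) (Var ''sign'' [*] Cell ''c'' (Var ''l'')) ;;
       Loop ''t'' (Var ''d'' [-] Var ''l'' [+] Const 1) (
         Assign ''g'' (Var ''l'' [+] Var ''t'') (Cell ''g'' (Var ''l'' [+] Var ''t'') [+] Var ''b'') ;;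
         Assign ''b'' (Const 0) ((Var ''b'' [*] (Var ''d'' [-] Var ''l'' [-] Var ''t'')) [div] (Var ''t'' [+] Const 1))) ;;
       Assign ''sign'' (Const 0) (Const 0 [-] Var ''sign''))) s1
     (\<lambda>s'. same_but X s s' \<and> (\<forall>j\<le>d+1. s' ''g'' (int j) = shift_coeff d a j))"
    proof (rule run_Assign_Seq)
      show "\<bar>aval (Const 1) s1\<bar> < 2 ^ L" using small[of 1] by simp
      let ?s2 = "s1(''sign'' := (s1 ''sign'')(aval (Const 0) s1 := aval (Const 1) s1))"
      show "run N L (Loop ''l'' lenx (
       Assign ''b'' (Const 0) (Var ''sign'' [*] Cell ''c'' (Var ''l'')) ;;
       Loop ''t'' (Var ''d'' [-] Var ''l'' [+] Const 1) (
         Assign ''g'' (Var ''l'' [+] Var ''t'') (Cell ''g'' (Var ''l'' [+] Var ''t'') [+] Var ''b'') ;;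
         Assign ''b'' (Const 0) ((Var ''b'' [*] (Var ''d'' [-] Var ''l'' [-] Var ''t'')) [div] (Var ''t'' [+] Const 1))) ;;
       Assign ''sign'' (Const 0) (Const 0 [-] Var ''sign''))) ?s2
     (\<lambda>s'. same_but X s s' \<and> (\<forall>j\<le>d+1. s' ''g'' (int j) = shift_coeff d a j))"
      proof (rule run_Loop[where I = ?I and m = len])
        show "?I 0 (set_var ''l'' 0 ?s2)"
          using s1 by (auto simp: same_but_def X_def G_def)
      next
        fix l s2 assume l: "l < len" and I: "?I l s2" and v: "s2 ''l'' 0 = int l"
        let ?y = "(-1) ^ l * a l"
        \<comment> \<open>After t steps of the inner loop, the first t coefficients of the l-th summand have been added.\<close>
        let ?J = "\<lambda>t s'. same_but X s s' \<and> s' ''sign'' 0 = (-1) ^ l \<and> s' ''l'' 0 = int l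
          \<and> s' ''b'' 0 = ?y * int ((d - l) choose t)
          \<and> (\<forall>j\<le>d+1. s' ''g'' (int j) = G l j + (if l \<le> j \<and> j < l + t then ?y * int ((d - l) choose (j - l)) else 0))"
        have ld: "l \<le> d" using l len(2) by simp
        have cl: "s2 ''c'' (int l) = a l" using I l by (simp add: a_def same_but_def X_def)
        show "run N L (
           Assign ''b'' (Const 0) (Var ''sign'' [*] Cell ''c'' (Var ''l'')) ;;
           Loop ''t'' (Var ''d'' [-] Var ''l'' [+] Const 1) (
             Assign ''g'' (Var ''l'' [+] Var ''t'') (Cell ''g'' (Var ''l'' [+] Var ''t'') [+] Var ''b'') ;;
             Assign ''b'' (Const 0) ((Var ''b'' [*] (Var ''d'' [-] Var ''l'' [-] Var ''t'')) [div] (Var ''t'' [+] Const 1))) ;;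
           Assign ''sign'' (Const 0) (Const 0 [-] Var ''sign'')) s2
           (\<lambda>s''. s'' ''l'' 0 = int l \<and> ?I (Suc l) (set_var ''l'' (int (Suc l)) s''))"
        proof (rule run_Assign_Seq, goal_cases)
          case 1
          have "aval (Var ''sign'' [*] Cell ''c'' (Var ''l'')) s2 = ?y * int ((d - l) choose 0)"
            using I v cl by simp
          then show ?case using le_less_trans[OF prod_bound[of l 0] KE_less] by (simp only:)
        next
          case 2
          show ?case
          proof (rule run_Seq)
            show "run N L (Loop ''t'' (Var ''d'' [-] Var ''l'' [+] Const 1) (
             Assign ''g'' (Var ''l'' [+] Var ''t'') (Cell ''g'' (Var ''l'' [+] Var ''t'') [+] Var ''b'') ;;
             Assign ''b'' (Const 0) ((Var ''b'' [*] (Var ''d'' [-] Var ''l'' [-] Var ''t'')) [div] (Var ''t'' [+] Const 1))))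
             (s2(''b'' := (s2 ''b'')(aval (Const 0) s2 := aval (Var ''sign'' [*] Cell ''c'' (Var ''l'')) s2)))
             (?J (d - l + 1))"
            proof (rule run_Loop_invariant[where I = ?J and m = "d - l + 1"])
              fix t s3 assume t: "t < d - l + 1" and J: "?J t s3" and vt: "s3 ''t'' 0 = int t"
              have "l + t \<le> d + 1" using t ld by simp
              then have g: "s3 ''g'' (int l + int t) = G l (l + t)"
              proof -
                from J have "\<forall>j\<le>d+1. s3 ''g'' (int j) = G l j + (if l \<le> j \<and> j < l + t then ?y * int ((d - l) choose (j - l)) else 0)"
                  by (elim conjE)
                from this[rule_format, OF \<open>l + t \<le> d + 1\<close>] show ?thesis by simp
              qed
              have b: "s3 ''b'' 0 = ?y * int ((d - l) choose t)" using J by blast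
              have step: "(?y * int ((d - l) choose t)) * (int d - int l - int t) div (int t + 1)
                = ?y * int ((d - l) choose Suc t)"
              proof -
                have "(?y * int ((d - l) choose t)) * (int d - int l - int t)
                    = ?y * (int ((d - l) choose t) * (int (d - l) - int t))"
                  using ld by (simp add: of_nat_diff)
                also have "\<dots> = (int t + 1) * (?y * int ((d - l) choose Suc t))"
                  using choose_Suc_step[of t "d - l"] t by simp
                finally have eq: "(?y * int ((d - l) choose t)) * (int d - int l - int t)
                    = (int t + 1) * (?y * int ((d - l) choose Suc t))" .
                have "int t + 1 \<noteq> 0" by simp
                then show ?thesis unfolding eq by (rule nonzero_mult_div_cancel_left)
              qed
              show "run N L (
                 Assign ''g'' (Var ''l'' [+] Var ''t'') (Cell ''g'' (Var ''l'' [+] Var ''t'') [+] Var ''b'') ;;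
                 Assign ''b'' (Const 0) ((Var ''b'' [*] (Var ''d'' [-] Var ''l'' [-] Var ''t'')) [div] (Var ''t'' [+] Const 1))) s3
                 (\<lambda>s''. s'' ''t'' 0 = int t \<and> ?J (Suc t) (set_var ''t'' (int (Suc t)) s''))"
              proof (rule run_Assign_Seq, goal_cases)
                case 1
                have "aval (Cell ''g'' (Var ''l'' [+] Var ''t'') [+] Var ''b'') s3 = G l (l + t) + ?y * int ((d - l) choose t)"
                  using J vt g b by simp
                then show ?case using G_Suc_bound[OF prod_bound[of l t] ld, of "l + t"] by (simp only:)
              next
                case 2
                have sd: "s3 ''d'' 0 = int d" using J d by (simp add: same_but_def X_def)
                show ?case
                proof (rule run_Assign, goal_cases)
                  case 1
                  have "aval (Var ''b'' [*] (Var ''d'' [-] Var ''l'' [-] Var ''t'') [div] (Var ''t'' [+] Const 1))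
                      (s3(''g'' := (s3 ''g'')(aval (Var ''l'' [+] Var ''t'') s3 := aval (Cell ''g'' (Var ''l'' [+] Var ''t'') [+] Var ''b'') s3)))
                    = ?y * int ((d - l) choose Suc t)"
                    using J vt b sd step by simp
                  then show ?case using le_less_trans[OF prod_bound[of l "Suc t"] KE_less] by (simp only:)
                next
                  case 2
                  from J have sb: "same_but X s s3" and sg: "s3 ''sign'' 0 = (-1) ^ l" and vl: "s3 ''l'' 0 = int l"
                    and gs: "\<forall>j\<le>d+1. s3 ''g'' (int j) = G l j + (if l \<le> j \<and> j < l + t then ?y * int ((d - l) choose (j - l)) else 0)"
                    by blast+
                  have new: "((s3 ''g'')(int l + int t := G l (l + t) + ?y * int ((d - l) choose t))) (int j)
                      = G l j + (if l \<le> j \<and> j < l + Suc t then ?y * int ((d - l) choose (j - l)) else 0)"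
                    if "j \<le> d + 1" for j
                  proof (cases "j = l + t")
                    case False
                    then have "int j \<noteq> int l + int t" by linarith
                    then show ?thesis using gs that False by auto
                  qed simp
                  show ?case
                    using sb sg vl vt sd b g step new by (simp add: same_but_def X_def del: fun_upd_apply add: fun_upd_same fun_upd_other)
                qed
              qed
            next
              show "?J 0 (set_var ''t'' 0 (s2(''b'' := (s2 ''b'')(aval (Const 0) s2 := aval (Var ''sign'' [*] Cell ''c'' (Var ''l'')) s2))))"
                using I v cl by (auto simp: same_but_def X_def)
            next
              fix t s3 assume "?J t s3"
              then show "aval (Var ''d'' [-] Var ''l'' [+] Const 1) s3 = int (d - l + 1)"
                using d ld by (simp add: same_but_def X_def of_nat_diff)
            next
              show "d - l + 1 \<le> N" using N by simp
              show "int (d - l + 1) < 2 ^ L" by (rule small) simp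
            qed
          next
            fix s3 assume J: "?J (d - l + 1) s3"
            have "G l j + (if l \<le> j \<and> j < l + (d - l + 1) then ?y * int ((d - l) choose (j - l)) else 0) = G (Suc l) j"
              if "j \<le> d + 1" for j
              using that ld by (auto simp: G_def summand_def)
            then show "run N L (Assign ''sign'' (Const 0) (Const 0 [-] Var ''sign'')) s3
              (\<lambda>s''. s'' ''l'' 0 = int l \<and> ?I (Suc l) (set_var ''l'' (int (Suc l)) s''))"
              using J small[of 1]
              by (intro run_Assign) (auto simp: same_but_def X_def)
          qed
        qed
      next
        fix s' assume I: "?I len s'" 
        have "G len j = shift_coeff d a j" for j
        proof -
          have "G len j = (\<Sum>x\<in>{..<len} \<inter> {..j}. summand x j)"
            unfolding G_def by (rule sum.mono_neutral_right) (auto simp: summand_def)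
          also have "\<dots> = (\<Sum>x\<le>j. summand x j)"
            by (rule sum.mono_neutral_left) (auto simp: summand_def a_def)
          also have "\<dots> = shift_coeff d a j" by (simp add: shift_coeff_def summand_def)
          finally show ?thesis .
        qed
        with I show "same_but X s s' \<and> (\<forall>j\<le>d+1. s' ''g'' (int j) = shift_coeff d a j)" by simp
      next
        show "len \<le> N" using len(2) N by simp
        show "int len < 2 ^ L" by (rule small) (use len(2) in simp)
        show "aval lenx s' = int len" if "?I j s'" for j s' using len(1) that by blast
      qed
    qed
  qed
qed


section \<open>Counting walks from a single card\<close>

lemma abs_sum_less:
  fixes F :: "nat \<Rightarrow> int"
  assumes "\<And>i. i < l \<Longrightarrow> \<bar>F i\<bar> \<le> 2 ^ a" "l \<le> 2 ^ b" "a + b < L"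
  shows "\<bar>\<Sum>i<l. F i\<bar> < 2 ^ L"
proof -
  have "\<bar>\<Sum>i<l. F i\<bar> \<le> (\<Sum>i<l. \<bar>F i\<bar>)" by (rule sum_abs)
  also have "\<dots> \<le> (\<Sum>i<l. 2 ^ a)" by (rule sum_mono) (use assms(1) in simp)
  also have "\<dots> = int l * 2 ^ a" by simp
  also have "\<dots> \<le> 2 ^ b * 2 ^ a"
    by (rule mult_right_mono) (use assms(2) in \<open>metis of_nat_le_iff of_nat_numeral of_nat_power\<close>, simp)
  also have "\<dots> = 2 ^ (a + b)" by (simp add: power_add)
  also have "(2::int) ^ (a + b) < 2 ^ L" using assms(3) by (intro power_strict_increasing) auto
  finally show ?thesis .
qed

lemma abs_mult_le_power:
  fixes x y :: int
  assumes "\<bar>x\<bar> \<le> 2 ^ a" "\<bar>y\<bar> \<le> 2 ^ b"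
  shows "\<bar>x * y\<bar> \<le> 2 ^ (a + b)"
  unfolding abs_mult power_add by (rule mult_mono) (use assms in auto)

text \<open>
  A card occupies \<open>n + m + 2\<close> consecutive cells of the input: the length \<open>n\<close>, the coefficients of its characteristic
  polynomial in increasing order of degree, the length \<open>m\<close>, and the leading coefficients for its complement. The
  array \<open>pc\<close> receives the coefficients in decreasing order, padded by one zero.
\<close>

definition copy_card :: com where
  "copy_card =
     Loop ''t'' (Var ''n'')
       (Assign ''pc'' (Var ''t'')
         (Cell ''in'' (Var ''i'' [*] Var ''stride'' [+] Var ''n'' [+] Const 1 [-] Var ''t''))) ;;
     Assign ''pc'' (Var ''n'') (Const 0) ;;
     Loop ''t'' (Var ''m'')
       (Assign ''c'' (Var ''t'')
         (Cell ''in'' (Var ''i'' [*] Var ''stride'' [+] Var ''n'' [+] Const 3 [+] Var ''t''))) ;;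
     Assign ''d'' (Const 0) (Var ''n'' [-] Const 1)"

text \<open>
  Extracts the square root: the array \<open>sq\<close> holds the coefficients of \<open>w\<^sub>i\<^sup>2\<close> obtained from
  \<open>f w\<^sub>i\<^sup>2 = W f\<^sub>i - (g\<^sub>i - f\<^sub>i) / z\<close>, and \<open>w\<close> those of \<open>w\<^sub>i\<close>.
\<close>

definition expand_walks :: com where
  "expand_walks =
     Assign ''sq'' (Const 0) (Const 1) ;;
     Assign ''w'' (Const 0) (Const 1) ;;
     Loop ''k'' (Var ''J'') (
       Sum ''acc'' ''l'' (Var ''k'' [+] Const 2)
         (Cell ''W'' (Var ''l'') [*] Cell ''pc'' (Var ''k'' [+] Const 1 [-] Var ''l'')) ;;
       Sum ''acc2'' ''l'' (Var ''k'' [+] Const 1)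
         (Cell ''sq'' (Var ''l'') [*] Cell ''P'' (Var ''k'' [+] Const 1 [-] Var ''l'')) ;;
       Assign ''sq'' (Var ''k'' [+] Const 1)
         (Var ''acc'' [-] Var ''acc2'' [-]
           (Cell ''g'' (Var ''k'' [+] Const 2) [-] Cell ''pc'' (Var ''k'' [+] Const 2))) ;;
       Sum ''acc'' ''l'' (Var ''k'')
         (Cell ''w'' (Var ''l'' [+] Const 1) [*] Cell ''w'' (Var ''k'' [-] Var ''l'')) ;;
       Assign ''w'' (Var ''k'' [+] Const 1)
         ((Cell ''sq'' (Var ''k'' [+] Const 1) [-] Var ''acc'') [div] Const 2))"

definition card_walks :: com where
  "card_walks = copy_card ;; shift_prog (Var ''m'') ;; expand_walks"

text \<open>
  The numerical facts on which the program relies, without reference to graphs. The sequences \<open>p\<close> and \<open>pc i\<close> are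
  reversed characteristic polynomials of the graph and the cards, \<open>c i\<close> the truncated lists padded by zeros, \<open>w i\<close> and
  \<open>W\<close> the local and global walk counts, and \<open>2 ^ E\<close> bounds the entries in use.
\<close>

locale deck_data =
  fixes n trunc h E :: nat and inp :: "int \<Rightarrow> int"
    and p :: "nat \<Rightarrow> int" and pc :: "nat \<Rightarrow> nat \<Rightarrow> int" and c :: "nat \<Rightarrow> nat \<Rightarrow> int"
    and W :: "nat \<Rightarrow> int" and w :: "nat \<Rightarrow> nat \<Rightarrow> int"
  assumes n3: "n \<ge> 3" and trunc: "trunc \<le> n" and h: "h = (n + 1) div 2"
    and inp_n: "inp 0 = int n" and inp_m: "inp (int n + 2) = int trunc"
    and inp_p: "\<And>i j. i < n \<Longrightarrow> j < n \<Longrightarrow> inp (int i * int (n + trunc + 2) + int n + 1 - int j) = pc i j"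
    and inp_c: "\<And>i l. i < n \<Longrightarrow> l < trunc \<Longrightarrow> inp (int i * int (n + trunc + 2) + int n + 3 + int l) = c i l"
    and c_beyond: "\<And>i l. l \<ge> trunc \<Longrightarrow> c i l = 0"
    and p_0: "p 0 = 1"
    and pc_sum: "\<And>j. j < n \<Longrightarrow> int (n - j) * p j = (\<Sum>i<n. pc i j)"
    and pc_n: "\<And>i. i < n \<Longrightarrow> pc i n = 0"
    and W_0: "W 0 = int n" and W_1: "W 1 = - 2 * p 2"
    and W_add: "\<And>l m. W (l + m) = (\<Sum>i<n. w i l * w i m)"
    and w_0: "\<And>i. w i 0 = 1"
    and vertex_identity: "\<And>i j. i < n \<Longrightarrow> 1 \<le> j \<Longrightarrow> j \<le> h \<Longrightarrow>
      (\<Sum>l\<le>j. (\<Sum>a\<le>l. w i a * w i (l - a)) * p (j - l))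
      = (\<Sum>l\<le>j. W l * pc i (j - l)) - (shift_coeff (n - 1) (c i) (Suc j) - pc i (Suc j))"
    and cayley_hamilton: "(\<Sum>l\<le>n. p l * W (n - l)) = 0"
    and p_bound: "\<And>j. \<bar>p j\<bar> \<le> 2 ^ E"
    and pc_bound: "\<And>i j. i < n \<Longrightarrow> \<bar>pc i j\<bar> \<le> 2 ^ E"
    and c_bound: "\<And>i l. i < n \<Longrightarrow> \<bar>c i l\<bar> \<le> 2 ^ E"
    and W_bound: "\<And>j. j \<le> n + 1 \<Longrightarrow> \<bar>W j\<bar> \<le> 2 ^ E"
    and w_bound: "\<And>i j. i < n \<Longrightarrow> j \<le> n \<Longrightarrow> \<bar>w i j\<bar> \<le> 2 ^ E"
    and E4: "n + 4 \<le> E"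
begin

text \<open>
  Every stored number is a sum of at most \<open>2 ^ E\<close> products whose factors contribute at most \<open>5 * E\<close> bits in total;
  the extreme case is the final substitution, whose input has up to \<open>4 * E\<close> bits.
\<close>

abbreviation "L \<equiv> 8 * E"
abbreviation "N \<equiv> n + 2"

definition env :: "state \<Rightarrow> bool" where
  "env s \<longleftrightarrow> s ''in'' = inp \<and> s ''n'' 0 = int n \<and> s ''m'' 0 = int trunc
     \<and> s ''stride'' 0 = int (n + trunc + 2) \<and> s ''half'' 0 = int h"

lemma envD:
  assumes "env s"
  shows "s ''in'' = inp" "s ''n'' 0 = int n" "s ''m'' 0 = int trunc"
    "s ''stride'' 0 = int (n + trunc + 2)" "s ''half'' 0 = int h"
  using assms by (simp_all add: env_def)

lemma env_same_but:
  assumes "env s" "same_but X s s'" "X \<inter> {''in'',''n'',''m'',''stride'',''half''} = {}"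
  shows "env s'"
  using assms unfolding env_def same_but_def by auto

lemma le_2_E: "x \<le> n + 4 \<Longrightarrow> x \<le> 2 ^ E"
  using E4 less_exp[of E] by linarith

lemma small: "x \<le> n + 4 \<Longrightarrow> int x < 2 ^ L"
proof -
  assume "x \<le> n + 4"
  then have "int x \<le> 2 ^ E" using le_2_E by (metis of_nat_le_iff of_nat_numeral of_nat_power)
  also have "(2::int) ^ E < 2 ^ L" using E4 by (intro power_strict_increasing) auto
  finally show ?thesis .
qed

lemma less_L: "\<bar>x\<bar> \<le> 2 ^ K \<Longrightarrow> K \<le> 7 * E \<Longrightarrow> \<bar>x\<bar> < 2 ^ L" for x :: int
proof -
  assume "\<bar>x\<bar> \<le> 2 ^ K" "K \<le> 7 * E"
  moreover from this(2) have "(2::int) ^ K < 2 ^ L" using E4 by (intro power_strict_increasing) auto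
  ultimately show ?thesis by linarith
qed

lemma h_bounds: "2 \<le> h" "h \<le> n - 1" "n \<le> 2 * h" "2 * h \<le> n + 1"
  using n3 by (auto simp: h)

lemma run_copy_card:
  assumes env: "env s" and i: "s ''i'' 0 = int i" "i < n"
  shows "run N L copy_card s (\<lambda>s'. same_but {''pc'',''c'',''d'',''t''} s s' \<and>
    (\<forall>j\<le>n. s' ''pc'' (int j) = pc i j) \<and> (\<forall>l<trunc. s' ''c'' (int l) = c i l) \<and> s' ''d'' 0 = int (n - 1))"
  unfolding copy_card_def
proof (rule run_Seq)
  let ?X = "{''pc'',''c'',''d'',''t''}"
  let ?I = "\<lambda>t s'. same_but ?X s s' \<and> (\<forall>j<t. s' ''pc'' (int j) = pc i j)"
  note e = envD[OF env]
  show "run N L (Loop ''t'' (Var ''n'') (Assign ''pc'' (Var ''t'')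
         (Cell ''in'' (Var ''i'' [*] Var ''stride'' [+] Var ''n'' [+] Const 1 [-] Var ''t'')))) s (?I n)"
  proof (rule run_Loop_invariant[where I = ?I and m = n])
    fix t s' assume t: "t < n" and I: "?I t s'" and v: "s' ''t'' 0 = int t"
    have val: "aval (Cell ''in'' (Var ''i'' [*] Var ''stride'' [+] Var ''n'' [+] Const 1 [-] Var ''t'')) s' = pc i t"
      using I v e i t inp_p[of i t] by (simp add: same_but_def)
    show "run N L (Assign ''pc'' (Var ''t'')
         (Cell ''in'' (Var ''i'' [*] Var ''stride'' [+] Var ''n'' [+] Const 1 [-] Var ''t''))) s'
         (\<lambda>s''. s'' ''t'' 0 = int t \<and> ?I (Suc t) (set_var ''t'' (int (Suc t)) s''))"
    proof (rule run_Assign, unfold val)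
      show "\<bar>pc i t\<bar> < 2 ^ L" using pc_bound[of i t] i by (intro less_L) auto
      show "(s'(''pc'' := (s' ''pc'')(aval (Var ''t'') s' := pc i t))) ''t'' 0 = int t \<and>
        ?I (Suc t) (set_var ''t'' (int (Suc t)) (s'(''pc'' := (s' ''pc'')(aval (Var ''t'') s' := pc i t))))"
        using I v by (simp add: same_but_def less_Suc_eq)
    qed
  next
    show "n \<le> N" "int n < 2 ^ L" using small[of n] by simp_all
  qed (use e in \<open>auto simp: same_but_def\<close>)
  fix s1 assume s1: "?I n s1"
  show "run N L (Assign ''pc'' (Var ''n'') (Const 0) ;;
     Loop ''t'' (Var ''m'')
       (Assign ''c'' (Var ''t'')
         (Cell ''in'' (Var ''i'' [*] Var ''stride'' [+] Var ''n'' [+] Const 3 [+] Var ''t''))) ;;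
     Assign ''d'' (Const 0) (Var ''n'' [-] Const 1)) s1 (\<lambda>s'. same_but ?X s s' \<and>
    (\<forall>j\<le>n. s' ''pc'' (int j) = pc i j) \<and> (\<forall>l<trunc. s' ''c'' (int l) = c i l) \<and> s' ''d'' 0 = int (n - 1))"
  proof (rule run_Assign_Seq)
    let ?s2 = "s1(''pc'' := (s1 ''pc'')(aval (Var ''n'') s1 := aval (Const 0) s1))"
    have "s1 ''n'' 0 = int n" using s1 e by (simp add: same_but_def)
    then have s2: "same_but ?X s ?s2 \<and> (\<forall>j\<le>n. ?s2 ''pc'' (int j) = pc i j)"
      using s1 pc_n[of i] i(2) by (simp add: same_but_def le_less)
    let ?J = "\<lambda>t s'. same_but ?X s s' \<and> (\<forall>j\<le>n. s' ''pc'' (int j) = pc i j) \<and> (\<forall>l<t. s' ''c'' (int l) = c i l)"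
    show "run N L (Loop ''t'' (Var ''m'')
       (Assign ''c'' (Var ''t'')
         (Cell ''in'' (Var ''i'' [*] Var ''stride'' [+] Var ''n'' [+] Const 3 [+] Var ''t''))) ;;
       Assign ''d'' (Const 0) (Var ''n'' [-] Const 1)) ?s2 (\<lambda>s'. same_but ?X s s' \<and>
      (\<forall>j\<le>n. s' ''pc'' (int j) = pc i j) \<and> (\<forall>l<trunc. s' ''c'' (int l) = c i l) \<and> s' ''d'' 0 = int (n - 1))"
    proof (rule run_Seq)
      show "run N L (Loop ''t'' (Var ''m'')
       (Assign ''c'' (Var ''t'')
         (Cell ''in'' (Var ''i'' [*] Var ''stride'' [+] Var ''n'' [+] Const 3 [+] Var ''t'')))) ?s2 (?J trunc)"
      proof (rule run_Loop_invariant[where I = ?J and m = trunc])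
        fix t s' assume t: "t < trunc" and I: "?J t s'" and v: "s' ''t'' 0 = int t"
        have val: "aval (Cell ''in'' (Var ''i'' [*] Var ''stride'' [+] Var ''n'' [+] Const 3 [+] Var ''t'')) s' = c i t"
          using I v e i t inp_c[of i t] by (simp add: same_but_def)
        show "run N L (Assign ''c'' (Var ''t'')
             (Cell ''in'' (Var ''i'' [*] Var ''stride'' [+] Var ''n'' [+] Const 3 [+] Var ''t''))) s'
             (\<lambda>s''. s'' ''t'' 0 = int t \<and> ?J (Suc t) (set_var ''t'' (int (Suc t)) s''))"
        proof (rule run_Assign, unfold val)
          show "\<bar>c i t\<bar> < 2 ^ L" using c_bound[of i t] i by (intro less_L) auto
          show "(s'(''c'' := (s' ''c'')(aval (Var ''t'') s' := c i t))) ''t'' 0 = int t \<and>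
            ?J (Suc t) (set_var ''t'' (int (Suc t)) (s'(''c'' := (s' ''c'')(aval (Var ''t'') s' := c i t))))"
            using I v by (simp add: same_but_def less_Suc_eq)
        qed
      next
        show "trunc \<le> N" "int trunc < 2 ^ L" using small[of trunc] trunc by simp_all
      next
        have "set_var ''t'' 0 ?s2 ''pc'' = ?s2 ''pc''" by (rule fun_upd_other) simp
        moreover have "same_but ?X s (set_var ''t'' 0 ?s2)" using s2 by (simp add: same_but_def)
        ultimately show "?J 0 (set_var ''t'' 0 ?s2)" using s2 by (simp del: fun_upd_apply)
      next
        fix t s' assume "?J t s'"
        then show "aval (Var ''m'') s' = int trunc" using e by (simp add: same_but_def)
      qed
    next
      fix s3 assume "?J trunc s3"
      then show "run N L (Assign ''d'' (Const 0) (Var ''n'' [-] Const 1)) s3 (\<lambda>s'. same_but ?X s s' \<and>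
        (\<forall>j\<le>n. s' ''pc'' (int j) = pc i j) \<and> (\<forall>l<trunc. s' ''c'' (int l) = c i l) \<and> s' ''d'' 0 = int (n - 1))"
        using e n3 small[of "n - 1"] by (intro run_Assign) (simp_all add: same_but_def of_nat_diff)
    qed
  qed simp
qed

definition sq :: "nat \<Rightarrow> nat \<Rightarrow> int" where
  "sq i l = (\<Sum>a\<le>l. w i a * w i (l - a))"

abbreviation gc :: "nat \<Rightarrow> nat \<Rightarrow> int" where
  "gc i \<equiv> shift_coeff (n - 1) (c i)"

lemma sq_bound: "\<bar>sq i l\<bar> \<le> 2 ^ (3 * E)" if "i < n" "l \<le> n"
proof -
  have "\<bar>sq i l\<bar> \<le> (\<Sum>a\<le>l. \<bar>w i a * w i (l - a)\<bar>)" unfolding sq_def by (rule sum_abs)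
  also have "\<dots> \<le> (\<Sum>a\<le>l. 2 ^ (E + E))"
    by (rule sum_mono, rule abs_mult_le_power) (use that w_bound in auto)
  also have "\<dots> = int (Suc l) * 2 ^ (E + E)" by simp
  also have "\<dots> \<le> 2 ^ E * 2 ^ (E + E)"
  proof (rule mult_right_mono)
    show "int (Suc l) \<le> 2 ^ E" using le_2_E[of "Suc l"] that
      by (metis add_leD1 add_Suc_right le_SucI not_less_eq_eq numeral_eq_Suc of_nat_le_iff of_nat_numeral of_nat_power trans_le_add1)
  qed simp
  also have "\<dots> = 2 ^ (3 * E)" by (simp add: power_add[symmetric])
  finally show ?thesis .
qed

text \<open>
  The vertex identity solved for its term of highest order, where \<open>p 0 = 1\<close>.
\<close>

lemma sq_step:
  assumes "i < n" "k < h"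
  shows "sq i (Suc k) = (\<Sum>l<k+2. W l * pc i (k + 1 - l)) - (\<Sum>l<k+1. sq i l * p (k + 1 - l))
     - (gc i (k + 2) - pc i (k + 2))"
proof -
  have "(\<Sum>l\<le>Suc k. sq i l * p (Suc k - l)) = (\<Sum>l\<le>Suc k. W l * pc i (Suc k - l)) - (gc i (Suc (Suc k)) - pc i (Suc (Suc k)))"
    using vertex_identity[of i "Suc k"] assms by (simp add: sq_def)
  moreover have "(\<Sum>l\<le>Suc k. sq i l * p (Suc k - l)) = (\<Sum>l<Suc k. sq i l * p (Suc k - l)) + sq i (Suc k)"
    by (simp add: lessThan_Suc_atMost p_0)
  moreover have "(\<Sum>l\<le>Suc k. W l * pc i (Suc k - l)) = (\<Sum>l<Suc (Suc k). W l * pc i (Suc k - l))"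
    by (simp only: lessThan_Suc_atMost)
  ultimately show ?thesis by (simp add: numeral_2_eq_2 del: sum.lessThan_Suc)
qed

text \<open>
  The two extreme terms of the convolution \<open>sq i (Suc k)\<close> both equal \<open>w i (Suc k)\<close>.
\<close>

lemma w_step: "w i (Suc k) = (sq i (Suc k) - (\<Sum>l<k. w i (l + 1) * w i (k - l))) div 2"
proof -
  have "sq i (Suc k) = (\<Sum>a<Suc k. w i a * w i (Suc k - a)) + w i (Suc k)"
    by (simp add: sq_def lessThan_Suc_atMost w_0)
  also have "(\<Sum>a<Suc k. w i a * w i (Suc k - a)) = w i (Suc k) + (\<Sum>l<k. w i (l + 1) * w i (k - l))"
    unfolding sum.lessThan_Suc_shift by (simp add: w_0)
  finally show ?thesis by simp
qed


lemma run_expand_walks: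
  assumes J: "s ''J'' 0 = int J" "J \<le> h" and i: "i < n"
    and sW: "\<forall>x\<le>J. s ''W'' (int x) = W x" and spc: "\<forall>j\<le>n. s ''pc'' (int j) = pc i j"
    and sP: "\<forall>j<n. s ''P'' (int j) = p j" and sg: "\<forall>j\<le>n. s ''g'' (int j) = gc i j"
  shows "run N L expand_walks s (\<lambda>s'. same_but {''sq'',''w'',''k'',''l'',''acc'',''acc2''} s s' \<and>
    (\<forall>x\<le>J. s' ''w'' (int x) = w i x))"
  unfolding expand_walks_def
proof (rule run_Assign_Seq, goal_cases)
  case 1
  show ?case using small[of 1] by simp
next
  case 2
  let ?X = "{''sq'',''w'',''k'',''l'',''acc'',''acc2''}"
  let ?I = "\<lambda>k s'. same_but ?X s s' \<and> (\<forall>x\<le>k. s' ''w'' (int x) = w i x) \<and> (\<forall>x\<le>k. s' ''sq'' (int x) = sq i x)"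
  show ?case
  proof (rule run_Assign_Seq, goal_cases)
    case 1
    show ?case using small[of 1] by simp
  next
    case 2
    show ?case
    proof (rule run_Loop[where I = ?I and m = J], goal_cases)
      case 1 show ?case using J(2) h_bounds by simp
    next
      case 2 show ?case using J(2) h_bounds by (intro small) simp
    next
      case 3
      show ?case by (simp add: same_but_def w_0 sq_def)
    next
      case (4 k s0)
      then have k: "k < J" and X0: "same_but ?X s s0" and w0: "\<forall>x\<le>k. s0 ''w'' (int x) = w i x"
        and q0: "\<forall>x\<le>k. s0 ''sq'' (int x) = sq i x" and v0: "s0 ''k'' 0 = int k" by blast+
      have kn: "k + 1 < n" "k < h" using k J(2) h_bounds by linarith+
      have W0: "s0 ''W'' (int x) = W x" if "x \<le> J" for x using X0 sW that by (simp add: same_but_def)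
      have pc0: "s0 ''pc'' (int x) = pc i x" if "x \<le> n" for x using X0 spc that by (simp add: same_but_def)
      have P0: "s0 ''P'' (int x) = p x" if "x < n" for x using X0 sP that by (simp add: same_but_def)
      have g0: "s0 ''g'' (int x) = gc i x" if "x \<le> n" for x using X0 sg that by (simp add: same_but_def)
      have le: "x \<le> 2 ^ E" if "x \<le> k + 2" for x by (rule le_2_E) (use that kn in simp)
      have "run N L (Sum ''acc'' ''l'' (Var ''k'' [+] Const 2)
         (Cell ''W'' (Var ''l'') [*] Cell ''pc'' (Var ''k'' [+] Const 1 [-] Var ''l''))) s0
         (\<lambda>s'. same_but {''acc'',''l''} s0 s' \<and> s' ''acc'' 0 = (\<Sum>l<k+2. W l * pc i (k + 1 - l)))"
      proof (rule run_Sum, goal_cases)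
        case 1 show ?case by simp
      next
        case 2 show ?case using kn by simp
      next
        case 3 show ?case by (rule small) (use kn in simp)
      next
        case (4 s') then show ?case using v0 by (simp add: same_but_def)
      next
        case (5 l s')
        then have "s' ''W'' (int l) = W l" using W0[of l] k by (simp add: same_but_def)
        moreover have "s' ''pc'' (int k + 1 - int l) = pc i (k + 1 - l)"
          using pc0[of "k + 1 - l"] 5 kn by (simp add: same_but_def of_nat_diff add.commute)
        ultimately show ?case using 5 v0 by (simp add: same_but_def)
      next
        case (6 l)
        show ?case
        proof (rule abs_sum_less[where a = "E + E" and b = E])
          fix x assume "x < l"
          then show "\<bar>W x * pc i (k + 1 - x)\<bar> \<le> 2 ^ (E + E)"
            using 6 kn by (intro abs_mult_le_power W_bound pc_bound i) simp
        qed (use 6 le E4 in auto)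
      qed
      then show ?case
      proof (rule run_Seq, goal_cases)
        case (1 s1)
        then have X1: "same_but {''acc'',''l''} s0 s1" and a1: "s1 ''acc'' 0 = (\<Sum>l<k+2. W l * pc i (k + 1 - l))" by blast+
        have "run N L (Sum ''acc2'' ''l'' (Var ''k'' [+] Const 1)
           (Cell ''sq'' (Var ''l'') [*] Cell ''P'' (Var ''k'' [+] Const 1 [-] Var ''l''))) s1
           (\<lambda>s'. same_but {''acc2'',''l''} s1 s' \<and> s' ''acc2'' 0 = (\<Sum>l<k+1. sq i l * p (k + 1 - l)))"
        proof (rule run_Sum, goal_cases)
          case 1 show ?case by simp
        next
          case 2 show ?case using kn by simp
        next
          case 3 show ?case by (rule small) (use kn in simp)
        next
          case (4 s') then show ?case using v0 X1 by (simp add: same_but_def)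
        next
          case (5 l s')
          then have "s' ''sq'' (int l) = sq i l" using q0 X1 by (simp add: same_but_def)
          moreover have "s' ''P'' (int k + 1 - int l) = p (k + 1 - l)"
            using P0[of "k + 1 - l"] 5 kn X1 by (simp add: same_but_def of_nat_diff add.commute)
          ultimately show ?case using 5 v0 X1 by (simp add: same_but_def)
        next
          case (6 l)
          show ?case
          proof (rule abs_sum_less[where a = "3 * E + E" and b = E])
            fix x assume "x < l"
            then show "\<bar>sq i x * p (k + 1 - x)\<bar> \<le> 2 ^ (3 * E + E)"
              using 6 kn by (intro abs_mult_le_power sq_bound p_bound i) simp
          qed (use 6 le E4 in auto)
        qed
        then show ?case
        proof (rule run_Seq, goal_cases)
          case (1 s2)
          then have X2: "same_but {''acc2'',''l''} s1 s2" and a2: "s2 ''acc2'' 0 = (\<Sum>l<k+1. sq i l * p (k + 1 - l))" by blast+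
          have idx: "s2 ''k'' 0 = int k" using X1 X2 v0 by (simp add: same_but_def)
          have "s2 ''g'' (int k + 2) = gc i (k + 2)" "s2 ''pc'' (int k + 2) = pc i (k + 2)"
            using g0[of "k + 2"] pc0[of "k + 2"] X1 X2 kn by (simp_all add: same_but_def add.commute)
          then have val: "aval (Var ''acc'' [-] Var ''acc2'' [-]
             (Cell ''g'' (Var ''k'' [+] Const 2) [-] Cell ''pc'' (Var ''k'' [+] Const 2))) s2 = sq i (Suc k)"
            using sq_step[OF i kn(2)] a1 a2 idx X2 by (simp add: same_but_def)
          show ?case
          proof (rule run_Assign_Seq, unfold val, goal_cases)
            case 1
            show ?case by (rule less_L[OF sq_bound[OF i]]) (use kn in simp_all)
          next
            case 2
            define s3 where "s3 = s2(''sq'' := (s2 ''sq'')(aval (Var ''k'' [+] Const 1) s2 := sq i (Suc k)))"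
            have X3: "same_but {''sq''} s2 s3" and v3: "s3 ''k'' 0 = int k"
              using idx by (simp_all add: s3_def same_but_def)
            have q3: "\<forall>x\<le>Suc k. s3 ''sq'' (int x) = sq i x"
              using q0 X1 X2 idx by (auto simp: s3_def same_but_def le_Suc_eq)
            have w3: "\<forall>x\<le>k. s3 ''w'' (int x) = w i x"
              using w0 X1 X2 X3 by (simp add: same_but_def)
            have "run N L (Sum ''acc'' ''l'' (Var ''k'')
               (Cell ''w'' (Var ''l'' [+] Const 1) [*] Cell ''w'' (Var ''k'' [-] Var ''l''))) s3
               (\<lambda>s'. same_but {''acc'',''l''} s3 s' \<and> s' ''acc'' 0 = (\<Sum>l<k. w i (l + 1) * w i (k - l)))"
            proof (rule run_Sum, goal_cases)
              case 1 show ?case by simp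
            next
              case 2 show ?case using kn by simp
            next
              case 3 show ?case by (rule small) (use kn in simp)
            next
              case (4 s') then show ?case using v3 by (simp add: same_but_def)
            next
              case (5 l s')
              then have "s' ''w'' (int l + 1) = w i (l + 1)"
                using w3[rule_format, of "l + 1"] by (simp add: same_but_def add.commute)
              moreover have "s' ''w'' (int k - int l) = w i (k - l)"
                using w3[rule_format, of "k - l"] 5 by (simp add: same_but_def of_nat_diff)
              ultimately show ?case using 5 v3 by (simp add: same_but_def)
            next
              case (6 l)
              show ?case
              proof (rule abs_sum_less[where a = "E + E" and b = E])
                fix x assume "x < l"
                then show "\<bar>w i (x + 1) * w i (k - x)\<bar> \<le> 2 ^ (E + E)"
                  using 6 kn by (intro abs_mult_le_power w_bound i) simp_all
              qed (use 6 le E4 in auto)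
            qed
            then show ?case
              unfolding s3_def[symmetric]
            proof (rule run_Seq, goal_cases)
              case (1 s4)
              then have X4: "same_but {''acc'',''l''} s3 s4" and a4: "s4 ''acc'' 0 = (\<Sum>l<k. w i (l + 1) * w i (k - l))" by blast+
              have v4: "s4 ''k'' 0 = int k" using X4 v3 by (simp add: same_but_def)
              have "s4 ''sq'' (int k + 1) = sq i (Suc k)"
                using q3[rule_format, of "Suc k"] X4 by (simp add: same_but_def add.commute)
              then have val: "aval ((Cell ''sq'' (Var ''k'' [+] Const 1) [-] Var ''acc'') [div] Const 2) s4 = w i (Suc k)"
                using w_step[of i k] a4 v4 by simp
              have X: "same_but ?X s s4"
                using X0 X1 X2 X3 X4 by (simp add: same_but_def)
              show ?case
              proof (rule run_Assign, unfold val, goal_cases)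
                case 1
                show ?case by (rule less_L[OF w_bound[OF i]]) (use kn in simp_all)
              next
                case 2
                have "\<forall>x\<le>Suc k. ((s4 ''w'')(int k + 1 := w i (Suc k))) (int x) = w i x"
                  using w3 X4 by (auto simp: same_but_def le_Suc_eq)
                moreover have "\<forall>x\<le>Suc k. s4 ''sq'' (int x) = sq i x"
                  using q3 X4 by (simp add: same_but_def)
                ultimately show ?case using v4 X
                  by (simp add: same_but_def del: fun_upd_apply add: fun_upd_same fun_upd_other)
              qed
            qed
          qed
        qed
      qed
    next
      case (5 k s')
      then show ?case using J by (simp add: same_but_def)
    next
      case (6 s')
      then show ?case by simp
    qed
  qed
qed

lemma run_card_walks:
  assumes env: "env s" and J: "s ''J'' 0 = int J" "J \<le> h" and i: "s ''i'' 0 = int i" "i < n"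
    and sW: "\<forall>x\<le>J. s ''W'' (int x) = W x" and sP: "\<forall>j<n. s ''P'' (int j) = p j"
  shows "run N L card_walks s (\<lambda>s'.
    same_but {''pc'',''c'',''d'',''t'',''g'',''sign'',''b'',''l'',''sq'',''w'',''k'',''acc'',''acc2''} s s' \<and>
    (\<forall>x\<le>J. s' ''w'' (int x) = w i x))"
  unfolding card_walks_def
proof (rule run_Seq[OF run_copy_card[OF env i]])
  fix s1 assume s1: "same_but {''pc'',''c'',''d'',''t''} s s1 \<and> (\<forall>j\<le>n. s1 ''pc'' (int j) = pc i j)
    \<and> (\<forall>l<trunc. s1 ''c'' (int l) = c i l) \<and> s1 ''d'' 0 = int (n - 1)"
  have env1: "env s1" by (rule env_same_but[OF env]) (use s1 in auto)
  have ci: "(\<lambda>l. if l < trunc then s1 ''c'' (int l) else 0) = c i"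
    using s1 c_beyond by auto
  have "run N L (shift_prog (Var ''m'')) s1 (\<lambda>s'. same_but {''g'',''sign'',''b'',''l'',''t''} s1 s' \<and>
           (\<forall>j\<le>n-1+1. s' ''g'' (int j) = shift_coeff (n - 1) (\<lambda>l. if l < trunc then s1 ''c'' (int l) else 0) j))"
  proof (rule run_shift_prog[where K = E and E = E])
    show "s1 ''d'' 0 = int (n - 1)" using s1 by blast
    show "aval (Var ''m'') s' = int trunc" if "same_but {''g'',''sign'',''b'',''l'',''t''} s1 s'" for s'
      using that envD[OF env1] by (simp add: same_but_def)
    show "trunc \<le> n - 1 + 1" using trunc n3 by simp
    show "\<bar>s1 ''c'' (int l)\<bar> \<le> 2 ^ E" if "l < trunc" for l using s1 that c_bound[OF i(2)] by simp
    show "n - 1 + 2 \<le> 2 ^ E" by (rule le_2_E) simp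
  qed (use E4 n3 in auto)
  then show "run N L (shift_prog (Var ''m'') ;; expand_walks) s1 (\<lambda>s'.
    same_but {''pc'',''c'',''d'',''t'',''g'',''sign'',''b'',''l'',''sq'',''w'',''k'',''acc'',''acc2''} s s' \<and>
    (\<forall>x\<le>J. s' ''w'' (int x) = w i x))"
    unfolding ci
  proof (rule run_Seq, goal_cases)
    case (1 s2)
    then have X2: "same_but {''g'',''sign'',''b'',''l'',''t''} s1 s2" and g2: "\<forall>j\<le>n. s2 ''g'' (int j) = gc i j"
      using n3 by simp_all
    have "run N L expand_walks s2 (\<lambda>s'. same_but {''sq'',''w'',''k'',''l'',''acc'',''acc2''} s2 s' \<and>
      (\<forall>x\<le>J. s' ''w'' (int x) = w i x))"
    proof (rule run_expand_walks[where i = i])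
      show "s2 ''J'' 0 = int J" using J s1 X2 by (simp add: same_but_def)
      show "\<forall>x\<le>J. s2 ''W'' (int x) = W x" using sW s1 X2 by (simp add: same_but_def)
      show "\<forall>j\<le>n. s2 ''pc'' (int j) = pc i j" using s1 X2 by (simp add: same_but_def)
      show "\<forall>j<n. s2 ''P'' (int j) = p j" using sP s1 X2 by (simp add: same_but_def)
    qed (fact J(2) i(2) g2)+
    then show ?case
      by (rule run_conseq) (use s1 X2 in \<open>simp add: same_but_def\<close>)
  qed
qed

end


section \<open>From local to global walk counts\<close>

text \<open>
  From global walk counts up to length \<open>J\<close> to those up to length \<open>2 J\<close>: each card yields its local counts up to \<open>J\<close>, and
  walks of length \<open>J + t\<close> are cut after \<open>J\<close> steps.
\<close>

definition extend_totals :: com where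
  "extend_totals =
     Loop ''t'' (Var ''J'') (Assign ''W'' (Var ''J'' [+] Const 1 [+] Var ''t'') (Const 0)) ;;
     Loop ''i'' (Var ''n'') (
       card_walks ;;
       Loop ''t'' (Var ''J'')
         (Assign ''W'' (Var ''J'' [+] Const 1 [+] Var ''t'')
           (Cell ''W'' (Var ''J'' [+] Const 1 [+] Var ''t'') [+]
             Cell ''w'' (Var ''J'') [*] Cell ''w'' (Var ''t'' [+] Const 1))))"

definition char_coeffs :: com where
  "char_coeffs =
     Loop ''j'' (Var ''n'') (
       Sum ''acc'' ''i'' (Var ''n'')
         (Cell ''in'' (Var ''i'' [*] Var ''stride'' [+] Var ''n'' [+] Const 1 [-] Var ''j'')) ;;
       Assign ''P'' (Var ''j'') (Var ''acc'' [div] (Var ''n'' [-] Var ''j'')))"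

definition walk_totals :: com where
  "walk_totals =
     Assign ''W'' (Const 0) (Var ''n'') ;;
     Assign ''W'' (Const 1) (Const 0 [-] Const 2 [*] Cell ''P'' (Const 2)) ;;
     Loop ''r'' (Var ''half'') (
       Assign ''J'' (Const 0) (Var ''r'' [+] Const 1) ;;
       extend_totals)"

context deck_data begin

abbreviation "scratch \<equiv> {''W'',''i'',''pc'',''c'',''d'',''t'',''g'',''sign'',''b'',''l'',''sq'',''w'',''k'',''acc'',''acc2''}"

lemma run_extend_totals:
  assumes env: "env s" and J: "s ''J'' 0 = int J" "1 \<le> J" "J \<le> h"
    and sW: "\<forall>x\<le>J. s ''W'' (int x) = W x" and sP: "\<forall>j<n. s ''P'' (int j) = p j"
  shows "run N L extend_totals s (\<lambda>s'. same_but scratch s s' \<and> (\<forall>x\<le>2*J. s' ''W'' (int x) = W x))"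
  unfolding extend_totals_def
proof (rule run_Seq)
  let ?I = "\<lambda>t s'. same_but scratch s s' \<and> (\<forall>x\<le>J. s' ''W'' (int x) = W x)
    \<and> (\<forall>x<t. s' ''W'' (int J + 1 + int x) = 0)"
  have Jn: "J < n" using J h_bounds n3 by linarith
  show "run N L (Loop ''t'' (Var ''J'') (Assign ''W'' (Var ''J'' [+] Const 1 [+] Var ''t'') (Const 0))) s (?I J)"
  proof (rule run_Loop_invariant[where I = ?I and m = J], goal_cases)
    case 1 show ?case using Jn by simp
  next
    case 2 show ?case by (rule small) (use Jn in simp)
  next
    case 3 show ?case using sW by (simp add: same_but_def)
  next
    case (4 t s')
    have v: "s' ''J'' 0 = int J" using 4 J by (simp add: same_but_def)
    have "\<forall>x\<le>J. ((s' ''W'')(int J + 1 + int t := 0)) (int x) = W x" using 4 by auto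
    moreover have "\<forall>x<Suc t. ((s' ''W'')(int J + 1 + int t := 0)) (int J + 1 + int x) = 0"
      using 4 by (simp add: less_Suc_eq)
    moreover have "same_but scratch s s'" using 4 by blast
    ultimately show ?case using 4(3) v
      by (intro run_Assign) (simp_all add: same_but_def del: fun_upd_apply add: fun_upd_same fun_upd_other)
  next
    case 5 then show ?case using J by (simp add: same_but_def)
  qed
  fix s1 assume s1: "?I J s1"
  let ?K = "\<lambda>i s'. same_but scratch s s' \<and> (\<forall>x\<le>J. s' ''W'' (int x) = W x)
    \<and> (\<forall>y<J. s' ''W'' (int J + 1 + int y) = (\<Sum>x<i. w x J * w x (y + 1)))"
  show "run N L (Loop ''i'' (Var ''n'') (
       card_walks ;;
       Loop ''t'' (Var ''J'')
         (Assign ''W'' (Var ''J'' [+] Const 1 [+] Var ''t'')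
           (Cell ''W'' (Var ''J'' [+] Const 1 [+] Var ''t'') [+]
             Cell ''w'' (Var ''J'') [*] Cell ''w'' (Var ''t'' [+] Const 1))))) s1
      (\<lambda>s'. same_but scratch s s' \<and> (\<forall>x\<le>2*J. s' ''W'' (int x) = W x))"
  proof (rule run_Loop[where I = ?K and m = n], goal_cases)
    case 1 show ?case by simp
  next
    case 2 show ?case by (rule small) simp
  next
    case 3 show ?case using s1 by (simp add: same_but_def)
  next
    case (4 i s2)
    then have i: "i < n" and vi: "s2 ''i'' 0 = int i" and X2: "same_but scratch s s2"
      and W2: "\<forall>x\<le>J. s2 ''W'' (int x) = W x"
      and T2: "\<forall>y<J. s2 ''W'' (int J + 1 + int y) = (\<Sum>x<i. w x J * w x (y + 1))" by blast+
    have env2: "env s2" by (rule env_same_but[OF env X2]) auto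
    have J2: "s2 ''J'' 0 = int J" using X2 J by (simp add: same_but_def)
    have P2: "\<forall>j<n. s2 ''P'' (int j) = p j" using X2 sP by (simp add: same_but_def)
    show ?case
    proof (rule run_Seq[OF run_card_walks[OF env2 J2 J(3) vi i W2 P2]], goal_cases)
      case (1 s3)
      then have X3: "same_but {''pc'',''c'',''d'',''t'',''g'',''sign'',''b'',''l'',''sq'',''w'',''k'',''acc'',''acc2''} s2 s3"
        and w3: "\<forall>x\<le>J. s3 ''w'' (int x) = w i x" by blast+
      let ?M = "\<lambda>t s'. same_but scratch s s' \<and> s' ''i'' 0 = int i \<and> (\<forall>x\<le>J. s' ''w'' (int x) = w i x)
        \<and> (\<forall>x\<le>J. s' ''W'' (int x) = W x)
        \<and> (\<forall>y<J. s' ''W'' (int J + 1 + int y) = (\<Sum>x<(if y < t then Suc i else i). w x J * w x (y + 1)))"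
      show ?case
      proof (rule run_Loop[where I = ?M and m = J], goal_cases)
        case 1 show ?case using Jn by simp
      next
        case 2 show ?case by (rule small) (use Jn in simp)
      next
        case 3
        have "same_but scratch s (set_var ''t'' 0 s3)" using X2 X3 by (simp add: same_but_def)
        then show ?case using vi W2 T2 w3 X3 by (simp add: same_but_def)
      next
        case (4 t s4)
        then have t: "t < J" and vt: "s4 ''t'' 0 = int t" and X4: "same_but scratch s s4"
          and vi4: "s4 ''i'' 0 = int i" and w4: "\<forall>x\<le>J. s4 ''w'' (int x) = w i x"
          and W4: "\<forall>x\<le>J. s4 ''W'' (int x) = W x"
          and T4: "\<forall>y<J. s4 ''W'' (int J + 1 + int y) = (\<Sum>x<(if y < t then Suc i else i). w x J * w x (y + 1))"
          by blast+
        have vJ: "s4 ''J'' 0 = int J" using X4 J by (simp add: same_but_def)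
        have "s4 ''w'' (int t + 1) = w i (t + 1)"
          using w4[rule_format, of "t + 1"] t by (simp add: add.commute)
        then have val: "aval (Cell ''W'' (Var ''J'' [+] Const 1 [+] Var ''t'') [+]
             Cell ''w'' (Var ''J'') [*] Cell ''w'' (Var ''t'' [+] Const 1)) s4
            = (\<Sum>x<Suc i. w x J * w x (t + 1))"
          using T4[rule_format, OF t] w4[rule_format, of J] vJ vt by simp
        show ?case
        proof (rule run_Assign, unfold val, goal_cases)
          case 1
          show ?case
          proof (rule abs_sum_less[where a = "E + E" and b = E])
            fix x assume "x < Suc i"
            then show "\<bar>w x J * w x (t + 1)\<bar> \<le> 2 ^ (E + E)"
              using i Jn t by (intro abs_mult_le_power w_bound) simp_all
          next
            show "Suc i \<le> 2 ^ E" by (rule le_2_E) (use i in simp)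
          qed (use E4 in simp)
        next
          case 2
          let ?W = "(s4 ''W'')(int J + 1 + int t := (\<Sum>x<Suc i. w x J * w x (t + 1)))"
          have "\<forall>x\<le>J. ?W (int x) = W x" using W4 by auto
          moreover have "\<forall>y<J. ?W (int J + 1 + int y) = (\<Sum>x<(if y < Suc t then Suc i else i). w x J * w x (y + 1))"
          proof (intro allI impI)
            fix y assume y: "y < J"
            show "?W (int J + 1 + int y) = (\<Sum>x<(if y < Suc t then Suc i else i). w x J * w x (y + 1))"
            proof (cases "y = t")
              case False
              then have "(y < Suc t) = (y < t)" by auto
              with False show ?thesis using T4[rule_format, OF y] by (simp del: sum.lessThan_Suc)
            qed simp
          qed
          ultimately show ?case using vJ vt vi4 w4 X4
            by (simp add: same_but_def del: fun_upd_apply sum.lessThan_Suc add: fun_upd_same fun_upd_other)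
        qed
      next
        case (5 t s')
        then show ?case using J by (simp add: same_but_def)
      next
        case (6 s')
        have "\<forall>y<J. s' ''W'' (int J + 1 + int y) = (\<Sum>x<Suc i. w x J * w x (y + 1))"
          using 6 by (simp del: sum.lessThan_Suc)
        then show ?case using 6 by (simp add: same_but_def del: sum.lessThan_Suc)
      qed
    qed
  next
    case (5 i s')
    then show ?case using envD[OF env] by (simp add: same_but_def)
  next
    case (6 s')
    have "s' ''W'' (int x) = W x" if "x \<le> 2 * J" for x
    proof (cases "x \<le> J")
      case False
      define y where "y = x - J - 1"
      have y: "y < J" "x = J + (y + 1)" using False that by (auto simp: y_def)
      have "s' ''W'' (int J + 1 + int y) = (\<Sum>x<n. w x J * w x (y + 1))" using 6 y by blast
      then show ?thesis unfolding y(2) W_add by (simp add: add_ac)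
    qed (use 6 in blast)
    then show ?case using 6 by blast
  qed
qed

lemma run_char_coeffs:
  assumes env: "env s"
  shows "run N L char_coeffs s (\<lambda>s'. same_but {''P'',''j'',''i'',''acc''} s s' \<and> (\<forall>j<n. s' ''P'' (int j) = p j))"
  unfolding char_coeffs_def
proof (rule run_Loop[where I = "\<lambda>j s'. same_but {''P'',''j'',''i'',''acc''} s s' \<and> (\<forall>x<j. s' ''P'' (int x) = p x)" and m = n], goal_cases)
  case 1 show ?case by simp
next
  case 2 show ?case by (rule small) simp
next
  case 3 show ?case by (simp add: same_but_def)
next
  case (4 j s1)
  then have j: "j < n" and X1: "same_but {''P'',''j'',''i'',''acc''} s s1"
    and P1: "\<forall>x<j. s1 ''P'' (int x) = p x" and v1: "s1 ''j'' 0 = int j" by blast+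
  have e: "env s1" by (rule env_same_but[OF env X1]) auto
  have "run N L (Sum ''acc'' ''i'' (Var ''n'')
         (Cell ''in'' (Var ''i'' [*] Var ''stride'' [+] Var ''n'' [+] Const 1 [-] Var ''j''))) s1
      (\<lambda>s'. same_but {''acc'',''i''} s1 s' \<and> s' ''acc'' 0 = (\<Sum>i<n. pc i j))"
  proof (rule run_Sum, goal_cases)
    case 1 show ?case by simp
  next
    case 2 show ?case by simp
  next
    case 3 show ?case by (rule small) simp
  next
    case (4 s') then show ?case using envD[OF e] by (simp add: same_but_def)
  next
    case (5 i s')
    then show ?case using envD[OF e] v1 inp_p[of i j] j by (simp add: same_but_def)
  next
    case (6 l)
    show ?case
      by (rule abs_sum_less[where a = E and b = E]) (use 6 pc_bound le_2_E[of l] E4 in auto)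
  qed
  then show ?case
  proof (rule run_Seq, goal_cases)
    case (1 s2)
    then have X2: "same_but {''acc'',''i''} s1 s2" and a2: "s2 ''acc'' 0 = (\<Sum>i<n. pc i j)" by blast+
    have v2: "s2 ''j'' 0 = int j" "s2 ''n'' 0 = int n" using X2 v1 envD[OF e] by (simp_all add: same_but_def)
    have val: "aval (Var ''acc'' [div] (Var ''n'' [-] Var ''j'')) s2 = p j"
      using a2 v2 pc_sum[OF j, symmetric] j by (simp add: of_nat_diff)
    show ?case
    proof (rule run_Assign, unfold val, goal_cases)
      case 1 show ?case by (rule less_L[OF p_bound]) simp
    next
      case 2
      have "\<forall>x<Suc j. ((s2 ''P'')(int j := p j)) (int x) = p x"
        using P1 X2 by (auto simp: same_but_def less_Suc_eq)
      moreover have "same_but {''P'',''j'',''i'',''acc''} s s2" using X1 X2 by (simp add: same_but_def)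
      ultimately show ?case using v2
        by (simp add: same_but_def del: fun_upd_apply add: fun_upd_same fun_upd_other)
    qed
  qed
next
  case (5 j s') then show ?case using envD[OF env] by (simp add: same_but_def)
next
  case (6 s') then show ?case by blast
qed

lemma run_walk_totals:
  assumes env: "env s" and sP: "\<forall>j<n. s ''P'' (int j) = p j"
  shows "run N L walk_totals s (\<lambda>s'. same_but (scratch \<union> {''J'',''r''}) s s' \<and> (\<forall>x\<le>n. s' ''W'' (int x) = W x))"
  unfolding walk_totals_def
proof (rule run_Assign_Seq, goal_cases)
  case 1 show ?case using envD[OF env] small[of n] by simp
next
  case 2
  show ?case
  proof (rule run_Assign_Seq, goal_cases)
    case 1
    have "aval (Const 0 [-] Const 2 [*] Cell ''P'' (Const 2)) (s(''W'' := (s ''W'')(aval (Const 0) s := aval (Var ''n'') s))) = W 1"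
      using sP[rule_format, of 2] n3 W_1 by simp
    moreover have "\<bar>W 1\<bar> < 2 ^ L" by (rule less_L[OF W_bound]) simp_all
    ultimately show ?case by (simp only:)
  next
    case 2
    let ?X = "scratch \<union> {''J'',''r''}"
    \<comment> \<open>Before round r = 0 the counts of length 0 and 1 are known; after r rounds, those up to length 2 r.\<close>
    let ?I = "\<lambda>r s'. same_but ?X s s' \<and> (\<forall>x\<le>max 1 (2 * r). s' ''W'' (int x) = W x)"
    show ?case
    proof (rule run_Loop[where I = ?I and m = h], goal_cases)
      case 1 show ?case using h_bounds by simp
    next
      case 2 show ?case by (rule small) (use h_bounds in simp)
    next
      case 3
      have "s ''P'' 2 = p 2" using sP[rule_format, of 2] n3 by simp
      then show ?case using envD[OF env] W_0 W_1 by (auto simp: same_but_def le_Suc_eq)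
    next
      case (4 r s1)
      then have r: "r < h" and X1: "same_but ?X s s1" and W1: "\<forall>x\<le>max 1 (2 * r). s1 ''W'' (int x) = W x"
        and v1: "s1 ''r'' 0 = int r" by blast+
      show ?case
      proof (rule run_Assign_Seq, goal_cases)
        case 1 show ?case using small[of "r + 1"] r h_bounds v1 by (simp add: add.commute)
      next
        case 2
        define s2 where "s2 = s1(''J'' := (s1 ''J'')(aval (Const 0) s1 := aval (Var ''r'' [+] Const 1) s1))"
        have X2: "same_but ?X s s2" using X1 by (simp add: s2_def same_but_def)
        have "run N L extend_totals s2 (\<lambda>s'. same_but scratch s2 s' \<and> (\<forall>x\<le>2*Suc r. s' ''W'' (int x) = W x))"
        proof (rule run_extend_totals)
          show "env s2" by (rule env_same_but[OF env X2]) auto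
          show "s2 ''J'' 0 = int (Suc r)" using v1 by (simp add: s2_def)
          show "1 \<le> Suc r" "Suc r \<le> h" using r by simp_all
          show "\<forall>x\<le>Suc r. s2 ''W'' (int x) = W x" using W1 by (simp add: s2_def)
          show "\<forall>j<n. s2 ''P'' (int j) = p j" using sP X2 by (simp add: same_but_def)
        qed
        then show ?case
          unfolding s2_def[symmetric]
        proof (rule run_conseq, goal_cases)
          case (1 s3)
          have "same_but ?X s s3" using 1 X2 by (simp add: same_but_def)
          moreover have "s3 ''r'' 0 = int r" using 1 v1 by (simp add: same_but_def s2_def)
          ultimately show ?case using 1 by (simp add: same_but_def)
        qed
      qed
    next
      case (5 r s') then show ?case using envD[OF env] by (simp add: same_but_def)
    next
      case (6 s') then show ?case using h_bounds by (simp add: max_def)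
    qed
  qed
qed

end


section \<open>Assembling and writing both characteristic polynomials\<close>

definition setup_prog :: com where
  "setup_prog =
     Assign ''n'' (Const 0) (Cell ''in'' (Const 0)) ;;
     Assign ''m'' (Const 0) (Cell ''in'' (Var ''n'' [+] Const 2)) ;;
     Assign ''stride'' (Const 0) (Var ''n'' [+] Var ''m'' [+] Const 2) ;;
     Assign ''half'' (Const 0) ((Var ''n'' [+] Const 1) [div] Const 2)"

text \<open>
  The coefficient of \<open>f W\<close> at \<open>z\<^sup>n\<close> vanishes, and the unknown \<open>p\<^sub>n\<close> occurs in it with the factor \<open>W\<^sub>0 = n\<close>.
\<close>

definition constant_coeff :: com where
  "constant_coeff =
     Sum ''acc'' ''l'' (Var ''n'') (Cell ''P'' (Var ''l'') [*] Cell ''W'' (Var ''n'' [-] Var ''l'')) ;;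
     Assign ''P'' (Var ''n'') ((Const 0 [-] Var ''acc'') [div] Var ''n'')"

definition complement_coeffs :: com where
  "complement_coeffs =
     Assign ''c'' (Const 0) (Const 1) ;;
     Loop ''k'' (Var ''n'') (
       Sum ''acc'' ''l'' (Var ''k'' [+] Const 1)
         (Cell ''P'' (Var ''l'') [*] Cell ''W'' (Var ''k'' [-] Var ''l'')) ;;
       Assign ''c'' (Var ''k'' [+] Const 1) (Cell ''P'' (Var ''k'' [+] Const 1) [+] Var ''acc'')) ;;
     Assign ''d'' (Const 0) (Var ''n'') ;;
     shift_prog (Var ''n'' [+] Const 1)"

definition write_output :: com where
  "write_output =
     Assign ''out'' (Const 0) (Var ''n'' [+] Const 1) ;;
     Assign ''out'' (Var ''n'' [+] Const 2) (Var ''n'' [+] Const 1) ;;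
     Loop ''t'' (Var ''n'' [+] Const 1) (
       Assign ''out'' (Var ''t'' [+] Const 1) (Cell ''P'' (Var ''n'' [-] Var ''t'')) ;;
       Assign ''out'' (Var ''n'' [+] Const 3 [+] Var ''t'') (Cell ''g'' (Var ''n'' [-] Var ''t'')))"

definition reconstruct :: com where
  "reconstruct =
     setup_prog ;; char_coeffs ;; walk_totals ;; constant_coeff ;; complement_coeffs ;; write_output"

context deck_data begin

lemma run_setup_prog:
  assumes "s ''in'' = inp"
  shows "run N L setup_prog s (\<lambda>s'. same_but {''n'',''m'',''stride'',''half''} s s' \<and> env s')"
proof -
  have "int (n + trunc + 2) < 2 ^ L"
  proof -
    have "n + trunc + 2 \<le> 2 ^ E + 2 ^ E" using le_2_E[of n] le_2_E[of "trunc + 2"] trunc by simp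
    also have "\<dots> = 2 ^ Suc E" by simp
    finally have "int (n + trunc + 2) \<le> 2 ^ Suc E" by (metis of_nat_le_iff of_nat_numeral of_nat_power)
    also have "(2::int) ^ Suc E < 2 ^ L" using E4 by (intro power_strict_increasing) auto
    finally show ?thesis .
  qed
  moreover have "int h < 2 ^ L" by (rule small) (use h_bounds in simp)
  moreover have "(int n + 1) div 2 = int h" unfolding h by (simp add: zdiv_int add.commute)
  moreover have "int trunc < 2 ^ L" by (rule small) (use trunc in simp)
  moreover have "int n < 2 ^ L" by (rule small) simp
  ultimately show ?thesis
    unfolding setup_prog_def using assms inp_n inp_m
    by (intro run_Assign_Seq run_Assign) (simp_all add: same_but_def env_def algebra_simps)
qed

lemma run_constant_coeff:
  assumes env: "env s" and sP: "\<forall>j<n. s ''P'' (int j) = p j" and sW: "\<forall>x\<le>n. s ''W'' (int x) = W x"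
  shows "run N L constant_coeff s (\<lambda>s'. same_but {''acc'',''l'',''P''} s s' \<and> (\<forall>j\<le>n. s' ''P'' (int j) = p j))"
  unfolding constant_coeff_def
proof -
  have "run N L (Sum ''acc'' ''l'' (Var ''n'') (Cell ''P'' (Var ''l'') [*] Cell ''W'' (Var ''n'' [-] Var ''l''))) s
    (\<lambda>s'. same_but {''acc'',''l''} s s' \<and> s' ''acc'' 0 = (\<Sum>l<n. p l * W (n - l)))"
  proof (rule run_Sum, goal_cases)
    case 1 show ?case by simp
  next
    case 2 show ?case by simp
  next
    case 3 show ?case by (rule small) simp
  next
    case (4 s') then show ?case using envD[OF env] by (simp add: same_but_def)
  next
    case (5 l s')
    then have "s' ''W'' (int n - int l) = W (n - l)"
      using sW[rule_format, of "n - l"] by (simp add: same_but_def of_nat_diff)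
    then show ?case using 5 sP envD[OF env] by (simp add: same_but_def)
  next
    case (6 l)
    show ?case
    proof (rule abs_sum_less[where a = "E + E" and b = E])
      fix x assume "x < l"
      then show "\<bar>p x * W (n - x)\<bar> \<le> 2 ^ (E + E)" by (intro abs_mult_le_power p_bound W_bound) simp
    qed (use 6 le_2_E[of l] E4 in auto)
  qed
  then show "run N L (Sum ''acc'' ''l'' (Var ''n'') (Cell ''P'' (Var ''l'') [*] Cell ''W'' (Var ''n'' [-] Var ''l'')) ;;
     Assign ''P'' (Var ''n'') ((Const 0 [-] Var ''acc'') [div] Var ''n'')) s
     (\<lambda>s'. same_but {''acc'',''l'',''P''} s s' \<and> (\<forall>j\<le>n. s' ''P'' (int j) = p j))"
  proof (rule run_Seq, goal_cases)
    case (1 s1)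
    then have X1: "same_but {''acc'',''l''} s s1" and a1: "s1 ''acc'' 0 = (\<Sum>l<n. p l * W (n - l))" by blast+
    have v: "s1 ''n'' 0 = int n" using X1 envD[OF env] by (simp add: same_but_def)
    have "(\<Sum>l<n. p l * W (n - l)) + p n * int n = 0"
      using cayley_hamilton by (simp add: W_0 flip: lessThan_Suc_atMost)
    then have "0 - s1 ''acc'' 0 = p n * int n" using a1 by linarith
    then have val: "aval ((Const 0 [-] Var ''acc'') [div] Var ''n'') s1 = p n"
      using v n3 by simp
    show ?case
    proof (rule run_Assign, unfold val, goal_cases)
      case 1 show ?case by (rule less_L[OF p_bound]) simp
    next
      case 2
      have "\<forall>j\<le>n. ((s1 ''P'')(int n := p n)) (int j) = p j"
        using sP X1 by (auto simp: same_but_def le_less)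
      then show ?case using X1 v
        by (simp add: same_but_def del: fun_upd_apply add: fun_upd_same fun_upd_other)
    qed
  qed
qed

text \<open>
  The coefficients of \<open>f (1 + z W)\<close>, the reversed characteristic polynomial of \<open>A - J\<close>.
\<close>

fun ones_coeff :: "nat \<Rightarrow> int" where
  "ones_coeff 0 = 1"
| "ones_coeff (Suc k) = p (Suc k) + (\<Sum>l<Suc k. p l * W (k - l))"

lemma ones_coeff_bound: "\<bar>ones_coeff j\<bar> \<le> 2 ^ (4 * E)" if "j \<le> n"
proof (cases j)
  case (Suc k)
  have "\<bar>\<Sum>l<Suc k. p l * W (k - l)\<bar> < 2 ^ (3 * E + 1)"
  proof (rule abs_sum_less[where a = "E + E" and b = E])
    fix x assume "x < Suc k"
    then show "\<bar>p x * W (k - x)\<bar> \<le> 2 ^ (E + E)" using Suc that by (intro abs_mult_le_power p_bound W_bound) simp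
  qed (use le_2_E[of "Suc k"] Suc that in simp_all)
  moreover have "(2::int) ^ E \<le> 2 ^ (3 * E + 1)" by (rule power_increasing) simp_all
  ultimately have "\<bar>ones_coeff j\<bar> \<le> 2 ^ (3 * E + 1) + 2 ^ (3 * E + 1)"
    using p_bound[of "Suc k"] unfolding Suc ones_coeff.simps by linarith
  also have "\<dots> = 2 ^ (3 * E + 2)" by simp
  also have "(2::int) ^ (3 * E + 2) \<le> 2 ^ (4 * E)" using E4 by (intro power_increasing) simp_all
  finally show ?thesis .
qed simp

lemma run_complement_coeffs:
  assumes env: "env s" and sP: "\<forall>j\<le>n. s ''P'' (int j) = p j" and sW: "\<forall>x\<le>n. s ''W'' (int x) = W x"
  shows "run N L complement_coeffs s (\<lambda>s'.
    same_but {''c'',''k'',''acc'',''l'',''d'',''g'',''sign'',''b'',''t''} s s' \<and>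
    (\<forall>j\<le>n. s' ''g'' (int j) = shift_coeff n ones_coeff j))"
  unfolding complement_coeffs_def
proof (rule run_Assign_Seq, goal_cases)
  case 1 show ?case using small[of 1] by simp
next
  case 2
  let ?X = "{''c'',''k'',''acc'',''l'',''d'',''g'',''sign'',''b'',''t''}"
  let ?s0 = "s(''c'' := (s ''c'')(aval (Const 0) s := aval (Const 1) s))"
  let ?I = "\<lambda>k s'. same_but {''c'',''k'',''acc'',''l''} s s' \<and> (\<forall>j\<le>k. s' ''c'' (int j) = ones_coeff j)"
  have "run N L (Loop ''k'' (Var ''n'') (
       Sum ''acc'' ''l'' (Var ''k'' [+] Const 1)
         (Cell ''P'' (Var ''l'') [*] Cell ''W'' (Var ''k'' [-] Var ''l'')) ;;
       Assign ''c'' (Var ''k'' [+] Const 1) (Cell ''P'' (Var ''k'' [+] Const 1) [+] Var ''acc''))) ?s0 (?I n)"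
  proof (rule run_Loop_invariant[where I = ?I and m = n], goal_cases)
    case 1 show ?case by simp
  next
    case 2 show ?case by (rule small) simp
  next
    case 3 show ?case by (simp add: same_but_def)
  next
    case (4 k s1)
    then have k: "k < n" and X1: "same_but {''c'',''k'',''acc'',''l''} s s1"
      and c1: "\<forall>j\<le>k. s1 ''c'' (int j) = ones_coeff j" and v1: "s1 ''k'' 0 = int k" by blast+
    have "run N L (Sum ''acc'' ''l'' (Var ''k'' [+] Const 1)
         (Cell ''P'' (Var ''l'') [*] Cell ''W'' (Var ''k'' [-] Var ''l''))) s1
       (\<lambda>s'. same_but {''acc'',''l''} s1 s' \<and> s' ''acc'' 0 = (\<Sum>l<Suc k. p l * W (k - l)))"
    proof (rule run_Sum, goal_cases)
      case 1 show ?case by simp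
    next
      case 2 show ?case using k by simp
    next
      case 3 show ?case by (rule small) (use k in simp)
    next
      case (4 s') then show ?case using v1 by (simp add: same_but_def)
    next
      case (5 l s')
      then have "s' ''W'' (int k - int l) = W (k - l)"
        using sW[rule_format, of "k - l"] k X1 by (simp add: same_but_def of_nat_diff)
      then show ?case using 5 sP v1 X1 k by (simp add: same_but_def)
    next
      case (6 l)
      show ?case
      proof (rule abs_sum_less[where a = "E + E" and b = E])
        fix x assume "x < l"
        then show "\<bar>p x * W (k - x)\<bar> \<le> 2 ^ (E + E)" using k by (intro abs_mult_le_power p_bound W_bound) simp
      qed (use 6 le_2_E[of l] k E4 in auto)
    qed
    then show ?case
    proof (rule run_Seq, goal_cases)
      case (1 s2)
      then have X2: "same_but {''acc'',''l''} s1 s2" and a2: "s2 ''acc'' 0 = (\<Sum>l<Suc k. p l * W (k - l))" by blast+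
      have v2: "s2 ''k'' 0 = int k" using X2 v1 by (simp add: same_but_def)
      have "s2 ''P'' (int k + 1) = p (Suc k)"
        using sP[rule_format, of "Suc k"] k X1 X2 by (simp add: same_but_def add.commute)
      then have val: "aval (Cell ''P'' (Var ''k'' [+] Const 1) [+] Var ''acc'') s2 = ones_coeff (Suc k)"
        using a2 v2 by simp
      show ?case
      proof (rule run_Assign, unfold val, goal_cases)
        case 1 show ?case by (rule less_L[OF ones_coeff_bound]) (use k in simp_all)
      next
        case 2
        have "\<forall>j\<le>Suc k. ((s2 ''c'')(int k + 1 := ones_coeff (Suc k))) (int j) = ones_coeff j"
          using c1 X2 by (auto simp: same_but_def le_Suc_eq simp del: ones_coeff.simps)
        then show ?case using X1 X2 v2
          by (simp add: same_but_def del: fun_upd_apply ones_coeff.simps add: fun_upd_same fun_upd_other)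
      qed
    qed
  next
    case (5 k s') then show ?case using envD[OF env] by (simp add: same_but_def)
  qed
  then show ?case
  proof (rule run_Seq, goal_cases)
    case (1 s1)
    then have X1: "same_but {''c'',''k'',''acc'',''l''} s s1" and c1: "\<forall>j\<le>n. s1 ''c'' (int j) = ones_coeff j" by blast+
    have v1: "s1 ''n'' 0 = int n" using X1 envD[OF env] by (simp add: same_but_def)
    show ?case
    proof (rule run_Assign_Seq, goal_cases)
      case 1 show ?case using v1 small[of n] by simp
    next
      case 2
      define s2 where "s2 = s1(''d'' := (s1 ''d'')(aval (Const 0) s1 := aval (Var ''n'') s1))"
      have "run N L (shift_prog (Var ''n'' [+] Const 1)) s2 (\<lambda>s'. same_but {''g'',''sign'',''b'',''l'',''t''} s2 s' \<and>
           (\<forall>j\<le>n+1. s' ''g'' (int j) = shift_coeff n (\<lambda>l. if l < n + 1 then s2 ''c'' (int l) else 0) j))"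
      proof (rule run_shift_prog[where K = "4 * E" and E = E])
        show "s2 ''d'' 0 = int n" using v1 by (simp add: s2_def)
        show "aval (Var ''n'' [+] Const 1) s' = int (n + 1)" if "same_but {''g'',''sign'',''b'',''l'',''t''} s2 s'" for s'
          using that v1 by (simp add: same_but_def s2_def)
        show "\<bar>s2 ''c'' (int l)\<bar> \<le> 2 ^ (4 * E)" if "l < n + 1" for l
          using c1 ones_coeff_bound[of l] that by (simp add: s2_def)
        show "n + 2 \<le> 2 ^ E" by (rule le_2_E) simp
      qed (use E4 in simp_all)
      then show ?case
        unfolding s2_def[symmetric]
      proof (rule run_conseq, goal_cases)
        case (1 s')
        have "same_but ?X s s'" using 1 X1 by (simp add: same_but_def s2_def)
        moreover have "s' ''g'' (int j) = shift_coeff n ones_coeff j" if "j \<le> n" for j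
        proof -
          have "s' ''g'' (int j) = shift_coeff n (\<lambda>l. if l < n + 1 then s2 ''c'' (int l) else 0) j"
            using 1 that by simp
          also have "\<dots> = shift_coeff n ones_coeff j"
            unfolding shift_coeff_def by (rule sum.cong) (use that c1 in \<open>auto simp: s2_def\<close>)
          finally show ?thesis .
        qed
        ultimately show ?case by blast
      qed
    qed
  qed
qed

definition result_list :: "int list" where
  "result_list = encode_ints (map (\<lambda>j. p (n - j)) [0..<Suc n])
     @ encode_ints (map (\<lambda>j. shift_coeff n ones_coeff (n - j)) [0..<Suc n])"

text \<open>
  The contents of the array \<open>out\<close> after \<open>t\<close> rounds of the final loop, which fills both polynomials in parallel.
\<close>

definition partial_output :: "nat \<Rightarrow> int \<Rightarrow> int" where
  "partial_output t x =
     (if x = 0 \<or> x = int n + 2 then int n + 1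
      else if 1 \<le> x \<and> x \<le> int t then p (n - nat (x - 1))
      else if int n + 3 \<le> x \<and> x < int n + 3 + int t then shift_coeff n ones_coeff (n - nat (x - (int n + 3)))
      else 0)"

lemma partial_output_Suc:
  assumes "t \<le> n"
  shows "(partial_output t)(int t + 1 := p (n - t), int n + 3 + int t := shift_coeff n ones_coeff (n - t))
    = partial_output (Suc t)"
  using assms by (auto simp: partial_output_def fun_eq_iff)

lemma partial_output_final: "partial_output (Suc n) = array_of result_list"
proof
  fix x
  have len: "length result_list = 2 * n + 4" by (simp add: result_list_def encode_ints_def)
  consider "x < 0" | "x = 0" | "1 \<le> x" "x \<le> int n + 1" | "x = int n + 2"
    | "int n + 3 \<le> x" "x < 2 * int n + 4" | "2 * int n + 4 \<le> x" by linarith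
  then show "partial_output (Suc n) x = array_of result_list x"
  proof cases
    case 3
    define j where "j = nat (x - 1)"
    have j: "x = int j + 1" "j \<le> n" "nat x = Suc j" using 3 by (auto simp: j_def)
    have "result_list ! Suc j = p (n - j)"
      using j by (simp add: result_list_def encode_ints_def nth_append del: upt_Suc)
    then show ?thesis using j len by (simp add: partial_output_def array_of_def)
  next
    case 5
    define j where "j = nat (x - (int n + 3))"
    have j: "x = int n + 3 + int j" "j \<le> n" "nat x = Suc (Suc n) + Suc j" using 5 by (auto simp: j_def)
    have "result_list ! (Suc (Suc n) + Suc j) = shift_coeff n ones_coeff (n - j)"
      using j by (simp add: result_list_def encode_ints_def nth_append del: upt_Suc)
    then show ?thesis using j len by (simp add: partial_output_def array_of_def)
  next
    case 4
    have "result_list ! Suc (Suc n) = int n + 1"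
      by (simp add: result_list_def encode_ints_def nth_append del: upt_Suc)
    then show ?thesis using 4 len by (simp add: partial_output_def array_of_def nat_add_distrib)
  qed (use len in \<open>simp_all add: partial_output_def array_of_def result_list_def encode_ints_def\<close>)
qed

lemma run_write_output:
  assumes env: "env s" and sP: "\<forall>j\<le>n. s ''P'' (int j) = p j"
    and sg: "\<forall>j\<le>n. s ''g'' (int j) = shift_coeff n ones_coeff j" and out: "s ''out'' = (\<lambda>_. 0)"
  shows "run N L write_output s (\<lambda>s'. s' ''out'' = array_of result_list)"
  unfolding write_output_def
proof (rule run_Assign_Seq, goal_cases)
  case 1 show ?case using envD[OF env] small[of "n + 1"] by (simp add: add.commute)
next
  case 2
  show ?case
  proof (rule run_Assign_Seq, goal_cases)
    case 1 show ?case using envD[OF env] small[of "n + 1"] by (simp add: add.commute)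
  next
    case 2
    let ?I = "\<lambda>t s'. same_but {''out'',''t''} s s' \<and> s' ''out'' = partial_output t"
    show ?case
    proof (rule run_Loop[where I = ?I and m = "Suc n"], goal_cases)
      case 1 show ?case by simp
    next
      case 2 show ?case by (rule small) simp
    next
      case 3 show ?case using envD[OF env] out
        by (auto simp: same_but_def partial_output_def fun_eq_iff)
    next
      case (4 t s1)
      then have t: "t \<le> n" and X1: "same_but {''out'',''t''} s s1" and o1: "s1 ''out'' = partial_output t"
        and v1: "s1 ''t'' 0 = int t" by simp_all
      have n1: "s1 ''n'' 0 = int n" using X1 envD[OF env] by (simp add: same_but_def)
      have Pv: "s1 ''P'' (int n - int t) = p (n - t)" and gv: "s1 ''g'' (int n - int t) = shift_coeff n ones_coeff (n - t)"
        using sP[rule_format, of "n - t"] sg[rule_format, of "n - t"] X1 t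
        by (simp_all add: same_but_def of_nat_diff)
      have g_less: "\<bar>shift_coeff n ones_coeff (n - t)\<bar> < 2 ^ L"
        unfolding shift_coeff_def lessThan_Suc_atMost[symmetric]
      proof (rule abs_sum_less[where a = "4 * E + E" and b = E])
        fix x assume x: "x < Suc (n - t)"
        have "(n - x) choose (n - t - x) \<le> 2 ^ (n - x)" by (rule binomial_le_pow2)
        also have "\<dots> \<le> 2 ^ E" using E4 by (intro power_increasing) auto
        finally have "\<bar>int ((n - x) choose (n - t - x))\<bar> \<le> 2 ^ E" by (simp flip: of_nat_power_le_of_nat_cancel_iff)
        moreover have "\<bar>(-1) ^ x * ones_coeff x\<bar> \<le> 2 ^ (4 * E)" using ones_coeff_bound[of x] x by (simp add: abs_mult)
        ultimately show "\<bar>(-1) ^ x * ones_coeff x * int ((n - x) choose (n - t - x))\<bar> \<le> 2 ^ (4 * E + E)"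
          by (intro abs_mult_le_power)
      next
        show "Suc (n - t) \<le> 2 ^ E" by (rule le_2_E) simp
      qed (use E4 in simp)
      show ?case
      proof (rule run_Assign_Seq, goal_cases)
        case 1
        have "\<bar>p (n - t)\<bar> < 2 ^ L" by (rule less_L[OF p_bound]) simp
        then show ?case using n1 v1 Pv by simp
      next
        case 2
        show ?case
        proof (rule run_Assign, goal_cases)
          case 1
          then show ?case using n1 v1 gv g_less by simp
        next
          case 2
          show ?case using n1 v1 Pv gv o1 X1 partial_output_Suc[OF t]
            by (simp add: same_but_def del: fun_upd_apply add: fun_upd_same fun_upd_other)
        qed
      qed
    next
      case (5 t s') then show ?case using envD[OF env] by (simp add: same_but_def)
    next
      case (6 s') then show ?case by (simp add: partial_output_final)
    qed
  qed
qed

theorem run_reconstruct: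
  assumes "s ''in'' = inp" "s ''out'' = (\<lambda>_. 0)"
  shows "run N L reconstruct s (\<lambda>s'. s' ''out'' = array_of result_list)"
  unfolding reconstruct_def
proof (rule run_Seq[OF run_setup_prog[of s, OF assms(1)]], goal_cases)
  case (1 s1)
  then have e1: "env s1" and o1: "s1 ''out'' = (\<lambda>_. 0)" using assms(2) by (simp_all add: same_but_def)
  show ?case
  proof (rule run_Seq[OF run_char_coeffs[OF e1]], goal_cases)
    case (1 s2)
    then have X2: "same_but {''P'',''j'',''i'',''acc''} s1 s2" and P2: "\<forall>j<n. s2 ''P'' (int j) = p j" by blast+
    have e2: "env s2" by (rule env_same_but[OF e1 X2]) auto
    show ?case
    proof (rule run_Seq[OF run_walk_totals[OF e2 P2]], goal_cases)
      case (1 s3)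
      then have X3: "same_but (scratch \<union> {''J'',''r''}) s2 s3" and W3: "\<forall>x\<le>n. s3 ''W'' (int x) = W x" by blast+
      have e3: "env s3" by (rule env_same_but[OF e2 X3]) auto
      have P3: "\<forall>j<n. s3 ''P'' (int j) = p j" using P2 X3 by (simp add: same_but_def)
      show ?case
      proof (rule run_Seq[OF run_constant_coeff[OF e3 P3 W3]], goal_cases)
        case (1 s4)
        then have X4: "same_but {''acc'',''l'',''P''} s3 s4" and P4: "\<forall>j\<le>n. s4 ''P'' (int j) = p j" by blast+
        have e4: "env s4" by (rule env_same_but[OF e3 X4]) auto
        have W4: "\<forall>x\<le>n. s4 ''W'' (int x) = W x" using W3 X4 by (simp add: same_but_def)
        show ?case
        proof (rule run_Seq[OF run_complement_coeffs[OF e4 P4 W4]], goal_cases)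
          case (1 s5)
          then have X5: "same_but {''c'',''k'',''acc'',''l'',''d'',''g'',''sign'',''b'',''t''} s4 s5"
            and g5: "\<forall>j\<le>n. s5 ''g'' (int j) = shift_coeff n ones_coeff j" by blast+
          have e5: "env s5" by (rule env_same_but[OF e4 X5]) auto
          have "\<forall>j\<le>n. s5 ''P'' (int j) = p j" using P4 X5 by (simp add: same_but_def)
          moreover have "s5 ''out'' = (\<lambda>_. 0)" using o1 X2 X3 X4 X5 by (simp add: same_but_def)
          ultimately show ?case using run_write_output[OF e5 _ g5] by blast
        qed
      qed
    qed
  qed
qed

end


section \<open>The deck of a graph as input\<close>

text \<open>
  The length of the truncated lists in the form \<open>h + 2\<close>, where \<open>h\<close> is the order up to which the local walk counts are computed:
  they reach index \<open>h + 1\<close>.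
\<close>

lemma num_top_coeffs_eq: "num_top_coeffs n = (n + 1) div 2 + 2"
proof (cases "even n")
  case True
  then obtain m where m: "n = 2 * m" by (elim evenE)
  have "\<lceil>(real n + 4) / 2\<rceil> = int m + 2"
    unfolding m by (rule ceiling_unique) (simp_all add: field_simps)
  then show ?thesis by (simp add: num_top_coeffs_def m nat_add_distrib)
next
  case False
  then obtain m where m: "n = 2 * m + 1" by (elim oddE)
  have "\<lceil>(real n + 4) / 2\<rceil> = int m + 3"
    unfolding m by (rule ceiling_unique) (simp_all add: field_simps)
  then show ?thesis by (simp add: num_top_coeffs_def m nat_add_distrib)
qed

lemma mset_eq_image_mset_list:
  assumes "mset ys = image_mset f M"
  obtains xs where "mset xs = M" "ys = map f xs"
  using assms
proof (induction ys arbitrary: M thesis)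
  case Nil
  then show ?case by simp
next
  case (Cons y ys)
  then have "y \<in># image_mset f M" by (metis list.set_intros(1) set_mset_mset)
  then obtain x where x: "x \<in># M" "y = f x" by auto
  then obtain M' where M: "M = add_mset x M'" by (metis mset_add)
  then have "mset ys = image_mset f M'" using Cons.prems(2) x by simp
  then obtain xs where "mset xs = M'" "ys = map f xs" using Cons.IH by blast
  then show ?case using Cons.prems(1)[of "x # xs"] M x by simp
qed

lemma nth_concat_map:
  assumes "\<And>x. x \<in> set xs \<Longrightarrow> length (f x) = S" "i < length xs" "r < S"
  shows "concat (map f xs) ! (i * S + r) = f (xs ! i) ! r"
  using assms
proof (induction xs arbitrary: i)
  case (Cons x xs)
  show ?case
  proof (cases i)
    case 0
    then show ?thesis using Cons.prems by (simp add: nth_append)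
  next
    case (Suc i')
    then have "concat (map f xs) ! (i' * S + r) = f (xs ! i') ! r" using Cons by simp
    then show ?thesis using Suc Cons.prems(1)[of x] by (simp add: nth_append add.assoc)
  qed
qed simp

lemma length_concat_map_const:
  "(\<And>x. x \<in> set xs \<Longrightarrow> length (f x) = S) \<Longrightarrow> length (concat (map f xs)) = length xs * S"
  by (induction xs) auto

lemma set_concat_map_nth: "y \<in> set (concat (map f xs)) \<longleftrightarrow> (\<exists>i<length xs. y \<in> set (f (xs ! i)))"
  by (force simp: in_set_conv_nth[of _ xs])

lemma power_bounds:
  fixes n :: nat
  assumes "n \<ge> 3"
  shows "(fact n * 2 ^ n :: int) \<le> 2 ^ (4 * n * n)" "int n ^ (n + 2) \<le> 2 ^ (4 * n * n)" "n + 4 \<le> 4 * n * n"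
proof -
  have n2: "int n \<le> 2 ^ n" using less_exp[of n] by (metis less_imp_le of_nat_le_iff of_nat_numeral of_nat_power)
  have "(fact n :: int) = int (fact n)" by simp
  also have "\<dots> \<le> int (n ^ n)" using fact_le_power[of n, where 'a = nat] by (simp only: of_nat_le_iff of_nat_id)
  also have "\<dots> = int n ^ n" by simp
  also have "\<dots> \<le> (2 ^ n) ^ n" using n2 by (intro power_mono) auto
  finally have "(fact n * 2 ^ n :: int) \<le> (2 ^ n) ^ n * 2 ^ n" by (intro mult_right_mono) auto
  also have "\<dots> = 2 ^ (n * n + n)" by (simp add: power_mult power_add)
  also have "(2::int) ^ (n * n + n) \<le> 2 ^ (4 * n * n)" by (intro power_increasing) (auto simp: algebra_simps)
  finally show "(fact n * 2 ^ n :: int) \<le> 2 ^ (4 * n * n)" .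
  have "int n ^ (n + 2) \<le> (2 ^ n) ^ (n + 2)" using n2 by (intro power_mono) auto
  also have "\<dots> = 2 ^ (n * (n + 2))" by (simp only: power_mult)
  also have "(2::int) ^ (n * (n + 2)) \<le> 2 ^ (4 * n * n)"
  proof (rule power_increasing)
    have "n + 2 \<le> 4 * n" using assms by simp
    then have "n * (n + 2) \<le> n * (4 * n)" by (rule mult_le_mono2)
    then show "n * (n + 2) \<le> 4 * n * n" by (simp add: mult_ac)
  qed simp
  finally show "int n ^ (n + 2) \<le> 2 ^ (4 * n * n)" .
  have "n + 4 \<le> 4 * n" using assms by simp
  also have "\<dots> \<le> 4 * n * n" using assms by simp
  finally show "n + 4 \<le> 4 * n * n" .
qed

lemma degree_char_poly:
  fixes B :: "int mat"
  assumes "B \<in> carrier_mat m m"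
  shows "degree (char_poly B) = m" "char_poly B \<noteq> 0"
proof -
  have "degree (char_poly B) = m \<and> coeff (char_poly B) m = 1" by (rule degree_monic_char_poly[OF assms])
  then show "degree (char_poly B) = m" "char_poly B \<noteq> 0" by (blast, metis coeff_0 zero_neq_one)
qed

text \<open>
  A graph together with a listing of its deck in an arbitrary order. The order is fixed by choosing a list of vertices
  that induces it; all quantities derived from the cards enter the reconstruction through sums over all cards.
\<close>

locale graph_deck =
  fixes n :: nat and G :: "nat pair_pre_digraph" and ds :: "(int poly \<times> int list) list"
  assumes n3: "n \<ge> 3" and G: "pair_graph G" and verts: "pverts G = {1..n}"
    and deck: "mset ds = truncated_deck (num_top_coeffs n) G"
begin

definition "A = adjacency_matrix G"
definition "trunc = min (num_top_coeffs n) n"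
definition deck_card :: "nat \<Rightarrow> int poly \<times> int list" where
  "deck_card v = (graph_char_poly (delete_vertex G v),
     top_coeffs (num_top_coeffs n) (graph_char_poly (complement_graph (delete_vertex G v))))"
definition vertex_list :: "nat list" where
  "vertex_list = (SOME vs. mset vs = mset_set {1..n} \<and> ds = map deck_card vs)"
definition vertex :: "nat \<Rightarrow> nat" where "vertex i = vertex_list ! i - 1"
definition co_card :: "nat \<Rightarrow> int mat" where
  "co_card m = adjacency_matrix (complement_graph (delete_vertex G (Suc m)))"

lemma vertex_list: "mset vertex_list = mset_set {1..n}" "ds = map deck_card vertex_list"
proof -
  have "mset ds = image_mset deck_card (mset_set {1..n})"
    unfolding deck truncated_deck_def verts deck_card_def ..
  then obtain vs where "mset vs = mset_set {1..n} \<and> ds = map deck_card vs"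
    by (metis mset_eq_image_mset_list)
  then have "mset vertex_list = mset_set {1..n} \<and> ds = map deck_card vertex_list"
    unfolding vertex_list_def by (rule someI)
  then show "mset vertex_list = mset_set {1..n}" "ds = map deck_card vertex_list" by blast+
qed

lemma length_vertex_list: "length vertex_list = n"
  by (metis card_atLeastAtMost diff_Suc_1 vertex_list(1) size_mset size_mset_set)

lemma set_vertex_list: "set vertex_list = {1..n}"
  by (metis finite_atLeastAtMost finite_set_mset_mset_set vertex_list(1) set_mset_mset)

lemma distinct_vertex_list: "distinct vertex_list"
  by (metis card_atLeastAtMost card_distinct diff_Suc_1 length_vertex_list set_vertex_list)

lemma vertex_list_nth: "i < n \<Longrightarrow> vertex_list ! i = Suc (vertex i)" "i < n \<Longrightarrow> vertex i < n"
proof -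
  assume "i < n"
  then have "vertex_list ! i \<in> {1..n}" using set_vertex_list length_vertex_list nth_mem by metis
  then show "vertex_list ! i = Suc (vertex i)" "vertex i < n" by (auto simp: vertex_def)
qed

lemma sum_vertex: "(\<Sum>i<n. f (vertex i)) = (\<Sum>v<n. f v)" for f :: "nat \<Rightarrow> int"
proof (rule sum.reindex_bij_betw)
  have inj: "inj_on vertex {..<n}"
  proof (rule inj_onI)
    fix i j assume ij: "i \<in> {..<n}" "j \<in> {..<n}" "vertex i = vertex j"
    then have "vertex_list ! i = vertex_list ! j" using vertex_list_nth(1) by simp
    then show "i = j" using ij distinct_vertex_list length_vertex_list by (simp add: nth_eq_iff_index_eq)
  qed
  moreover have "vertex ` {..<n} \<subseteq> {..<n}" using vertex_list_nth(2) by auto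
  ultimately show "bij_betw vertex {..<n} {..<n}"
    by (simp add: bij_betw_def endo_inj_surj)
qed

lemma no_loop: "(v,v) \<notin> parcs G"
proof -
  interpret pair_graph G by (rule G)
  show ?thesis using no_loops' by blast
qed

lemma arc_sym: "(u,v) \<in> parcs G \<Longrightarrow> (v,u) \<in> parcs G"
proof -
  interpret pair_graph G by (rule G)
  assume "(u,v) \<in> parcs G"
  then show ?thesis using pair_sym_arcs by (simp add: symmetric_def sym_def)
qed

lemma A_carrier: "A \<in> carrier_mat n n"
  using adjacency_matrix_carrier[of G] by (simp add: A_def verts)

lemma A_entry: "i < n \<Longrightarrow> j < n \<Longrightarrow> A $$ (i,j) = (if (Suc i, Suc j) \<in> parcs G then 1 else 0)"
  by (simp add: A_def adjacency_matrix_def Let_def verts sorted_list_of_1_to_n nth_upt plus_1_eq_Suc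
    del: upt_Suc One_nat_def)

sublocale symmetric_int_matrix A n
proof
  show "A \<in> carrier_mat n n" by (rule A_carrier)
  show "A $$ (i,j) = A $$ (j,i)" if "i < n" "j < n" for i j
    using that arc_sym by (auto simp: A_entry)
qed

lemma A_abs: "i < n \<Longrightarrow> j < n \<Longrightarrow> \<bar>A $$ (i,j)\<bar> \<le> 1" by (simp add: A_entry)

lemma card_poly: "m < n \<Longrightarrow> graph_char_poly (delete_vertex G (Suc m)) = char_poly (mat_delete A m m)"
  unfolding graph_char_poly_def A_def by (simp add: adjacency_matrix_delete[OF verts])

lemma delete_carrier: "mat_delete A m m \<in> carrier_mat (n - 1) (n - 1)"
  by (rule mat_delete_carrier[OF A_carrier])

lemma card_delete: "m < n \<Longrightarrow> card (pverts (delete_vertex G (Suc m))) = n - 1"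
  by (simp add: delete_vertex_def verts)

lemma co_card_carrier: "m < n \<Longrightarrow> co_card m \<in> carrier_mat (n - 1) (n - 1)"
  using adjacency_matrix_carrier[of "complement_graph (delete_vertex G (Suc m))"]
  by (simp add: co_card_def complement_graph_def card_delete)

lemma co_card_abs: "i < n - 1 \<Longrightarrow> j < n - 1 \<Longrightarrow> m < n \<Longrightarrow> \<bar>co_card m $$ (i,j)\<bar> \<le> 1"
  using card_delete[of m] by (simp add: co_card_def adjacency_matrix_def Let_def complement_graph_def)

lemma co_card_entry:
  assumes "i < n - 1" "j < n - 1" "m < n"
  shows "co_card m $$ (i,j) = - mat_delete (minus_ones A) m m $$ (i,j) - (if i = j then 1 else 0)"
proof -
  have "co_card m $$ (i,j) = - minus_ones (adjacency_matrix (delete_vertex G (Suc m))) $$ (i,j) - (if i = j then 1 else 0)"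
    unfolding co_card_def
  proof (rule adjacency_matrix_complement)
    show "(v,v) \<notin> parcs (delete_vertex G (Suc m))" for v using no_loop by (simp add: delete_vertex_def)
  qed (use assms card_delete in \<open>simp_all add: delete_vertex_def verts\<close>)
  moreover have "minus_ones (adjacency_matrix (delete_vertex G (Suc m))) = mat_delete (minus_ones A) m m"
    unfolding adjacency_matrix_delete[OF verts assms(3)] A_def[symmetric]
    using A_carrier by (intro eq_matI) (auto simp: minus_ones_def mat_delete_def)
  ultimately show ?thesis by simp
qed

definition "c_coeff i l = (if l < trunc then rev_coeff (char_poly (co_card (vertex i))) l else 0)"

lemma minus_ones_delete_carrier: "mat_delete (minus_ones A) m m \<in> carrier_mat (n - 1) (n - 1)"
  using A_carrier by (intro mat_delete_carrier) (simp add: minus_ones_def)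

text \<open>
  Beyond the truncation the lists are padded by zeros, which is harmless up to index \<open>h + 1\<close>: an entry that is missing there
  belongs to an index above the degree \<open>n - 1\<close>.
\<close>

lemma card_complement_coeffs:
  assumes "i < n" "j \<le> (n + 1) div 2 + 1"
  shows "rev_coeff (char_poly (mat_delete (minus_ones A) (vertex i) (vertex i))) j = shift_coeff (n - 1) (c_coeff i) j"
proof -
  let ?m = "vertex i"
  have m: "?m < n" by (rule vertex_list_nth(2)[OF assms(1)])
  have "rev_coeff (char_poly (mat_delete (minus_ones A) ?m ?m)) j = shift_coeff (n - 1) (rev_coeff (char_poly (co_card ?m))) j"
    by (rule reflected_matrix_coeffs[OF co_card_carrier[OF m] minus_ones_delete_carrier])
      (simp add: co_card_entry[OF _ _ m])
  also have "\<dots> = shift_coeff (n - 1) (c_coeff i) j"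
    unfolding shift_coeff_def
  proof (rule sum.cong)
    fix l assume "l \<in> {..j}"
    then have "l < num_top_coeffs n" using assms(2) by (simp add: num_top_coeffs_eq)
    moreover have "rev_coeff (char_poly (co_card ?m)) l = 0" if "\<not> l < n"
      by (rule rev_coeff_beyond_dim[OF co_card_carrier[OF m]]) (use that n3 in simp)
    ultimately have "rev_coeff (char_poly (co_card ?m)) l = c_coeff i l"
      by (auto simp: c_coeff_def trunc_def)
    then show "(-1) ^ l * rev_coeff (char_poly (co_card ?m)) l * int ((n - 1 - l) choose (j - l))
        = (-1) ^ l * c_coeff i l * int ((n - 1 - l) choose (j - l))" by simp
  qed simp
  finally show ?thesis .
qed


definition block :: "int poly \<times> int list \<Rightarrow> int list" where
  "block = (\<lambda>(p, cs). encode_poly p @ encode_ints cs)"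

lemma block_deck_card:
  assumes "i < n"
  shows "block (deck_card (vertex_list ! i)) =
      (int n # map (\<lambda>j. rev_coeff (char_poly (mat_delete A (vertex i) (vertex i))) (n - 1 - j)) [0..<n])
      @ (int trunc # map (c_coeff i) [0..<trunc])"
proof -
  let ?m = "vertex i"
  have m: "?m < n" by (rule vertex_list_nth(2)[OF assms])
  have deg: "degree (char_poly (mat_delete A ?m ?m)) = n - 1" "char_poly (mat_delete A ?m ?m) \<noteq> 0"
    by (rule degree_char_poly[OF delete_carrier])+
  have "encode_poly (graph_char_poly (delete_vertex G (vertex_list ! i)))
      = int n # map (\<lambda>j. rev_coeff (char_poly (mat_delete A ?m ?m)) (n - 1 - j)) [0..<n]"
    using n3 unfolding vertex_list_nth(1)[OF assms] card_poly[OF m] encode_poly_def encode_ints_def coeffs_conv_reflect[OF deg]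
    by (simp del: upt_Suc)
  moreover have "degree (char_poly (co_card ?m)) = n - 1"
    using degree_monic_char_poly[OF co_card_carrier[OF m]] by simp
  then have "top_coeffs (num_top_coeffs n) (graph_char_poly (complement_graph (delete_vertex G (vertex_list ! i))))
      = map (c_coeff i) [0..<trunc]"
    using n3 unfolding vertex_list_nth(1)[OF assms] graph_char_poly_def co_card_def[symmetric] top_coeffs_conv trunc_def
    by (auto simp: c_coeff_def trunc_def)
  ultimately show ?thesis by (simp add: block_def deck_card_def encode_ints_def)
qed

lemma encoded_deck: "encode_deck ds = int n # concat (map block (map deck_card vertex_list))"
proof -
  have "length ds = n" using arg_cong[OF vertex_list(2), of length] length_vertex_list by simp
  moreover have "map block ds = map block (map deck_card vertex_list)" by (rule arg_cong[OF vertex_list(2)])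
  ultimately show ?thesis by (simp only: encode_deck_def block_def)
qed

lemma block_length: "x \<in> set (map deck_card vertex_list) \<Longrightarrow> length (block x) = n + trunc + 2"
  using block_deck_card length_vertex_list by (auto simp: in_set_conv_nth)

lemma input_at:
  assumes "i < n" "r < n + trunc + 2"
  shows "array_of (encode_deck ds) (1 + int (i * (n + trunc + 2) + r)) = block (deck_card (vertex_list ! i)) ! r"
proof -
  let ?x = "i * (n + trunc + 2) + r"
  have len: "length (concat (map block (map deck_card vertex_list))) = n * (n + trunc + 2)"
    by (simp only: length_concat_map_const[OF block_length] length_map length_vertex_list)
  have less: "?x < n * (n + trunc + 2)"
  proof -
    have "?x < Suc i * (n + trunc + 2)" using assms by simp
    also have "\<dots> \<le> n * (n + trunc + 2)" using assms by (intro mult_le_mono1) simp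
    finally show ?thesis .
  qed
  have nth: "concat (map block (map deck_card vertex_list)) ! ?x = block (map deck_card vertex_list ! i) ! r"
    by (rule nth_concat_map[OF block_length]) (use assms length_vertex_list in auto)
  have arr: "array_of (y # ys) (1 + int x) = (if x < length ys then ys ! x else 0)" for y ys x
    by (simp add: array_of_def nat_add_distrib)
  show ?thesis
    unfolding encoded_deck arr len if_P[OF less] nth using assms(1) length_vertex_list by simp
qed

lemma coeff_bound:
  assumes "B \<in> carrier_mat m m" "m \<le> n" "\<And>i j. i < m \<Longrightarrow> j < m \<Longrightarrow> \<bar>B $$ (i,j)\<bar> \<le> 1"
  shows "\<bar>rev_coeff (char_poly B) j\<bar> \<le> 2 ^ (4 * n * n)"
proof -
  have "\<bar>coeff (char_poly B) k\<bar> \<le> fact m * 2 ^ m" for k by (rule char_poly_coeff_bound[OF assms(1,3)])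
  then have "\<bar>rev_coeff (char_poly B) j\<bar> \<le> fact m * 2 ^ m" by (simp add: coeff_reflect_poly)
  also have "\<dots> \<le> fact n * 2 ^ n" using assms(2) by (intro mult_mono fact_mono power_increasing) auto
  also have "\<dots> \<le> 2 ^ (4 * n * n)" by (rule power_bounds(1)[OF n3])
  finally show ?thesis .
qed

lemma delete_abs: "i < n - 1 \<Longrightarrow> j < n - 1 \<Longrightarrow> m < n \<Longrightarrow> \<bar>mat_delete A m m $$ (i,j)\<bar> \<le> 1"
  using A_carrier by (simp add: mat_delete_def A_abs)

lemma minor_coeff_bound: "m < n \<Longrightarrow> \<bar>rev_coeff (char_poly (mat_delete A m m)) j\<bar> \<le> 2 ^ (4 * n * n)"
  by (rule coeff_bound[OF delete_carrier]) (auto simp: delete_abs)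

lemma c_coeff_bound: "i < n \<Longrightarrow> \<bar>c_coeff i l\<bar> \<le> 2 ^ (4 * n * n)"
  unfolding c_coeff_def using coeff_bound[OF co_card_carrier[OF vertex_list_nth(2)]] co_card_abs[OF _ _ vertex_list_nth(2)] by simp

lemma walks_bound:
  assumes "i < n" "j \<le> n + 1"
  shows "int n * \<bar>walks j i\<bar> \<le> 2 ^ (4 * n * n)"
proof -
  have "int n * \<bar>walks j i\<bar> \<le> int n * int n ^ j"
    using walk_count_bound[OF A_carrier A_abs assms(1)] by (intro mult_left_mono) auto
  also have "\<dots> = int n ^ (j + 1)" by simp
  also have "\<dots> \<le> int n ^ (n + 2)" using assms n3 by (intro power_increasing) auto
  also have "\<dots> \<le> 2 ^ (4 * n * n)" by (rule power_bounds(2)[OF n3])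
  finally show ?thesis .
qed

lemma n_le_power: "int n \<le> 2 ^ (4 * n * n)"
  using walks_bound[of 0 0] n3 by simp

lemma input_bound: "\<bar>array_of (encode_deck ds) x\<bar> \<le> 2 ^ (4 * n * n)"
proof -
  have trunc: "int trunc \<le> 2 ^ (4 * n * n)" using n_le_power by (simp add: trunc_def)
  have "\<bar>y\<bar> \<le> 2 ^ (4 * n * n)" if "y \<in> set (encode_deck ds)" for y
  proof -
    from that have "y = int n \<or> (\<exists>i<n. y \<in> set (block (deck_card (vertex_list ! i))))"
      unfolding encoded_deck list.set insert_iff set_concat_map_nth length_map length_vertex_list
      by (metis length_vertex_list nth_map)
    then consider "y = int n" | i where "i < n" "y \<in> set (block (deck_card (vertex_list ! i)))" by blast
    then show ?thesis
    proof cases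
      case (2 i)
      then show ?thesis unfolding block_deck_card[OF 2(1)]
        using n_le_power trunc minor_coeff_bound[OF vertex_list_nth(2)[OF 2(1)]] c_coeff_bound[OF 2(1)] by auto
    qed (use n_le_power in simp)
  qed
  then show ?thesis unfolding array_of_def by auto
qed

text \<open>
  The bound \<open>2 ^ (4 * n * n)\<close> covers walk counts, which are at most \<open>n ^ (n + 2)\<close>, and coefficients of
  characteristic polynomials, which are at most \<open>n! * 2 ^ n\<close>.
\<close>

sublocale D: deck_data n trunc "(n + 1) div 2" "4 * n * n" "array_of (encode_deck ds)" "rev_coeff (char_poly A)"
  "\<lambda>i. rev_coeff (char_poly (mat_delete A (vertex i) (vertex i)))" c_coeff total_walks "\<lambda>i j. walks j (vertex i)"
proof
  let ?inp = "array_of (encode_deck ds)"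
  have n0: "0 < n" using n3 by simp
  show "?inp 0 = int n" by (simp add: array_of_def encoded_deck)
  show "?inp (int n + 2) = int trunc"
  proof -
    have "(block (deck_card (vertex_list ! 0))) ! (n + 1) = int trunc"
      unfolding block_deck_card[OF n0] by (simp add: nth_append del: upt_Suc)
    moreover have "int n + 2 = 1 + int (0 * (n + trunc + 2) + (n + 1))" by simp
    ultimately show ?thesis using input_at[OF n0, of "n + 1"] by (simp add: add.commute)
  qed
  show "?inp (int i * int (n + trunc + 2) + int n + 1 - int j) = rev_coeff (char_poly (mat_delete A (vertex i) (vertex i))) j"
    if "i < n" "j < n" for i j
  proof -
    have "Suc (n - 1 - j) = n - j" "n - 1 - (n - 1 - j) = j" "n - 1 - j < n" using that by auto
    then have "(block (deck_card (vertex_list ! i))) ! (n - j) = rev_coeff (char_poly (mat_delete A (vertex i) (vertex i))) j"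
      unfolding block_deck_card[OF that(1)] by (metis (no_types, lifting) append_Cons nth_Cons_Suc nth_append length_map length_upt diff_zero nth_map nth_upt add_0)
    moreover have idx: "int i * int (n + trunc + 2) + int n + 1 - int j = 1 + int (i * (n + trunc + 2) + (n - j))"
      using that by (simp add: of_nat_diff algebra_simps)
    ultimately show ?thesis unfolding idx by (subst input_at[OF that(1)]) simp_all
  qed
  show "?inp (int i * int (n + trunc + 2) + int n + 3 + int l) = c_coeff i l" if "i < n" "l < trunc" for i l
  proof -
    have "(block (deck_card (vertex_list ! i))) ! (n + 2 + l) = c_coeff i l"
      unfolding block_deck_card[OF that(1)] using that by (simp add: nth_append del: upt_Suc)
    moreover have idx: "int i * int (n + trunc + 2) + int n + 3 + int l = 1 + int (i * (n + trunc + 2) + (n + 2 + l))"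
      by (simp add: algebra_simps)
    ultimately show ?thesis unfolding idx using that by (subst input_at[OF that(1)]) simp_all
  qed
  show "int (n - j) * rev_coeff (char_poly A) j = (\<Sum>i<n. rev_coeff (char_poly (mat_delete A (vertex i) (vertex i))) j)" if "j < n" for j
    unfolding derivative_coeffs[OF that] sum_vertex[of "\<lambda>v. rev_coeff (char_poly (mat_delete A v v)) j"] ..
  show "total_walks 1 = - 2 * rev_coeff (char_poly A) 2"
    by (rule total_walks_1[OF n3]) (simp_all add: A_entry no_loop)
  show "total_walks (l + m) = (\<Sum>i<n. walks l (vertex i) * walks m (vertex i))" for l m
    unfolding total_walks_add sum_vertex[of "\<lambda>v. walks l v * walks m v"] ..
  show "(\<Sum>l\<le>j. (\<Sum>a\<le>l. walks a (vertex i) * walks (l - a) (vertex i)) * rev_coeff (char_poly A) (j - l))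
      = (\<Sum>l\<le>j. total_walks l * rev_coeff (char_poly (mat_delete A (vertex i) (vertex i))) (j - l))
        - (shift_coeff (n - 1) (c_coeff i) (Suc j) - rev_coeff (char_poly (mat_delete A (vertex i) (vertex i))) (Suc j))"
    if "i < n" "1 \<le> j" "j \<le> (n + 1) div 2" for i j
    using vertex_walks_identity[OF vertex_list_nth(2)[OF that(1)], of j] card_complement_coeffs[OF that(1), of "Suc j"] that(3)
    by (simp add: atLeast0AtMost)
  show "(\<Sum>l\<le>n. rev_coeff (char_poly A) l * total_walks (n - l)) = 0"
    using cayley_hamilton_for_total_walks[OF n0] by (simp add: atLeast0AtMost)
  show "\<bar>total_walks j\<bar> \<le> 2 ^ (4 * n * n)" if "j \<le> n + 1" for j
  proof -
    have "\<bar>total_walks j\<bar> \<le> (\<Sum>i<n. \<bar>walks j i\<bar>)" unfolding total_walks_def by (rule sum_abs)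
    also have "\<dots> \<le> (\<Sum>i<n. int n ^ j)"
      by (rule sum_mono) (use walk_count_bound[OF A_carrier A_abs] in auto)
    also have "\<dots> = int n ^ (j + 1)" by simp
    also have "\<dots> \<le> int n ^ (n + 2)" using that n3 by (intro power_increasing) auto
    also have "\<dots> \<le> 2 ^ (4 * n * n)" by (rule power_bounds(2)[OF n3])
    finally show ?thesis .
  qed
  show "\<bar>walks j (vertex i)\<bar> \<le> 2 ^ (4 * n * n)" if "i < n" "j \<le> n" for i j
  proof -
    have "1 * \<bar>walks j (vertex i)\<bar> \<le> int n * \<bar>walks j (vertex i)\<bar>" using n3 by (intro mult_right_mono) auto
    then show ?thesis using walks_bound[OF vertex_list_nth(2)[OF that(1)], of j] that by linarith
  qed
  show "rev_coeff (char_poly (mat_delete A (vertex i) (vertex i))) n = 0" if "i < n" for i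
    by (rule rev_coeff_beyond_dim[OF delete_carrier]) (use n3 in simp)
  show "\<bar>rev_coeff (char_poly A) j\<bar> \<le> 2 ^ (4 * n * n)" for j by (rule coeff_bound[OF A_carrier]) (auto simp: A_abs)
  show "\<bar>rev_coeff (char_poly (mat_delete A (vertex i) (vertex i))) j\<bar> \<le> 2 ^ (4 * n * n)" if "i < n" for i j
    by (rule minor_coeff_bound[OF vertex_list_nth(2)[OF that]])
  show "n + 4 \<le> 4 * n * n" by (rule power_bounds(3)[OF n3])
qed (use n3 c_coeff_bound rev_coeff_0[OF A_carrier] in
  \<open>auto simp: trunc_def c_coeff_def total_walks_def simp del: coeff_0_reflect_poly\<close>)


lemma complement_carrier: "adjacency_matrix (complement_graph G) \<in> carrier_mat n n"
  using adjacency_matrix_carrier[of "complement_graph G"] by (simp add: complement_graph_def verts)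

lemma ones_coeff_eq: "D.ones_coeff j = rev_coeff (char_poly (minus_ones A)) j"
proof (cases j)
  case 0
  have "minus_ones A \<in> carrier_mat n n" using A_carrier by (simp add: minus_ones_def)
  then show ?thesis unfolding 0 D.ones_coeff.simps by (rule rev_coeff_0[symmetric])
next
  case (Suc k)
  then show ?thesis using minus_ones_coeffs[of k] n3
    by (simp only: D.ones_coeff.simps atLeast0AtMost lessThan_Suc_atMost)
qed

lemma result_list_eq:
  "D.result_list = encode_poly_pair (graph_char_poly G, graph_char_poly (complement_graph G))"
proof -
  let ?B = "adjacency_matrix (complement_graph G)"
  have M: "minus_ones A \<in> carrier_mat n n" using A_carrier by (simp add: minus_ones_def)
  have entry: "?B $$ (i,j) = - minus_ones A $$ (i,j) - (if i = j then 1 else 0)" if "i < n" "j < n" for i j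
    unfolding A_def by (rule adjacency_matrix_complement) (use that no_loop in \<open>simp_all add: verts\<close>)
  have "rev_coeff (char_poly ?B) j = shift_coeff n (rev_coeff (char_poly (minus_ones A))) j" for j
    by (rule reflected_matrix_coeffs[OF M complement_carrier]) (rule entry)
  moreover have "D.ones_coeff = rev_coeff (char_poly (minus_ones A))" using ones_coeff_eq by blast
  ultimately have shift: "shift_coeff n D.ones_coeff j = rev_coeff (char_poly ?B) j" for j by simp
  note coeffs = coeffs_conv_reflect[OF degree_char_poly[OF complement_carrier]]
    coeffs_conv_reflect[OF degree_char_poly[OF A_carrier]]
  show ?thesis
    by (simp only: D.result_list_def encode_poly_pair_def encode_poly_def graph_char_poly_def
        A_def[symmetric] coeffs shift prod.case)
qed

lemma computes_char_polys:
  "computes_within reconstruct (encode_deck ds)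
     (encode_poly_pair (graph_char_poly G, graph_char_poly (complement_graph G)))
     (com_cost (n + 2) (8 * (4 * n * n)) reconstruct)"
proof -
  let ?s = "initial_state (encode_deck ds)"
  have "run (n + 2) (8 * (4 * n * n)) reconstruct ?s (\<lambda>s'. s' ''out'' = array_of D.result_list)"
    by (rule D.run_reconstruct) (simp_all add: initial_state_def)
  moreover have "fits (8 * (4 * n * n)) ?s"
    unfolding fits_def
  proof (intro allI)
    fix x i
    have "\<bar>?s x i\<bar> \<le> 2 ^ (4 * n * n)" using input_bound[of i] by (simp add: initial_state_def)
    also have "(2::int) ^ (4 * n * n) < 2 ^ (8 * (4 * n * n))"
      using n3 by (intro power_strict_increasing) simp_all
    finally show "\<bar>?s x i\<bar> < 2 ^ (8 * (4 * n * n))" .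
  qed
  ultimately show ?thesis unfolding run_def computes_within_def result_list_eq by blast
qed

end

lemma array_of_inject: "array_of xs = array_of ys \<Longrightarrow> length xs = length ys \<Longrightarrow> xs = ys"
proof (rule nth_equalityI)
  fix i assume eq: "array_of xs = array_of ys" and len: "length xs = length ys" "i < length xs"
  from fun_cong[OF eq, of "int i"] len show "xs ! i = ys ! i" by (simp add: array_of_def)
qed

lemma encode_poly_pair_inject:
  assumes "array_of (encode_poly_pair (p, q)) = array_of (encode_poly_pair (p', q'))"
    and "length (coeffs p) = length (coeffs p')" "length (coeffs q) = length (coeffs q')"
  shows "p = p' \<and> q = q'"
proof -
  have "encode_poly_pair (p, q) = encode_poly_pair (p', q')"
    by (rule array_of_inject[OF assms(1)])
      (use assms(2,3) in \<open>simp add: encode_poly_pair_def encode_poly_def encode_ints_def\<close>)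
  then show ?thesis using assms(2,3)
    by (simp add: encode_poly_pair_def encode_poly_def encode_ints_def coeffs_eq_iff)
qed

lemma length_coeffs_graph_char_poly: "length (coeffs (graph_char_poly G)) = card (pverts G) + 1"
proof -
  have "degree (graph_char_poly G) = card (pverts G)" "graph_char_poly G \<noteq> 0"
    unfolding graph_char_poly_def by (rule degree_char_poly[OF adjacency_matrix_carrier])+
  then show ?thesis by (simp add: length_coeffs_degree)
qed

theorem theorem4:
  shows
    "(\<exists>(c :: com) (C :: nat) (d :: nat).
        \<forall>n\<ge>3. \<forall>G :: nat pair_pre_digraph. pair_graph G \<and> pverts G = {1..n} \<longrightarrow>
          (\<forall>ds. mset ds = truncated_deck (num_top_coeffs n) G \<longrightarrow>
             computes_within c (encode_deck ds)
               (encode_poly_pair (graph_char_poly G, graph_char_poly (complement_graph G)))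
               (C * n ^ d)))
     \<and> (\<forall>n\<ge>3. \<forall>G H :: nat pair_pre_digraph.
          pair_graph G \<and> pverts G = {1..n} \<and> pair_graph H \<and> pverts H = {1..n} \<and>
          truncated_deck (num_top_coeffs n) G = truncated_deck (num_top_coeffs n) H \<longrightarrow>
          graph_char_poly G = graph_char_poly H \<and>
          graph_char_poly (complement_graph G) = graph_char_poly (complement_graph H))"
proof (intro conjI)
  let ?L = "\<lambda>n. 8 * (4 * n * n)"
  have "poly_bounded (\<lambda>n. n)"
    unfolding poly_bounded_def by (rule exI[of _ 1], rule exI[of _ 1]) simp
  then have "poly_bounded (\<lambda>n. com_cost (n + 2) (?L n) reconstruct)"
    by (intro poly_bounded_com_cost poly_bounded_add poly_bounded_mult poly_bounded_const)
  then obtain C d where cost: "\<And>n. n \<ge> 1 \<Longrightarrow> com_cost (n + 2) (?L n) reconstruct \<le> C * n ^ d"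
    unfolding poly_bounded_def by blast
  show "\<exists>(c :: com) (C :: nat) (d :: nat).
        \<forall>n\<ge>3. \<forall>G :: nat pair_pre_digraph. pair_graph G \<and> pverts G = {1..n} \<longrightarrow>
          (\<forall>ds. mset ds = truncated_deck (num_top_coeffs n) G \<longrightarrow>
             computes_within c (encode_deck ds)
               (encode_poly_pair (graph_char_poly G, graph_char_poly (complement_graph G)))
               (C * n ^ d))"
  proof (intro exI allI impI)
    fix n :: nat and G :: "nat pair_pre_digraph" and ds
    assume "3 \<le> n" "pair_graph G \<and> pverts G = {1..n}" "mset ds = truncated_deck (num_top_coeffs n) G"
    then interpret graph_deck n G ds by (intro graph_deck.intro) blast+
    show "computes_within reconstruct (encode_deck ds)
        (encode_poly_pair (graph_char_poly G, graph_char_poly (complement_graph G))) (C * n ^ d)"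
      using computes_char_polys cost[of n] n3 unfolding computes_within_def by fastforce
  qed
  show "\<forall>n\<ge>3. \<forall>G H :: nat pair_pre_digraph.
          pair_graph G \<and> pverts G = {1..n} \<and> pair_graph H \<and> pverts H = {1..n} \<and>
          truncated_deck (num_top_coeffs n) G = truncated_deck (num_top_coeffs n) H \<longrightarrow>
          graph_char_poly G = graph_char_poly H \<and>
          graph_char_poly (complement_graph G) = graph_char_poly (complement_graph H)"
  proof (intro allI impI, elim conjE)
    fix n :: nat and G H :: "nat pair_pre_digraph"
    assume n: "3 \<le> n" and G: "pair_graph G" "pverts G = {1..n}" and H: "pair_graph H" "pverts H = {1..n}"
      and same: "truncated_deck (num_top_coeffs n) G = truncated_deck (num_top_coeffs n) H"
    obtain ds where ds: "mset ds = truncated_deck (num_top_coeffs n) G" using ex_mset by blast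
    interpret G: graph_deck n G ds using n G ds by (intro graph_deck.intro)
    interpret H: graph_deck n H ds using n H ds[unfolded same] by (intro graph_deck.intro)
    have "array_of (encode_poly_pair (graph_char_poly G, graph_char_poly (complement_graph G)))
        = array_of (encode_poly_pair (graph_char_poly H, graph_char_poly (complement_graph H)))"
      using G.computes_char_polys H.computes_char_polys exec_deterministic
      unfolding computes_within_def by metis
    then show "graph_char_poly G = graph_char_poly H \<and>
          graph_char_poly (complement_graph G) = graph_char_poly (complement_graph H)"
      by (rule encode_poly_pair_inject)
        (simp_all add: length_coeffs_graph_char_poly complement_graph_def G(2) H(2))
  qed
qed

end
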